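(* Let $k$ be a field of characteristic zero, let $n\ge 1$, and let $M$ be a bimodule over the Weyl algebra $A_n(k)$. (i) If $M$ is finitely generated as a left $A_n(k)$-module or finitely generated as a right $A_n(k)$-module, then $M$ is holonomic (as a bimodule). (ii) If $M$ is non-zero and cyclic as a left (respectively right) $A_n(k)$-module, then $M$ is free as a left (respectively right) $A_n(k)$-module and $M$ is irreducible (simple) as a bimodule.
   Context: For a field $k$, the Weyl algebra $A_n(k)$ is the $k$-algebra generated by $x_1,\dots,x_n,\partial_1,\dots,\partial_n$ with relations $[x_i,x_j]=0$, $[\partial_i,\partial_j]=0$, $[\partial_i,x_j]=\delta_{ij}$. The monomials $x^\alpha\partial^\beta$ ($\alpha,\beta\in\mathbb{N}^n$) form a $k$-basis; the degree of $x^\alpha\partial^\beta$ is $|\alpha|+|\beta|$, and $B^n_m$ denotes the $k$-span of monomials of degree $\le m$ (Bernstein filtration). A bimodule over a $k$-algebra $A$ is a $k$-vector space $M$ with left and right $A$-module structures compatible with the $k$-vector space structure such that $(a_1m)a_2=a_1(ma_2)$. Bimodules over $A_n(k)$ are identified with left $A_{2n}(k)$-modules via $x_i\cdot m=x_im$, $\partial_i\cdot m=\partial_i m$, $x_{n+i}\cdot m=mx_i$, $\partial_{n+i}\cdot m=-m\partial_i$ for $1\le i\le n$. For $k$ of characteristic zero and a finitely generated left $A_N(k)$-module $M\ne0$ with finite generating set $m_1,\dots,m_r$, put $\Gamma_i=B^N_im_1+\cdots+B^N_im_r$. For $i\gg0$, $\dim_k\Gamma_i$ equals $p(i)$ for a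 polynomial $p=\frac{e}{d!}x^d+\cdots$, where $d=\dim(M)$ (the dimension) and $e$ are independent of the choice of generators. $M$ is called holonomic if it is finitely generated and either $M=0$ or $\dim(M)=N$. A bimodule over $A_n(k)$ is called holonomic if it is holonomic as a left $A_{2n}(k)$-module. *)

theory Defs
  imports Complex_Main "HOL-Library.Poly_Mapping" "HOL-Library.Function_Algebras"
    "HOL-Library.Cardinality"
    "HOL-Computational_Algebra.Polynomial"
begin

section \<open>The free algebra\<close>

datatype 'g free_monoid = Word "'g list"

instantiation free_monoid :: (type) monoid_add
begin

definition zero_free_monoid :: "'a free_monoid" where
  "0 = Word []"

fun plus_free_monoid :: "'a free_monoid \<Rightarrow> 'a free_monoid \<Rightarrow> 'a free_monoid" where
  "Word u + Word v = Word (u @ v)"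

instance
proof
  fix a b c :: "'a free_monoid"
  show "a + b + c = a + (b + c)" by (cases a; cases b; cases c) simp
  show "0 + a = a" by (cases a) (simp add: zero_free_monoid_def)
  show "a + 0 = a" by (cases a) (simp add: zero_free_monoid_def)
qed

end

text \<open>The monoid algebra of the free monoid on \<open>'g\<close> is the free associative algebra on \<open>'g\<close>;
  its product is the convolution product of \<^type>\<open>poly_mapping\<close>.\<close>

type_synonym ('k, 'g) free_algebra = "'g free_monoid \<Rightarrow>\<^sub>0 'k"

definition free_var :: "'g \<Rightarrow> ('k::ring_1, 'g) free_algebra" where
  "free_var g = Poly_Mapping.single (Word [g]) 1"

definition free_scale :: "'k \<Rightarrow> ('k, 'g) free_algebra \<Rightarrow> ('k::ring_1, 'g) free_algebra" where
  "free_scale c p = Poly_Mapping.single 0 c * p"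

fun word_act :: "('g \<Rightarrow> 'm \<Rightarrow> 'm) \<Rightarrow> 'g free_monoid \<Rightarrow> 'm \<Rightarrow> 'm" where
  "word_act opr (Word l) m = foldr opr l m"

definition free_act ::
    "('k \<Rightarrow> 'm \<Rightarrow> 'm) \<Rightarrow> ('g \<Rightarrow> 'm \<Rightarrow> 'm) \<Rightarrow> ('k::ring_1, 'g) free_algebra \<Rightarrow> 'm \<Rightarrow> 'm::ab_group_add" where
  "free_act scale opr p m =
     (\<Sum>w\<in>Poly_Mapping.keys p. scale (Poly_Mapping.lookup p w) (word_act opr w m))"

lemma free_algebra_induct [case_names single add]:
  fixes p :: "'a \<Rightarrow>\<^sub>0 'b::comm_monoid_add"
  assumes "\<And>k v. P (Poly_Mapping.single k v)"
    and "\<And>p q. P p \<Longrightarrow> P q \<Longrightarrow> P (p + q)"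
  shows "P p"
proof (induction p rule: update_induct)
  case const
  then show ?case using assms(1)[of undefined 0] by simp
next
  case (update f a b)
  have "Poly_Mapping.update a b f = f + Poly_Mapping.single a b"
    using update(1)
    by (intro poly_mapping_eqI)
      (auto simp: lookup_update lookup_add lookup_single in_keys_iff when_def)
  then show ?case using assms update by auto
qed

locale linear_operators = vector_space scale
  for scale :: "'k::field \<Rightarrow> 'm::ab_group_add \<Rightarrow> 'm" +
  fixes opr :: "'g \<Rightarrow> 'm \<Rightarrow> 'm"
  assumes opr_add: "opr g (u + v) = opr g u + opr g v"
    and opr_scale: "opr g (scale c v) = scale c (opr g v)"
begin

lemma word_add: "word_act opr w (u + v) = word_act opr w u + word_act opr w v"
proof (cases w)
  case (Word l)
  have "foldr opr l (u + v) = foldr opr l u + foldr opr l v"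
    by (induction l) (auto simp: opr_add)
  then show ?thesis using Word by simp
qed

lemma word_scale: "word_act opr w (scale c v) = scale c (word_act opr w v)"
proof (cases w)
  case (Word l)
  have "foldr opr l (scale c v) = scale c (foldr opr l v)"
    by (induction l) (auto simp: opr_scale)
  then show ?thesis using Word by simp
qed

lemma word_plus: "word_act opr (u + w) m = word_act opr u (word_act opr w m)"
  by (cases u; cases w) simp

lemma free_act_superset:
  assumes "finite A" "Poly_Mapping.keys p \<subseteq> A"
  shows "free_act scale opr p m = (\<Sum>w\<in>A. scale (Poly_Mapping.lookup p w) (word_act opr w m))"
  unfolding free_act_def using assms
  by (intro sum.mono_neutral_left) (auto simp: in_keys_iff)

lemma free_act_single:
  "free_act scale opr (Poly_Mapping.single w c) m = scale c (word_act opr w m)"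
  by (subst free_act_superset[of "{w}"]) auto

lemma free_act_plus: "free_act scale opr (p + q) m = free_act scale opr p m + free_act scale opr q m"
proof -
  let ?A = "Poly_Mapping.keys p \<union> Poly_Mapping.keys q"
  have "finite ?A" "Poly_Mapping.keys (p + q) \<subseteq> ?A"
    by (auto simp: Poly_Mapping.keys_add)
  then show ?thesis
    by (simp add: free_act_superset[of ?A] lookup_add scale_left_distrib sum.distrib)
qed

lemma free_act_zero: "free_act scale opr 0 m = 0"
  by (simp add: free_act_def)

lemma free_act_minus: "free_act scale opr (p - q) m = free_act scale opr p m - free_act scale opr q m"
  by (metis add_diff_cancel diff_add_cancel free_act_plus)

lemma free_act_add: "free_act scale opr p (u + v) = free_act scale opr p u + free_act scale opr p v"
  by (simp add: free_act_def word_add scale_right_distrib sum.distrib)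

lemma free_act_scale: "free_act scale opr p (scale c v) = scale c (free_act scale opr p v)"
  by (simp add: free_act_def word_scale scale_sum_right mult.commute)

lemma free_act_times: "free_act scale opr (p * q) m = free_act scale opr p (free_act scale opr q m)"
proof (induction p rule: free_algebra_induct)
  case (single w c)
  show ?case
  proof (induction q rule: free_algebra_induct)
    case (single w' c')
    then show ?case
      by (simp add: mult_single free_act_single word_plus word_scale)
  next
    case (add p q)
    then show ?case by (simp add: distrib_left free_act_plus free_act_add)
  qed
next
  case (add p q)
  then show ?case by (simp add: distrib_right free_act_plus)
qed

lemma free_act_var: "free_act scale opr (free_var g) m = opr g m"
  by (simp add: free_var_def free_act_single)

lemma free_act_one: "free_act scale opr 1 m = m"
proof -
  have "free_act scale opr (Poly_Mapping.single 0 1) m = m"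
    unfolding free_act_single by (simp add: zero_free_monoid_def)
  then show ?thesis by simp
qed

lemma free_act_free_scale: "free_act scale opr (free_scale c p) m = scale c (free_act scale opr p m)"
  by (simp add: free_scale_def free_act_times free_act_single zero_free_monoid_def)

end


section \<open>The Weyl algebra\<close>

text \<open>The index type \<open>'n\<close> plays the role of \<open>{1, \<dots>, n}\<close>, and \<open>'n + 'n\<close> that of
  \<open>{1, \<dots>, 2n}\<close>, with \<^term>\<open>Inl i\<close> standing for \<open>i\<close> and \<^term>\<open>Inr i\<close> for \<open>n + i\<close>.\<close>

datatype 'n weyl_gen = GX 'n | GD 'n

definition weyl_relators :: "('k::ring_1, 'n weyl_gen) free_algebra set" where
  "weyl_relators =
     {free_var (GX i) * free_var (GX j) - free_var (GX j) * free_var (GX i) | i j. True} \<union>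
     {free_var (GD i) * free_var (GD j) - free_var (GD j) * free_var (GD i) | i j. True} \<union>
     {free_var (GD i) * free_var (GX j) - free_var (GX j) * free_var (GD i)
        - (if i = j then 1 else 0) | i j. True}"

definition two_sided_ideal :: "'a::ring_1 set \<Rightarrow> bool" where
  "two_sided_ideal I \<longleftrightarrow>
     0 \<in> I \<and> (\<forall>a\<in>I. \<forall>b\<in>I. a + b \<in> I) \<and> (\<forall>a\<in>I. \<forall>r. r * a \<in> I \<and> a * r \<in> I)"

definition weyl_ideal :: "('k::ring_1, 'n weyl_gen) free_algebra set" where
  "weyl_ideal = two_sided_ideal hull weyl_relators"

lemma two_sided_ideal_weyl_ideal: "two_sided_ideal weyl_ideal"
  unfolding weyl_ideal_def by (rule hull_in) (auto simp: two_sided_ideal_def)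

lemma weyl_ideal_closed:
  "0 \<in> weyl_ideal"
  "a \<in> weyl_ideal \<Longrightarrow> b \<in> weyl_ideal \<Longrightarrow> a + b \<in> weyl_ideal"
  "a \<in> weyl_ideal \<Longrightarrow> r * a \<in> weyl_ideal"
  "a \<in> weyl_ideal \<Longrightarrow> a * r \<in> weyl_ideal"
  using two_sided_ideal_weyl_ideal unfolding two_sided_ideal_def by auto

lemma weyl_ideal_uminus: "a \<in> weyl_ideal \<Longrightarrow> - a \<in> weyl_ideal"
  using weyl_ideal_closed(3)[of a "- 1"] by simp

lemma weyl_ideal_diff: "a \<in> weyl_ideal \<Longrightarrow> b \<in> weyl_ideal \<Longrightarrow> a - b \<in> weyl_ideal"
  using weyl_ideal_closed(2)[of a "- b"] weyl_ideal_uminus[of b] by simp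

lemma weyl_relators_in_ideal: "a \<in> weyl_relators \<Longrightarrow> a \<in> weyl_ideal"
  by (simp add: hull_inc weyl_ideal_def)

definition weyl_eq :: "('k::ring_1, 'n weyl_gen) free_algebra \<Rightarrow> ('k, 'n weyl_gen) free_algebra \<Rightarrow> bool" where
  "weyl_eq p q \<longleftrightarrow> p - q \<in> weyl_ideal"

lemma equivp_weyl_eq:
  "equivp (weyl_eq :: ('a::ring_1, 'b weyl_gen) free_algebra \<Rightarrow> _)"
proof (rule equivpI)
  show "reflp (weyl_eq :: ('a, 'b weyl_gen) free_algebra \<Rightarrow> _)"
    by (auto simp: reflp_def weyl_eq_def weyl_ideal_closed)
  show "symp (weyl_eq :: ('a, 'b weyl_gen) free_algebra \<Rightarrow> _)"
  proof (rule sympI)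
    fix p q :: "('a, 'b weyl_gen) free_algebra"
    assume "weyl_eq p q"
    then show "weyl_eq q p"
      using weyl_ideal_uminus[of "p - q"] by (simp add: weyl_eq_def)
  qed
  show "transp (weyl_eq :: ('a, 'b weyl_gen) free_algebra \<Rightarrow> _)"
  proof (rule transpI)
    fix p q r :: "('a, 'b weyl_gen) free_algebra"
    assume "weyl_eq p q" "weyl_eq q r"
    then show "weyl_eq p r"
      using weyl_ideal_closed(2)[of "p - q" "q - r"] by (simp add: weyl_eq_def)
  qed
qed

quotient_type (overloaded) ('k, 'n) weyl = "('k::field, 'n weyl_gen) free_algebra" / weyl_eq
  by (rule equivp_weyl_eq)

text \<open>Linear operators satisfying the Weyl relations.\<close>

locale weyl_operators = linear_operators scale "case_weyl_gen ox od"
  for scale :: "'k::field \<Rightarrow> 'm::ab_group_add \<Rightarrow> 'm"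
    and ox od :: "'n \<Rightarrow> 'm \<Rightarrow> 'm" +
  assumes ox_ox: "ox i (ox j v) = ox j (ox i v)"
    and od_od: "od i (od j v) = od j (od i v)"
    and od_ox: "od i (ox j v) = ox j (od i v) + (if i = j then v else 0)"
begin

abbreviation "weval \<equiv> free_act scale (case_weyl_gen ox od)"

lemma weyl_ideal_acts_zero:
  assumes "p \<in> weyl_ideal"
  shows "weval p v = 0"
proof -
  have "weyl_ideal \<subseteq> {p. \<forall>v. weval p v = 0}"
    unfolding weyl_ideal_def
  proof (rule hull_minimal)
    show "weyl_relators \<subseteq> {p. \<forall>v. weval p v = 0}"
      by (auto simp: weyl_relators_def free_act_minus free_act_times free_act_var free_act_one
          free_act_zero ox_ox od_od od_ox)
    have z: "weval p 0 = 0" for p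
      using free_act_scale[of p 0 0] by simp
    show "two_sided_ideal {p. \<forall>v. weval p v = 0}"
      by (auto simp: two_sided_ideal_def free_act_plus free_act_times free_act_zero z)
  qed
  then show ?thesis using assms by auto
qed

lemma free_act_weyl_eq: "weyl_eq p q \<Longrightarrow> weval p v = weval q v"
  using weyl_ideal_acts_zero[of "p - q" v] by (simp add: weyl_eq_def free_act_minus)

end

text \<open>The action on formal power series, given by their coefficient functions; it shows that the
  presented algebra is not the zero ring.\<close>

definition series_x :: "'n \<Rightarrow> (('n \<Rightarrow> nat) \<Rightarrow> 'k) \<Rightarrow> ('n \<Rightarrow> nat) \<Rightarrow> 'k::field" where
  "series_x i f = (\<lambda>\<alpha>. if \<alpha> i = 0 then 0 else f (\<alpha>(i := \<alpha> i - 1)))"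

definition series_d :: "'n \<Rightarrow> (('n \<Rightarrow> nat) \<Rightarrow> 'k) \<Rightarrow> ('n \<Rightarrow> nat) \<Rightarrow> 'k::field" where
  "series_d i f = (\<lambda>\<alpha>. of_nat (\<alpha> i + 1) * f (\<alpha>(i := \<alpha> i + 1)))"

lemma weyl_operators_series:
  "weyl_operators (\<lambda>(c::'k::field) f \<alpha>. c * f \<alpha>) (series_x :: 'n \<Rightarrow> _) series_d"
proof
  fix a b :: 'k and u v :: "('n \<Rightarrow> nat) \<Rightarrow> 'k" and g :: "'n weyl_gen" and i j :: 'n
  show "(\<lambda>\<alpha>. a * (u + v) \<alpha>) = (\<lambda>\<alpha>. a * u \<alpha>) + (\<lambda>\<alpha>. a * v \<alpha>)"
    by (auto simp: algebra_simps)
  show "(\<lambda>\<alpha>. (a + b) * u \<alpha>) = (\<lambda>\<alpha>. a * u \<alpha>) + (\<lambda>\<alpha>. b * u \<alpha>)"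
    by (auto simp: algebra_simps)
  show "(\<lambda>\<alpha>. a * (b * u \<alpha>)) = (\<lambda>\<alpha>. a * b * u \<alpha>)"
    by (auto simp: algebra_simps)
  show "(\<lambda>\<alpha>. 1 * u \<alpha>) = u" by simp
  show "case_weyl_gen series_x series_d g (u + v) =
      case_weyl_gen series_x series_d g u + case_weyl_gen series_x series_d g v"
    by (cases g) (auto simp: series_x_def series_d_def algebra_simps)
  show "case_weyl_gen series_x series_d g (\<lambda>\<alpha>. a * u \<alpha>) =
      (\<lambda>\<alpha>. a * case_weyl_gen series_x series_d g u \<alpha>)"
    by (cases g) (auto simp: series_x_def series_d_def algebra_simps)
  show "series_x i (series_x j u) = series_x j (series_x i u)"
    by (cases "i = j") (auto simp: series_x_def fun_upd_twist)
  show "series_d i (series_d j u) = series_d j (series_d i u)"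
    by (cases "i = j") (auto simp: series_d_def fun_upd_twist)
  show "series_d i (series_x j u) = series_x j (series_d i u) + (if i = j then u else 0)"
  proof (cases "i = j")
    case True
    then show ?thesis
      by (auto simp: series_d_def series_x_def fun_eq_iff algebra_simps)
  next
    case False
    then show ?thesis
      by (auto simp: series_d_def series_x_def fun_upd_twist)
  qed
qed

lemma one_notin_weyl_ideal: "(1 :: ('k::field, 'n weyl_gen) free_algebra) \<notin> weyl_ideal"
proof
  assume *: "(1 :: ('k, 'n weyl_gen) free_algebra) \<in> weyl_ideal"
  interpret weyl_operators "\<lambda>(c::'k) f \<alpha>. c * f \<alpha>" "series_x :: 'n \<Rightarrow> _" series_d
    by (rule weyl_operators_series)
  have "(\<lambda>_. 1) = (0 :: ('n \<Rightarrow> nat) \<Rightarrow> 'k)"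
    using weyl_ideal_acts_zero[OF *, of "\<lambda>_. 1"] by (simp only: free_act_one)
  then show False by (simp add: fun_eq_iff)
qed

instantiation weyl :: (field, type) ring_1
begin

lift_definition zero_weyl :: "('a, 'b) weyl" is 0 .
lift_definition one_weyl :: "('a, 'b) weyl" is 1 .

lift_definition plus_weyl :: "('a, 'b) weyl \<Rightarrow> ('a, 'b) weyl \<Rightarrow> ('a, 'b) weyl" is "(+)"
  unfolding weyl_eq_def by (metis add_diff_add weyl_ideal_closed(2))

lift_definition uminus_weyl :: "('a, 'b) weyl \<Rightarrow> ('a, 'b) weyl" is uminus
  unfolding weyl_eq_def by (metis minus_diff_minus weyl_ideal_uminus)

lift_definition minus_weyl :: "('a, 'b) weyl \<Rightarrow> ('a, 'b) weyl \<Rightarrow> ('a, 'b) weyl" is "(-)"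
proof -
  fix a b c d :: "('a, 'b weyl_gen) free_algebra"
  assume "weyl_eq a b" "weyl_eq c d"
  moreover have "(a - c) - (b - d) = (a - b) - (c - d)" by simp
  ultimately show "weyl_eq (a - c) (b - d)"
    unfolding weyl_eq_def by (metis weyl_ideal_diff)
qed

lift_definition times_weyl :: "('a, 'b) weyl \<Rightarrow> ('a, 'b) weyl \<Rightarrow> ('a, 'b) weyl" is "(*)"
proof -
  fix a b c d :: "('a, 'b weyl_gen) free_algebra"
  assume "weyl_eq a b" "weyl_eq c d"
  moreover have "a * c - b * d = (a - b) * c + b * (c - d)" by (simp add: algebra_simps)
  ultimately show "weyl_eq (a * c) (b * d)"
    unfolding weyl_eq_def using weyl_ideal_closed by metis
qed

lemma weyl_eq_refl: "weyl_eq p p"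
  by (simp add: weyl_eq_def weyl_ideal_closed)

instance
proof
  fix a b c :: "('a, 'b) weyl"
  show "a * b * c = a * (b * c)" by transfer (simp add: mult.assoc weyl_eq_refl)
  show "1 * a = a" by transfer (simp add: weyl_eq_refl)
  show "a * 1 = a" by transfer (simp add: weyl_eq_refl)
  show "a + b + c = a + (b + c)" by transfer (simp add: add.assoc weyl_eq_refl)
  show "a + b = b + a" by transfer (simp add: add.commute weyl_eq_refl)
  show "0 + a = a" by transfer (simp add: weyl_eq_refl)
  show "- a + a = 0" by transfer (simp add: weyl_eq_refl)
  show "a - b = a + - b" by transfer (simp add: weyl_eq_refl)
  show "(a + b) * c = a * c + b * c" by transfer (simp add: distrib_right weyl_eq_refl)
  show "a * (b + c) = a * b + a * c" by transfer (simp add: distrib_left weyl_eq_refl)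
  show "(0 :: ('a, 'b) weyl) \<noteq> 1"
  proof transfer
    show "\<not> weyl_eq (0 :: ('a, 'b weyl_gen) free_algebra) 1"
      using weyl_ideal_uminus[of "- 1 :: ('a, 'b weyl_gen) free_algebra"] one_notin_weyl_ideal
      by (auto simp: weyl_eq_def)
  qed
qed

end

lemma single_zero_central:
  "Poly_Mapping.single 0 c * p = p * Poly_Mapping.single 0 c"
  for p :: "('k::field, 'g) free_algebra"
  by (induction p rule: free_algebra_induct)
    (auto simp: mult_single distrib_left distrib_right mult.commute)

lemma free_scale_mult_right: "a * free_scale c b = free_scale c (a * b)"
  for a :: "('k::field, 'g) free_algebra"
  unfolding free_scale_def
  by (simp add: mult.assoc[symmetric] single_zero_central[of c a])

lift_definition weyl_scale :: "'k::field \<Rightarrow> ('k, 'n) weyl \<Rightarrow> ('k, 'n) weyl" is free_scale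
  unfolding weyl_eq_def free_scale_def by (metis right_diff_distrib weyl_ideal_closed(3))

lift_definition wX :: "'n \<Rightarrow> ('k::field, 'n) weyl" is "\<lambda>i. free_var (GX i)" .
lift_definition wD :: "'n \<Rightarrow> ('k::field, 'n) weyl" is "\<lambda>i. free_var (GD i)" .

interpretation weyl: vector_space "weyl_scale :: 'k::field \<Rightarrow> ('k, 'n) weyl \<Rightarrow> ('k, 'n) weyl"
proof
  fix a b :: 'k and u v :: "('k, 'n) weyl"
  show "weyl_scale a (u + v) = weyl_scale a u + weyl_scale a v"
    by transfer (simp add: free_scale_def distrib_left weyl_eq_refl)
  show "weyl_scale (a + b) u = weyl_scale a u + weyl_scale b u"
    by transfer (simp add: free_scale_def distrib_right single_add weyl_eq_refl)
  show "weyl_scale a (weyl_scale b u) = weyl_scale (a * b) u"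
    by transfer (simp add: free_scale_def mult.assoc[symmetric] mult_single weyl_eq_refl)
  show "weyl_scale 1 u = u"
    by transfer (simp add: free_scale_def weyl_eq_refl)
qed

lemma weyl_scale_mult_left: "weyl_scale c a * b = weyl_scale c (a * b)"
  by transfer (simp add: free_scale_def mult.assoc weyl_eq_refl)

lemma weyl_scale_mult_right: "a * weyl_scale c b = weyl_scale c (a * b)"
  by transfer (simp add: free_scale_mult_right weyl_eq_refl)

lemma wX_wX: "wX i * wX j = wX j * wX i"
  by transfer (unfold weyl_eq_def, rule weyl_relators_in_ideal, unfold weyl_relators_def, blast)

lemma wD_wD: "wD i * wD j = wD j * wD i"
  by transfer (unfold weyl_eq_def, rule weyl_relators_in_ideal, unfold weyl_relators_def, blast)

lemma wD_wX:
  "wD i * wX j - wX j * wD i = (if i = j then 1 else (0 :: ('k::field, 'n) weyl))"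
proof -
  let ?c = "free_var (GD i) * free_var (GX j) - free_var (GX j) * free_var (GD i)
    :: ('k, 'n weyl_gen) free_algebra"
  have eq: "weyl_eq ?c (if i = j then 1 else 0)"
    unfolding weyl_eq_def by (rule weyl_relators_in_ideal, unfold weyl_relators_def) blast
  have "wD i * wX j - wX j * wD i = abs_weyl ?c"
    by (simp add: wX.abs_eq wD.abs_eq times_weyl.abs_eq minus_weyl.abs_eq)
  also have "\<dots> = abs_weyl (if i = j then 1 else 0)"
    using eq by (simp only: weyl.abs_eq_iff)
  also have "\<dots> = (if i = j then 1 else 0)"
    by (simp add: zero_weyl.abs_eq one_weyl.abs_eq)
  finally show ?thesis .
qed

text \<open>The factors of each of the products below commute, so that the value of the fold does not
  depend on the order of multiplication.\<close>

definition wX_monomial :: "('n::finite \<Rightarrow> nat) \<Rightarrow> ('k::field, 'n) weyl" where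
  "wX_monomial \<alpha> = Finite_Set.fold (\<lambda>i a. wX i ^ \<alpha> i * a) 1 UNIV"

definition wD_monomial :: "('n::finite \<Rightarrow> nat) \<Rightarrow> ('k::field, 'n) weyl" where
  "wD_monomial \<beta> = Finite_Set.fold (\<lambda>i a. wD i ^ \<beta> i * a) 1 UNIV"

lemma power_mult_commute:
  fixes a b :: "'a::monoid_mult"
  assumes "a * b = b * a"
  shows "a ^ m * b ^ n = b ^ n * a ^ m"
proof -
  have "a * b ^ n = b ^ n * a" for n
    by (metis assms power_commuting_commutes)
  then show ?thesis by (metis power_commuting_commutes)
qed

lemma comp_fun_commute_wX: "comp_fun_commute (\<lambda>i a. wX i ^ \<alpha> i * a)"
  by standard (auto simp: fun_eq_iff mult.assoc[symmetric] power_mult_commute[OF wX_wX])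

lemma comp_fun_commute_wD: "comp_fun_commute (\<lambda>i a. wD i ^ \<beta> i * a)"
  by standard (auto simp: fun_eq_iff mult.assoc[symmetric] power_mult_commute[OF wD_wD])

definition bernstein :: "nat \<Rightarrow> ('k::field, 'n::finite) weyl set" where
  "bernstein m =
     weyl.span {wX_monomial \<alpha> * wD_monomial \<beta> | \<alpha> \<beta>.
       (\<Sum>i\<in>UNIV. \<alpha> i) + (\<Sum>i\<in>UNIV. \<beta> i) \<le> m}"


section \<open>Modules and bimodules\<close>

locale algebra_left_module = vector_space scale
  for ascale :: "'k::field \<Rightarrow> 'a::ring_1 \<Rightarrow> 'a"
    and scale :: "'k \<Rightarrow> 'm::ab_group_add \<Rightarrow> 'm" +
  fixes lact :: "'a \<Rightarrow> 'm \<Rightarrow> 'm"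
  assumes lact_plus: "lact (a + b) m = lact a m + lact b m"
    and lact_add: "lact a (m + m') = lact a m + lact a m'"
    and lact_times: "lact (a * b) m = lact a (lact b m)"
    and lact_one: "lact 1 m = m"
    and lact_ascale: "lact (ascale c a) m = scale c (lact a m)"
    and lact_scale: "lact a (scale c m) = scale c (lact a m)"

locale algebra_right_module = vector_space scale
  for ascale :: "'k::field \<Rightarrow> 'a::ring_1 \<Rightarrow> 'a"
    and scale :: "'k \<Rightarrow> 'm::ab_group_add \<Rightarrow> 'm" +
  fixes ract :: "'m \<Rightarrow> 'a \<Rightarrow> 'm"
  assumes ract_plus: "ract m (a + b) = ract m a + ract m b"
    and ract_add: "ract (m + m') a = ract m a + ract m' a"
    and ract_times: "ract m (a * b) = ract (ract m a) b"
    and ract_one: "ract m 1 = m"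
    and ract_ascale: "ract m (ascale c a) = scale c (ract m a)"
    and ract_scale: "ract (scale c m) a = scale c (ract m a)"

locale algebra_bimodule =
  algebra_left_module ascale scale lact + algebra_right_module ascale scale ract
  for ascale :: "'k::field \<Rightarrow> 'a::ring_1 \<Rightarrow> 'a"
    and scale :: "'k \<Rightarrow> 'm::ab_group_add \<Rightarrow> 'm"
    and lact :: "'a \<Rightarrow> 'm \<Rightarrow> 'm"
    and ract :: "'m \<Rightarrow> 'a \<Rightarrow> 'm" +
  assumes lact_ract: "ract (lact a m) b = lact a (ract m b)"

text \<open>The following notions do not refer to the product of the ring. They are used both for a left
  action \<^term>\<open>lact\<close> and, as \<^term>\<open>\<lambda>a m. ract m a\<close>, for a right action.\<close>

definition submodule :: "('a \<Rightarrow> 'm \<Rightarrow> 'm) \<Rightarrow> 'm::ab_group_add set \<Rightarrow> bool" where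
  "submodule act N \<longleftrightarrow>
     0 \<in> N \<and> (\<forall>u\<in>N. \<forall>v\<in>N. u + v \<in> N) \<and> (\<forall>a. \<forall>u\<in>N. act a u \<in> N)"

definition generates :: "('a \<Rightarrow> 'm \<Rightarrow> 'm) \<Rightarrow> 'm::ab_group_add set \<Rightarrow> bool" where
  "generates act G \<longleftrightarrow> submodule act hull G = UNIV"

definition finitely_generated :: "('a \<Rightarrow> 'm \<Rightarrow> 'm::ab_group_add) \<Rightarrow> bool" where
  "finitely_generated act \<longleftrightarrow> (\<exists>G. finite G \<and> generates act G)"

definition cyclic_module :: "('a \<Rightarrow> 'm \<Rightarrow> 'm::ab_group_add) \<Rightarrow> bool" where
  "cyclic_module act \<longleftrightarrow> (\<exists>m. generates act {m})"

definition module_basis :: "('a::zero \<Rightarrow> 'm \<Rightarrow> 'm) \<Rightarrow> 'm::ab_group_add set \<Rightarrow> bool" where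
  "module_basis act B \<longleftrightarrow> generates act B \<and>
     (\<forall>F f. finite F \<longrightarrow> F \<subseteq> B \<longrightarrow> (\<Sum>b\<in>F. act (f b) b) = 0 \<longrightarrow> (\<forall>b\<in>F. f b = 0))"

definition free_module :: "('a::zero \<Rightarrow> 'm \<Rightarrow> 'm::ab_group_add) \<Rightarrow> bool" where
  "free_module act \<longleftrightarrow> (\<exists>B. module_basis act B)"

definition irreducible_bimodule ::
    "('a \<Rightarrow> 'm \<Rightarrow> 'm) \<Rightarrow> ('m \<Rightarrow> 'a \<Rightarrow> 'm::ab_group_add) \<Rightarrow> bool" where
  "irreducible_bimodule lact ract \<longleftrightarrow> (UNIV :: 'm set) \<noteq> {0} \<and>
     (\<forall>N. submodule lact N \<and> submodule (\<lambda>a m. ract m a) N \<longrightarrow> N = {0} \<or> N = UNIV)"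


section \<open>Dimension and holonomic modules\<close>

definition bernstein_filtration ::
    "(('k::field, 'n::finite) weyl \<Rightarrow> 'm \<Rightarrow> 'm) \<Rightarrow> 'm::ab_group_add set \<Rightarrow> nat \<Rightarrow> 'm set" where
  "bernstein_filtration act G i =
     {(\<Sum>g\<in>G. act (b g) g) | b. \<forall>g\<in>G. b g \<in> bernstein i}"

text \<open>\<open>has_dimension scale act d\<close> means \<open>dim M = d\<close>. That \<open>d\<close> is the same for all finite generating
  sets is part of the definition, which is meant for finitely generated non-zero \<open>M\<close>.\<close>

definition has_dimension ::
    "('k::field \<Rightarrow> 'm \<Rightarrow> 'm) \<Rightarrow> (('k, 'n::finite) weyl \<Rightarrow> 'm \<Rightarrow> 'm::ab_group_add) \<Rightarrow> nat \<Rightarrow> bool" where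
  "has_dimension scale act d \<longleftrightarrow>
     (\<forall>G. finite G \<and> generates act G \<longrightarrow>
        (\<exists>p :: rat poly. p \<noteq> 0 \<and> degree p = d \<and>
           (\<forall>\<^sub>F i in sequentially.
              of_nat (vector_space.dim scale (bernstein_filtration act G i)) = poly p (of_nat i))))"

definition holonomic ::
    "('k::field \<Rightarrow> 'm \<Rightarrow> 'm) \<Rightarrow> (('k, 'n::finite) weyl \<Rightarrow> 'm \<Rightarrow> 'm::ab_group_add) \<Rightarrow> bool" where
  "holonomic scale act \<longleftrightarrow> finitely_generated act \<and>
     ((UNIV :: 'm set) = {0} \<or> has_dimension scale act CARD('n))"

text \<open>The left \<open>A\<^sub>2\<^sub>n\<close>-module structure of an \<open>A\<^sub>n\<close>-bimodule, determined by the action of the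
  generators; existence and uniqueness are shown below.\<close>

definition is_bimodule_left_action ::
    "('k::field \<Rightarrow> 'm::ab_group_add \<Rightarrow> 'm) \<Rightarrow> (('k, 'n) weyl \<Rightarrow> 'm \<Rightarrow> 'm) \<Rightarrow>
     ('m \<Rightarrow> ('k, 'n) weyl \<Rightarrow> 'm) \<Rightarrow> (('k, 'n + 'n) weyl \<Rightarrow> 'm \<Rightarrow> 'm) \<Rightarrow> bool" where
  "is_bimodule_left_action scale lact ract act \<longleftrightarrow>
     algebra_left_module weyl_scale scale act \<and>
     (\<forall>i m. act (wX (Inl i)) m = lact (wX i) m \<and>
            act (wD (Inl i)) m = lact (wD i) m \<and>
            act (wX (Inr i)) m = ract m (wX i) \<and>
            act (wD (Inr i)) m = - ract m (wD i))"

definition bimodule_left_action ::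
    "('k::field \<Rightarrow> 'm::ab_group_add \<Rightarrow> 'm) \<Rightarrow> (('k, 'n) weyl \<Rightarrow> 'm \<Rightarrow> 'm) \<Rightarrow>
     ('m \<Rightarrow> ('k, 'n) weyl \<Rightarrow> 'm) \<Rightarrow> ('k, 'n + 'n) weyl \<Rightarrow> 'm \<Rightarrow> 'm" where
  "bimodule_left_action scale lact ract = (THE act. is_bimodule_left_action scale lact ract act)"

definition holonomic_bimodule ::
    "('k::field \<Rightarrow> 'm::ab_group_add \<Rightarrow> 'm) \<Rightarrow> (('k, 'n::finite) weyl \<Rightarrow> 'm \<Rightarrow> 'm) \<Rightarrow>
     ('m \<Rightarrow> ('k, 'n) weyl \<Rightarrow> 'm) \<Rightarrow> bool" where
  "holonomic_bimodule scale lact ract \<longleftrightarrow> holonomic scale (bimodule_left_action scale lact ract)"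

lemma (in weyl_operators) weyl_action_exists:
  "\<exists>act. algebra_left_module weyl_scale scale act \<and>
     (\<forall>i m. act (wX i) m = ox i m \<and> act (wD i) m = od i m)"
proof -
  define act where "act a = weval (rep_weyl a)" for a
  have act: "act (abs_weyl p) m = weval p m" for p m
    unfolding act_def
    by (rule free_act_weyl_eq) (metis Quotient3_weyl equivp_weyl_eq equivp_reflp rep_abs_rsp_left)
  have ex: "\<exists>p. a = abs_weyl p" for a :: "('k, 'n) weyl"
    by (metis Quotient3_abs_rep Quotient3_weyl)
  have "algebra_left_module weyl_scale scale act"
  proof
    fix a b :: "('k, 'n) weyl" and m m' c
    obtain p q where [simp]: "a = abs_weyl p" "b = abs_weyl q" using ex by metis
    show "act (a + b) m = act a m + act b m"
      by (simp add: plus_weyl.abs_eq act free_act_plus)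
    show "act a (m + m') = act a m + act a m'"
      by (simp add: act free_act_add)
    show "act (a * b) m = act a (act b m)"
      by (simp add: times_weyl.abs_eq act free_act_times)
    show "act 1 m = m"
      by (simp add: one_weyl.abs_eq act free_act_one)
    show "act (weyl_scale c a) m = scale c (act a m)"
      by (simp add: weyl_scale.abs_eq act free_act_free_scale)
    show "act a (scale c m) = scale c (act a m)"
      by (simp add: act free_act_scale)
  qed
  moreover have "act (wX i) m = ox i m \<and> act (wD i) m = od i m" for i m
    by (simp add: wX.abs_eq wD.abs_eq act free_act_var)
  ultimately show ?thesis by blast
qed

lemma weyl_action_unique:
  fixes act act' :: "('k::field, 'n) weyl \<Rightarrow> 'm::ab_group_add \<Rightarrow> 'm"
  assumes "algebra_left_module weyl_scale scale act" "algebra_left_module weyl_scale scale act'"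
    and gen: "\<And>i m. act (wX i) m = act' (wX i) m" "\<And>i m. act (wD i) m = act' (wD i) m"
  shows "act = act'"
proof -
  interpret A: algebra_left_module weyl_scale scale act by fact
  interpret B: algebra_left_module weyl_scale scale act' by fact
  have word: "act (abs_weyl (Poly_Mapping.single (Word l) 1)) m =
      act' (abs_weyl (Poly_Mapping.single (Word l) 1)) m" for l m
  proof (induction l arbitrary: m)
    case Nil
    have "Poly_Mapping.single (Word []) 1 = (1 :: ('k, 'n weyl_gen) free_algebra)"
      by (simp add: zero_free_monoid_def[symmetric])
    then show ?case by (simp add: one_weyl.abs_eq[symmetric] A.lact_one B.lact_one)
  next
    case (Cons g l)
    have "Poly_Mapping.single (Word (g # l)) 1 =
        (free_var g * Poly_Mapping.single (Word l) 1 :: ('k, 'n weyl_gen) free_algebra)"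
      by (simp add: free_var_def mult_single)
    moreover have "act (abs_weyl (free_var g)) m = act' (abs_weyl (free_var g)) m" for m
      using gen by (cases g) (simp_all add: wX.abs_eq wD.abs_eq)
    ultimately show ?case
      by (simp add: times_weyl.abs_eq[symmetric] A.lact_times B.lact_times Cons)
  qed
  have "act (abs_weyl p) m = act' (abs_weyl p) m" for p m
  proof (induction p rule: free_algebra_induct)
    case (single w c)
    have "Poly_Mapping.single w c = free_scale c (Poly_Mapping.single w 1)"
      by (simp add: free_scale_def mult_single)
    then show ?case
      using word by (cases w) (simp add: weyl_scale.abs_eq[symmetric] A.lact_ascale B.lact_ascale)
  next
    case (add p q)
    then show ?case by (simp add: plus_weyl.abs_eq[symmetric] A.lact_plus B.lact_plus)
  qed
  moreover have "\<exists>p. a = abs_weyl p" for a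
    by (metis Quotient3_abs_rep Quotient3_weyl)
  ultimately show ?thesis by (metis ext)
qed

lemma is_bimodule_left_action_unique:
  fixes scale :: "'k::field \<Rightarrow> 'm::ab_group_add \<Rightarrow> 'm"
    and lact :: "('k, 'n) weyl \<Rightarrow> 'm \<Rightarrow> 'm"
  assumes "is_bimodule_left_action scale lact ract act" "is_bimodule_left_action scale lact ract act'"
  shows "act = act'"
proof (rule weyl_action_unique)
  fix i :: "'n + 'n" and m
  show "act (wX i) m = act' (wX i) m" "act (wD i) m = act' (wD i) m"
    using assms by (cases i; simp add: is_bimodule_left_action_def)+
qed (use assms in \<open>auto simp: is_bimodule_left_action_def\<close>)

lemma is_bimodule_left_action:
  fixes scale :: "'k::field \<Rightarrow> 'm::ab_group_add \<Rightarrow> 'm"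
    and lact :: "('k, 'n) weyl \<Rightarrow> 'm \<Rightarrow> 'm"
  assumes "algebra_bimodule weyl_scale scale lact ract"
  shows "is_bimodule_left_action scale lact ract (bimodule_left_action scale lact ract)"
proof -
  interpret algebra_bimodule weyl_scale scale lact ract by fact
  let ?ox = "case_sum (\<lambda>i. lact (wX i)) (\<lambda>i m. ract m (wX i))"
  let ?od = "case_sum (\<lambda>i. lact (wD i)) (\<lambda>i m. - ract m (wD i))"
  have comm_l: "lact a (lact b m) = lact b (lact a m)" if "a * b = b * a" for a b m
    using that by (metis lact_times)
  have comm_r: "ract (ract m a) b = ract (ract m b) a" if "a * b = b * a" for a b m
    using that by (metis ract_times)
  have neg_l: "lact a (- m) = - lact a m" for a m
    by (metis lact_scale scale_minus_left scale_one)
  have neg_r: "ract (- m) a = - ract m a" for a m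
    by (metis ract_scale scale_minus_left scale_one)
  have zero_l: "lact 0 m = 0" for m using lact_plus[of 0 0 m] by simp
  have zero_r: "ract m 0 = 0" for m using ract_plus[of m 0 0] by simp
  have dx: "wD i * wX j = wX j * wD i + (if i = j then 1 else 0)" for i j
    using wD_wX[of i j] by (simp add: algebra_simps)
  have dx_l: "lact (wD i) (lact (wX j) m) = lact (wX j) (lact (wD i) m) + (if i = j then m else 0)" for i j m
    unfolding lact_times[symmetric] dx by (simp add: lact_plus lact_one zero_l)
  have dx_r: "ract (ract m (wD i)) (wX j) = ract (ract m (wX j)) (wD i) + (if i = j then m else 0)" for i j m
    unfolding ract_times[symmetric] dx by (simp add: ract_plus ract_one zero_r)
  have "weyl_operators scale ?ox ?od"
  proof
    fix g :: "('n + 'n) weyl_gen" and u v c and i j :: "'n + 'n"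
    show "case_weyl_gen ?ox ?od g (u + v) = case_weyl_gen ?ox ?od g u + case_weyl_gen ?ox ?od g v"
      by (auto split: weyl_gen.split sum.split simp: lact_add ract_add)
    show "case_weyl_gen ?ox ?od g (scale c v) = scale c (case_weyl_gen ?ox ?od g v)"
      by (auto split: weyl_gen.split sum.split simp: lact_scale ract_scale)
    show "?ox i (?ox j v) = ?ox j (?ox i v)"
      by (auto split: sum.split simp: lact_ract comm_l[OF wX_wX] intro: comm_r[OF wX_wX])
    show "?od i (?od j v) = ?od j (?od i v)"
      by (auto split: sum.split simp: lact_ract neg_l neg_r intro: comm_l[OF wD_wD] comm_r[OF wD_wD])
    show "?od i (?ox j v) = ?ox j (?od i v) + (if i = j then v else 0)"
      by (auto split: sum.split simp: lact_ract neg_l neg_r dx_l dx_r)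
  qed
  then interpret weyl_operators scale ?ox ?od .
  obtain act where *: "algebra_left_module weyl_scale scale act"
      "\<And>i m. act (wX i) m = ?ox i m \<and> act (wD i) m = ?od i m"
    using weyl_action_exists by blast
  have "is_bimodule_left_action scale lact ract act"
    by (simp add: is_bimodule_left_action_def *)
  then show ?thesis
    unfolding bimodule_left_action_def by (metis theI is_bimodule_left_action_unique)
qed

end

(* For a bimodule M generated by finitely many elements as a left module, right multiplication by
   a generator of the algebra raises the left Bernstein filtration by a bounded amount, so the
   bimodule filtration grows at most like i^(2n). Conversely, since the Weyl algebra is simple,
   the right action on the generators has no relations, so the filtration grows at least like
   i^(2n). The same comparison settles the cyclic case: a relation for the left generator would
   bound the growth of the module by i^(2n-1), and then the right orbit of the generator would
   have a relation too. That the dimensions are eventually polynomial follows as for Groebner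
   bases: the reducible monomials form an upward closed set. Everything is done for families of
   operators whose commutators are scalars, where left and right multiplications play symmetric
   roles. *)

theory Submission
  imports Defs "HOL-Library.List_Lexorder" "HOL-Library.Product_Lexorder" "HOL-Library.Multiset"
    "HOL-Library.FuncSet"
begin

section \<open>Eventually polynomial counting functions\<close>

text \<open>Freeness and irreducibility in the cyclic case are one statement: if \<open>a\<close> is
  non-zero and \<open>a m\<close> lies in a sub-bimodule \<open>N\<close>, then \<open>N\<close> is
  everything. With \<open>N = 0\<close> it says that \<open>m\<close> has no relation; for non-zero
  \<open>N\<close> it says that \<open>N\<close> is not proper, because each of its elements has the
  form \<open>a m\<close>. It is a statement about the quotient by \<open>N\<close>, and since that
  quotient is not a type of its own, the arguments carry the subspace \<open>N\<close> along and
  work modulo it. Holonomicity asks for the dimension with respect to every finite generating set of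
  the bimodule, whereas finiteness is given on one side only. The filtrations are therefore compared
  up to linear changes of the index, which do not affect the degree. With several generators the
  lower bound needs one relation that kills all of them at once, and it is found in a direct sum of
  copies of the module. That the complement of an upward closed set of exponents has a polynomial
  counting function rests on Dickson's lemma: its slices in one coordinate are eventually
  constant.\<close>

definition eventually_poly :: "(nat \<Rightarrow> nat) \<Rightarrow> bool" where
  "eventually_poly f \<longleftrightarrow>
     (\<exists>p :: rat poly. \<forall>\<^sub>F i in sequentially. of_nat (f i) = poly p (of_nat i))"

lemma eventually_poly_cong:
  assumes "eventually_poly f" "\<forall>\<^sub>F i in sequentially. f i = g i"
  shows "eventually_poly g"
proof -
  obtain p :: "rat poly" where "\<forall>\<^sub>F i in sequentially. of_nat (f i) = poly p (of_nat i)"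
    using assms(1) by (auto simp: eventually_poly_def)
  with assms(2) have "\<forall>\<^sub>F i in sequentially. of_nat (g i) = poly p (of_nat i)"
    by eventually_elim simp
  then show ?thesis by (auto simp: eventually_poly_def)
qed

lemma eventually_poly_const: "eventually_poly (\<lambda>_. c)"
  unfolding eventually_poly_def by (rule exI[of _ "[:of_nat c:]"]) simp

lemma eventually_poly_add:
  assumes "eventually_poly f" "eventually_poly g"
  shows "eventually_poly (\<lambda>i. f i + g i)"
proof -
  obtain p q :: "rat poly" where
    "\<forall>\<^sub>F i in sequentially. of_nat (f i) = poly p (of_nat i)"
    "\<forall>\<^sub>F i in sequentially. of_nat (g i) = poly q (of_nat i)"
    using assms by (auto simp: eventually_poly_def)
  then have "\<forall>\<^sub>F i in sequentially. of_nat (f i + g i) = poly (p + q) (of_nat i)"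
    by eventually_elim simp
  then show ?thesis unfolding eventually_poly_def by blast
qed

lemma eventually_poly_sum:
  assumes "finite A" "\<And>a. a \<in> A \<Longrightarrow> eventually_poly (f a)"
  shows "eventually_poly (\<lambda>i. \<Sum>a\<in>A. f a i)"
  using assms by (induction A) (auto simp: eventually_poly_const intro: eventually_poly_add)

lemma eventually_poly_shift:
  assumes "eventually_poly f"
  shows "eventually_poly (\<lambda>i. f (i - k))"
proof -
  obtain p :: "rat poly" where "\<forall>\<^sub>F i in sequentially. of_nat (f i) = poly p (of_nat i)"
    using assms by (auto simp: eventually_poly_def)
  then have "\<forall>\<^sub>F i in sequentially. of_nat (f (i - k)) = poly p (of_nat (i - k))"
    by (auto simp: eventually_sequentially) (metis le_diff_conv2 add_leD2)
  moreover have "\<forall>\<^sub>F i in sequentially. k \<le> i" by (rule eventually_ge_at_top)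
  ultimately have
    "\<forall>\<^sub>F i in sequentially. of_nat (f (i - k)) = poly (pcompose p [:- of_nat k, 1:]) (of_nat i)"
    by eventually_elim (simp add: poly_pcompose of_nat_diff)
  then show ?thesis by (auto simp: eventually_poly_def)
qed

text \<open>The difference of \<open>x^(n+1)\<close> has leading term \<open>(n+1) x^n\<close>. In
  characteristic zero \<open>n+1\<close> is invertible, so the top coefficient of \<open>p\<close>
  can be removed, by induction on a bound for its degree.\<close>

lemma poly_antidifference:
  fixes p :: "'a::field_char_0 poly"
  shows "\<exists>q. \<forall>x. poly q (x + 1) - poly q x = poly p x"
proof -
  have "\<exists>q. \<forall>x. poly q (x + 1) - poly q x = poly p x" if "\<forall>i\<ge>n. coeff p i = 0" for n
    using that
  proof (induction n arbitrary: p)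
    case 0
    then have "p = 0" by (intro poly_eqI) simp
    then show ?case by (intro exI[of _ 0]) simp
  next
    case (Suc n)
    define a where "a = coeff p n / of_nat (Suc n)"
    define d :: "'a poly" where "d = [:1, 1:] ^ Suc n - monom 1 (Suc n)"
    have cd: "coeff d i = (if i = Suc n then 0 else of_nat (Suc n choose i))" for i
    proof -
      have "([:1, 1:] :: 'a poly) ^ Suc n = (\<Sum>k\<le>Suc n. monom (of_nat (Suc n choose k)) k)"
      proof -
        have "([:1, 1:] :: 'a poly) = monom 1 1 + 1"
          by (simp add: monom_altdef one_pCons)
        then have "([:1, 1:] :: 'a poly) ^ Suc n =
            (\<Sum>k\<le>Suc n. of_nat (Suc n choose k) * monom 1 1 ^ k * 1 ^ (Suc n - k))"
          by (simp only: binomial_ring)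
        also have "\<dots> = (\<Sum>k\<le>Suc n. monom (of_nat (Suc n choose k)) k)"
          by (intro sum.cong) (simp_all add: monom_power of_nat_monom mult_monom)
        finally show ?thesis .
      qed
      then have "coeff (([:1, 1:] :: 'a poly) ^ Suc n) i = of_nat (Suc n choose i)"
        by (auto simp: coeff_sum binomial_eq_0 simp del: sum.atMost_Suc)
      then show ?thesis by (simp add: d_def del: power_Suc binomial_Suc_Suc)
    qed
    have "\<forall>i\<ge>n. coeff (p - smult a d) i = 0"
    proof (intro allI impI)
      fix i assume "n \<le> i"
      consider "i = n" | "i = Suc n" | "i > Suc n" using \<open>n \<le> i\<close> by linarith
      then show "coeff (p - smult a d) i = 0"
      proof cases
        case 1
        have "(of_nat (Suc n choose n) :: 'a) = of_nat (Suc n)" by (subst binomial_Suc_n) simp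
        then show ?thesis using 1 by (simp add: cd a_def del: binomial_Suc_Suc of_nat_Suc)
      qed (use Suc.prems in \<open>auto simp: cd binomial_eq_0 simp del: binomial_Suc_Suc\<close>)
    qed
    then obtain q where q: "\<And>x. poly q (x + 1) - poly q x = poly (p - smult a d) x"
      using Suc.IH by blast
    have "poly (q + monom a (Suc n)) (x + 1) - poly (q + monom a (Suc n)) x = poly p x" for x
      using q[of x] by (simp add: d_def poly_monom algebra_simps)
    then show ?case by blast
  qed
  then show ?thesis by (meson coeff_eq_0 le_degree less_eq_Suc_le)
qed

lemma eventually_poly_partial_sums:
  assumes "eventually_poly f"
  shows "eventually_poly (\<lambda>i. \<Sum>t\<le>i. f t)"
proof -
  obtain p :: "rat poly" and k where p: "\<And>i. k \<le> i \<Longrightarrow> of_nat (f i) = poly p (of_nat i)"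
    using assms by (auto simp: eventually_poly_def eventually_sequentially)
  \<comment> \<open>Passing from \<open>i\<close> to \<open>Suc i\<close> adds
    \<open>f (Suc i)\<close>, so the antidifference is that of \<open>p(x+1)\<close>; the constant
    in \<open>r\<close> is then fitted at \<open>k\<close>.\<close>
  obtain q where q: "\<And>x. poly q (x + 1) - poly q x = poly (pcompose p [:1, 1:]) x"
    using poly_antidifference by blast
  define r where "r = q + [:of_nat (\<Sum>t\<le>k. f t) - poly q (of_nat k):]"
  have "of_nat (\<Sum>t\<le>i. f t) = poly r (of_nat i)" if "k \<le> i" for i
    using that
  proof (induction i rule: dec_induct)
    case base
    then show ?case by (simp add: r_def)
  next
    case (step i)
    then have "(of_nat (f (Suc i)) :: rat) = poly p (1 + of_nat i)" using p[of "Suc i"] by simp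
    then show ?case using q[of "of_nat i"] step
      by (simp add: r_def poly_pcompose algebra_simps)
  qed
  then show ?thesis unfolding eventually_poly_def eventually_sequentially by blast
qed

section \<open>Dickson's lemma and order ideals of exponent vectors\<close>

lemma nat_seq_mono_subseq:
  fixes f :: "nat \<Rightarrow> nat"
  shows "\<exists>\<phi> :: nat \<Rightarrow> nat. strict_mono \<phi> \<and> (\<forall>i j. i \<le> j \<longrightarrow> f (\<phi> i) \<le> f (\<phi> j))"
proof -
  obtain \<phi> where \<phi>: "strict_mono \<phi>" "monoseq (\<lambda>n. f (\<phi> n))" using seq_monosub by blast
  from \<phi>(2) consider "\<forall>i j. i \<le> j \<longrightarrow> f (\<phi> i) \<le> f (\<phi> j)" | "\<forall>i j. i \<le> j \<longrightarrow> f (\<phi> j) \<le> f (\<phi> i)"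
    by (auto simp: monoseq_def)
  then show ?thesis
  proof cases
    case 1
    then show ?thesis using \<phi>(1) by blast
  next
    case 2
    \<comment> \<open>A nonincreasing sequence of naturals is constant from the place of its minimum
      on.\<close>
    define k where "k = (ARG_MIN (\<lambda>n. f (\<phi> n)) n. True)"
    have "f (\<phi> k) \<le> f (\<phi> n)" for n
      unfolding k_def by (rule arg_min_nat_le) simp
    then have "f (\<phi> (k + i)) = f (\<phi> k)" for i
      using 2 by (metis le_add1 le_antisym)
    moreover have "strict_mono (\<lambda>i. \<phi> (k + i))"
      using \<phi>(1) by (simp add: strict_mono_def)
    ultimately show ?thesis by (intro exI[of _ "\<lambda>i. \<phi> (k + i)"]) simp
  qed
qed

text \<open>Dickson's lemma. Asking for a whole subsequence, and not only for a comparable pair,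
  lets the induction thin out the sequence one coordinate at a time.\<close>

lemma dickson_subseq:
  assumes "\<And>n. length (f n) = m"
  shows "\<exists>\<phi> :: nat \<Rightarrow> nat. strict_mono \<phi> \<and> (\<forall>i j. i \<le> j \<longrightarrow> list_all2 (\<le>) (f (\<phi> i) :: nat list) (f (\<phi> j)))"
  using assms
proof (induction m arbitrary: f)
  case 0
  then have "list_all2 (\<le>) (f i) (f j)" for i j by simp
  then show ?case using strict_mono_id by blast
next
  case (Suc m)
  have "length (tl (f n)) = m" for n using Suc.prems[of n] by simp
  then obtain \<phi> :: "nat \<Rightarrow> nat" where \<phi>: "strict_mono \<phi>"
    "\<And>i j. i \<le> j \<Longrightarrow> list_all2 (\<le>) (tl (f (\<phi> i))) (tl (f (\<phi> j)))"
    using Suc.IH[of "\<lambda>n. tl (f n)"] by auto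
  obtain \<psi> :: "nat \<Rightarrow> nat" where \<psi>: "strict_mono \<psi>"
    "\<And>i j. i \<le> j \<Longrightarrow> hd (f (\<phi> (\<psi> i))) \<le> hd (f (\<phi> (\<psi> j)))"
    using nat_seq_mono_subseq[of "\<lambda>n. hd (f (\<phi> n))"] by auto
  have "list_all2 (\<le>) (f (\<phi> (\<psi> i))) (f (\<phi> (\<psi> j)))" if "i \<le> j" for i j
  proof -
    have "f n = hd (f n) # tl (f n)" for n using Suc.prems[of n] by (cases "f n") auto
    then show ?thesis
      using \<psi>(2)[OF that] \<phi>(2)[of "\<psi> i" "\<psi> j"] that \<psi>(1)
      by (metis list_all2_Cons strict_mono_less_eq)
  qed
  moreover have "strict_mono (\<lambda>i. \<phi> (\<psi> i))" using \<phi>(1) \<psi>(1) by (simp add: strict_mono_def)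
  ultimately show ?case by blast
qed

text \<open>Order ideals of exponent vectors. Vectors are lists, so that the first coordinate can be
  split off in an induction on the number of variables.\<close>

definition down_closed :: "nat list set \<Rightarrow> bool" where
  "down_closed D \<longleftrightarrow> (\<forall>bs\<in>D. \<forall>as. list_all2 (\<le>) as bs \<longrightarrow> as \<in> D)"

text \<open>Otherwise each stage loses a point at some later stage. By Dickson's lemma one lost
  point lies below another that is still present after the loss, and downward closure brings it
  back.\<close>

lemma decseq_down_closed_stabilizes:
  assumes dec: "decseq D" and len: "\<And>x as. as \<in> D x \<Longrightarrow> length as = m"
    and down: "\<And>x. down_closed (D x)"
  shows "\<exists>x0. \<forall>x\<ge>x0. D x = D x0"
proof (rule ccontr)
  assume "\<not> ?thesis"
  then have "\<exists>y as. y > x \<and> as \<in> D x \<and> as \<notin> D y" for x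
    using dec unfolding decseq_def by (metis le_neq_implies_less subset_iff subset_antisym)
  then obtain nxt pt where nxt: "\<And>x. x < nxt x" "\<And>x. pt x \<in> D x" "\<And>x. pt x \<notin> D (nxt x)"
    by metis
  \<comment> \<open>Iterating \<open>nxt\<close> makes every stage start no earlier than the loss
    recorded by the preceding one.\<close>
  define s where "s k = (nxt ^^ k) 0" for k
  have s: "strict_mono s" by (simp add: strict_mono_Suc_iff s_def nxt)
  obtain \<phi> :: "nat \<Rightarrow> nat" where \<phi>: "strict_mono \<phi>"
    "\<And>i j. i \<le> j \<Longrightarrow> list_all2 (\<le>) (pt (s (\<phi> i))) (pt (s (\<phi> j)))"
    using dickson_subseq[of "\<lambda>k. pt (s k)" m] nxt(2) len by blast
  have "\<phi> 0 < \<phi> 1" using \<phi>(1) by (simp add: strict_mono_def)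
  then have "nxt (s (\<phi> 0)) \<le> s (\<phi> 1)"
    using s by (metis Suc_leI comp_apply funpow.simps(2) s_def strict_mono_less_eq)
  then have "pt (s (\<phi> 1)) \<in> D (nxt (s (\<phi> 0)))" using dec nxt(2) unfolding decseq_def by blast
  then have "pt (s (\<phi> 0)) \<in> D (nxt (s (\<phi> 0)))"
    using down \<phi>(2)[of 0 1] unfolding down_closed_def by auto
  then show False using nxt(3) by blast
qed

lemma finite_bounded_sum_list: "finite {as :: nat list. length as = m \<and> sum_list as \<le> i}"
proof (rule finite_subset)
  show "{as :: nat list. length as = m \<and> sum_list as \<le> i} \<subseteq> {as. set as \<subseteq> {..i} \<and> length as = m}"
    using member_le_sum_list by (fastforce intro: order_trans)
  show "finite {as. set as \<subseteq> {..i} \<and> length as = m}"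
    by (rule finite_lists_length_eq) simp
qed

text \<open>Slice by the first entry \<open>x\<close>. The slices shrink with \<open>x\<close> and
  are constant from some \<open>x0\<close> on, so the count is a finite sum of shifted slice counts
  plus partial sums of the count of the stable slice.\<close>

lemma eventually_poly_down_closed:
  assumes "D \<subseteq> {as. length as = m}" "down_closed D"
  shows "eventually_poly (\<lambda>i. card {as \<in> D. sum_list as \<le> i})"
  using assms
proof (induction m arbitrary: D)
  case 0
  then have "{as \<in> D. sum_list as \<le> i} = D" for i by auto
  then show ?case by (simp add: eventually_poly_const)
next
  case (Suc m)
  define sl where "sl x = {as. x # as \<in> D}" for x
  let ?h = "\<lambda>x i. card {as \<in> sl x. sum_list as \<le> i}"
  have len: "length as = m" if "as \<in> sl x" for as x using Suc.prems(1) that by (auto simp: sl_def)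
  have down: "down_closed (sl x)" for x
    using Suc.prems(2) by (auto simp: sl_def down_closed_def)
  have "decseq sl"
    unfolding decseq_def
  proof (intro allI impI subsetI)
    fix x y as assume "x \<le> y" "as \<in> sl y"
    moreover have "list_all2 (\<le>) (x # as) (y # as)" using \<open>x \<le> y\<close> by (simp add: list_all2_refl)
    ultimately show "as \<in> sl x" using Suc.prems(2) unfolding sl_def down_closed_def by blast
  qed
  then obtain x0 where x0: "\<And>x. x0 \<le> x \<Longrightarrow> sl x = sl x0"
    using decseq_down_closed_stabilizes[of sl m] len down by blast
  have fin: "finite {as \<in> sl x. sum_list as \<le> i}" for x i
    by (rule finite_subset[OF _ finite_bounded_sum_list[of m i]]) (use len in auto)
  have card: "card {bs \<in> D. sum_list bs \<le> i} = (\<Sum>x\<le>i. ?h x (i - x))" for i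
  proof -
    have "{bs \<in> D. sum_list bs \<le> i} = (\<Union>x\<in>{..i}. (#) x ` {as \<in> sl x. sum_list as \<le> i - x})"
    proof (intro equalityI subsetI)
      fix bs assume bs: "bs \<in> {bs \<in> D. sum_list bs \<le> i}"
      then obtain x as where "bs = x # as" using Suc.prems(1) by (cases bs) auto
      then show "bs \<in> (\<Union>x\<in>{..i}. (#) x ` {as \<in> sl x. sum_list as \<le> i - x})"
        using bs by (auto simp: sl_def intro!: bexI[of _ x])
    qed (auto simp: sl_def)
    also have "card \<dots> = (\<Sum>x\<le>i. card ((#) x ` {as \<in> sl x. sum_list as \<le> i - x}))"
      by (intro card_UN_disjoint) (auto intro: fin)
    also have "\<dots> = (\<Sum>x\<le>i. ?h x (i - x))"
      by (simp add: card_image)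
    finally show ?thesis .
  qed
  have "eventually_poly (\<lambda>i. (\<Sum>x<x0. ?h x (i - x)) + (\<Sum>t\<le>i - x0. ?h x0 t))"
  proof (intro eventually_poly_add eventually_poly_sum)
    have ep: "eventually_poly (?h x)" for x
      using Suc.IH[of "sl x"] len down by blast
    show "eventually_poly (\<lambda>i. ?h x (i - x))" for x
      using ep by (rule eventually_poly_shift)
    show "eventually_poly (\<lambda>i. \<Sum>t\<le>i - x0. ?h x0 t)"
      using eventually_poly_shift[OF eventually_poly_partial_sums[OF ep]] .
  qed simp
  moreover have "(\<Sum>x<x0. ?h x (i - x)) + (\<Sum>t\<le>i - x0. ?h x0 t) = card {bs \<in> D. sum_list bs \<le> i}"
    if "x0 \<le> i" for i
  proof -
    have "(\<Sum>t\<le>i - x0. ?h x0 t) = (\<Sum>x\<in>{x0..i}. ?h x0 (i - x))"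
      by (rule sum.reindex_bij_witness[of _ "\<lambda>x. i - x" "\<lambda>t. i - t"]) (use that in auto)
    also have "\<dots> = (\<Sum>x\<in>{x0..i}. ?h x (i - x))"
    proof (rule sum.cong)
      fix x assume "x \<in> {x0..i}"
      then have "sl x = sl x0" by (intro x0) simp
      then show "?h x0 (i - x) = ?h x (i - x)" by simp
    qed simp
    finally have "(\<Sum>t\<le>i - x0. ?h x0 t) = (\<Sum>x\<in>{x0..i}. ?h x (i - x))" .
    moreover have "(\<Sum>x\<in>{..<x0} \<union> {x0..i}. ?h x (i - x)) =
        (\<Sum>x<x0. ?h x (i - x)) + (\<Sum>x\<in>{x0..i}. ?h x (i - x))"
      by (rule sum.union_disjoint) auto
    moreover have "{..<x0} \<union> {x0..i} = {..i}" using that by auto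
    ultimately show ?thesis unfolding card by simp
  qed
  ultimately show ?case
    by (rule eventually_poly_cong[OF _ eventually_mono[OF eventually_ge_at_top[of x0]]])
qed

section \<open>Operators with scalar commutators\<close>

definition below :: "('t \<Rightarrow> 'o::linorder) \<Rightarrow> ('t \<Rightarrow> 'b) \<Rightarrow> 't set \<Rightarrow> 't \<Rightarrow> 'b set" where
  "below key v T t = v ` {s \<in> T. key s < key t}"

context vector_space
begin

lemma subspace_diffD: "subspace B \<Longrightarrow> u - w \<in> B \<Longrightarrow> w \<in> B \<Longrightarrow> u \<in> B"
  by (metis diff_add_cancel subspace_add)

text \<open>Steinitz exchange relative to a subspace \<open>N\<close>, phrased without a quotient space.\<close>

lemma exists_relation_mod:
  assumes "finite T" "subspace N" "finite S" "card T < card S" "\<And>s. s \<in> S \<Longrightarrow> f s \<in> span (T \<union> N)"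
  shows "\<exists>c. (\<exists>s\<in>S. c s \<noteq> 0) \<and> (\<Sum>s\<in>S. scale (c s) (f s)) \<in> N"
  using assms(1,3-)
proof (induction T arbitrary: S f rule: finite_induct)
  case empty
  then have "S \<noteq> {}" by auto
  moreover have "f s \<in> N" if "s \<in> S" for s using empty(3)[OF that] span_eq_iff[of N] assms(2) by (metis sup_bot_left)
  ultimately show ?case
    using assms(2) by (intro exI[of _ "\<lambda>_. 1"]) (auto intro: subspace_sum)
next
  case (insert t T)
  have "\<exists>a. f s - scale a t \<in> span (T \<union> N)" if "s \<in> S" for s
    using insert.prems(3)[OF that] by (simp add: span_insert)
  then obtain a where a: "\<And>s. s \<in> S \<Longrightarrow> f s - scale (a s) t \<in> span (T \<union> N)" by metis
  show ?case
  proof (cases "\<forall>s\<in>S. a s = 0")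
    case True
    then have "f s \<in> span (T \<union> N)" if "s \<in> S" for s using a[OF that] that by simp
    moreover have "card T < card S" using insert by simp
    ultimately show ?thesis using insert.IH insert.prems(1) by blast
  next
    case False
    then obtain s0 where s0: "s0 \<in> S" "a s0 \<noteq> 0" by blast
    \<comment> \<open>Eliminates \<open>t\<close> with \<open>s0\<close> as pivot; the coefficient
      that \<open>c'\<close> assigns to \<open>s0\<close> below translates the relation back to
      \<open>f\<close>.\<close>
    define f' where "f' s = f s - scale (a s / a s0) (f s0)" for s
    have "f' s \<in> span (T \<union> N)" if "s \<in> S - {s0}" for s
    proof -
      have "f' s = (f s - scale (a s) t) - scale (a s / a s0) (f s0 - scale (a s0) t)"
        using s0(2) by (simp add: f'_def algebra_simps)
      then show ?thesis using a s0(1) that by (simp add: span_diff span_scale)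
    qed
    moreover have "card T < card (S - {s0})" using insert s0(1) by (simp add: card_Diff_singleton)
    ultimately obtain c where c: "\<exists>s\<in>S - {s0}. c s \<noteq> 0" "(\<Sum>s\<in>S - {s0}. scale (c s) (f' s)) \<in> N"
      using insert.IH[of "S - {s0}" f'] insert.prems(1) by auto
    define c' where "c' = c(s0 := - (\<Sum>s\<in>S - {s0}. c s * (a s / a s0)))"
    have "(\<Sum>s\<in>S. scale (c' s) (f s)) = scale (c' s0) (f s0) + (\<Sum>s\<in>S - {s0}. scale (c' s) (f s))"
      using s0(1) insert.prems(1) by (simp add: sum.remove)
    also have "(\<Sum>s\<in>S - {s0}. scale (c' s) (f s)) = (\<Sum>s\<in>S - {s0}. scale (c s) (f s))"
      by (intro sum.cong) (auto simp: c'_def)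
    also have "scale (c' s0) (f s0) + \<dots> = (\<Sum>s\<in>S - {s0}. scale (c s) (f' s))"
      by (simp add: c'_def f'_def scale_right_diff_distrib sum_subtractf scale_sum_left scale_minus_left)
    finally have "(\<Sum>s\<in>S. scale (c' s) (f s)) \<in> N" using c(2) by simp
    moreover have "\<exists>s\<in>S. c' s \<noteq> 0" using c(1) by (auto simp: c'_def)
    ultimately show ?thesis by blast
  qed
qed

text \<open>Greedy selection: running through \<open>T\<close> by increasing \<open>key\<close>,
  keep a vector only if it is not in the span of \<open>N\<close> and the vectors before it. Later
  the keys are a monomial order and the kept vectors the standard monomials.\<close>

lemma span_non_redundant:
  assumes "finite T" "inj_on key T"
  shows "span (v ` {t \<in> T. v t \<notin> span (below key v T t \<union> N)} \<union> N) = span (v ` T \<union> N)"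
    and "inj_on v {t \<in> T. v t \<notin> span (below key v T t)}"
    and "independent (v ` {t \<in> T. v t \<notin> span (below key v T t)})"
proof -
  have "span (v ` {t \<in> T. v t \<notin> span (below key v T t \<union> N)} \<union> N) = span (v ` T \<union> N) \<and>
     (N = {} \<longrightarrow> inj_on v {t \<in> T. v t \<notin> span (below key v T t \<union> N)} \<and>
        independent (v ` {t \<in> T. v t \<notin> span (below key v T t \<union> N)}))" for N
    using assms
  \<comment> \<open>This rule inserts elements in the order of \<open>key\<close>, so the status of
    the old ones does not change and the new one is tested against all of them.\<close>
  proof (induction T rule: finite_ranking_induct[where f = key])
    case empty
    then show ?case by (simp add: independent_empty)
  next
    case (insert x T)
    define P where "P = {t \<in> T. v t \<notin> span (below key v T t \<union> N)}"
    have IH: "span (v ` P \<union> N) = span (v ` T \<union> N)"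
      "N = {} \<Longrightarrow> inj_on v P" "N = {} \<Longrightarrow> independent (v ` P)"
      using insert by (auto simp: P_def)
    show ?case
    proof (cases "x \<in> T")
      case True
      then show ?thesis using IH by (simp add: insert_absorb P_def)
    next
      case False
      have lt: "key t < key x" if "t \<in> T" for t
        using insert.hyps(2)[OF that] insert.prems False that
        by (metis inj_on_eq_iff insertCI order_le_less)
      have "{s \<in> insert x T. key s < key t} = {s \<in> T. key s < key t}" if "t \<in> T" for t
        using lt[OF that] by auto
      then have old: "(v t \<in> span (below key v (insert x T) t \<union> N)) = (v t \<in> span (below key v T t \<union> N))" if "t \<in> T" for t
        using that by (simp add: below_def)
      have "{s \<in> insert x T. key s < key x} = T" using lt by auto
      then have new: "(v x \<in> span (below key v (insert x T) x \<union> N)) \<longleftrightarrow> v x \<in> span (v ` P \<union> N)"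
        by (simp add: below_def IH)
      show ?thesis
      proof (cases "(v x \<in> span (below key v (insert x T) x \<union> N))")
        case True
        then have "{t \<in> insert x T. v t \<notin> span (below key v (insert x T) t \<union> N)} = P"
          using old by (auto simp: P_def)
        moreover have "span (v ` insert x T \<union> N) = span (v ` T \<union> N)"
          using True new IH by (simp add: span_redundant)
        ultimately show ?thesis using IH by (simp only:) blast
      next
        case nr: False
        then have eq: "{t \<in> insert x T. v t \<notin> span (below key v (insert x T) t \<union> N)} = insert x P"
          using old by (auto simp: P_def)
        have "span (v ` insert x P \<union> N) = span (v ` insert x T \<union> N)"
          by (simp add: span_insert IH)
        moreover have "inj_on v (insert x P)" "independent (v ` insert x P)" if "N = {}"
        proof -
          have "v x \<notin> span (v ` P)" using nr new that by simp
          moreover from this have "v x \<notin> v ` P" using span_base by blast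
          ultimately show "inj_on v (insert x P)" "independent (v ` insert x P)"
            using IH that False by (auto simp: independent_insert P_def)
        qed
        ultimately show ?thesis unfolding eq by blast
      qed
    qed
  qed
  note main = this
  show "span (v ` {t \<in> T. v t \<notin> span (below key v T t \<union> N)} \<union> N) = span (v ` T \<union> N)"
    using main[of N] by blast
  show "inj_on v {t \<in> T. v t \<notin> span (below key v T t)}"
    and "independent (v ` {t \<in> T. v t \<notin> span (below key v T t)})"
    using main[of "{}"] by (simp_all only: sup_bot_right simp_thms)
qed

lemma dim_eq_card_non_redundant:
  assumes "finite T" "inj_on key T"
  shows "dim (span (v ` T)) = card {t \<in> T. v t \<notin> span (below key v T t)}"
proof -
  note nr = span_non_redundant[OF assms, of v]
  have "span (v ` T) = span (v ` {t \<in> T. v t \<notin> span (below key v T t)})"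
    using nr(1)[of "{}"] by simp
  then show ?thesis
    using dim_span_eq_card_independent[OF nr(3)] card_image[OF nr(2)] by simp
qed

end

section \<open>Ordered words and filtrations by word length\<close>

definition generator_list :: "'g::finite list" where
  "generator_list = (SOME gs. distinct gs \<and> set gs = UNIV)"

lemma generator_list: "distinct (generator_list :: 'g::finite list)" "set (generator_list :: 'g list) = UNIV"
proof -
  have "\<exists>gs :: 'g list. distinct gs \<and> set gs = UNIV"
    using finite_distinct_list[of "UNIV :: 'g set"] by auto
  from someI_ex[OF this] show "distinct (generator_list :: 'g list)" "set (generator_list :: 'g list) = UNIV"
    by (auto simp: generator_list_def)
qed

text \<open>The list \<open>gs\<close> is a parameter so that proofs can go by induction on it. The
  fixed \<open>generator_list\<close> sets the order of the factors as well as the later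
  lexicographic comparison.\<close>

definition power_word :: "'g list \<Rightarrow> ('g \<Rightarrow> nat) \<Rightarrow> 'g list" where
  "power_word gs \<mu> = concat (map (\<lambda>g. replicate (\<mu> g) g) gs)"

definition monomial_word :: "('g::finite \<Rightarrow> nat) \<Rightarrow> 'g list" where
  "monomial_word = power_word generator_list"

definition degree_of :: "('g::finite \<Rightarrow> nat) \<Rightarrow> nat" where
  "degree_of \<mu> = (\<Sum>g\<in>UNIV. \<mu> g)"

abbreviation increment :: "('g \<Rightarrow> nat) \<Rightarrow> 'g \<Rightarrow> 'g \<Rightarrow> nat" where
  "increment \<mu> h \<equiv> \<mu>(h := Suc (\<mu> h))"

lemma sum_list_map_generator_list:
  "sum_list (map f (generator_list :: 'g::finite list)) = (\<Sum>g\<in>UNIV. f g)"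
  using generator_list[where 'g = 'g] by (simp add: sum_list_distinct_conv_sum_set)

lemma length_monomial_word: "length (monomial_word \<mu>) = degree_of \<mu>"
  by (simp add: monomial_word_def power_word_def degree_of_def length_concat o_def
      sum_list_map_generator_list)

lemma count_power_word:
  assumes "distinct gs"
  shows "count (mset (power_word gs \<mu>)) g = (if g \<in> set gs then \<mu> g else 0)"
  using assms by (induction gs) (auto simp: power_word_def)

lemma mset_monomial_word_eq_iff: "mset l = mset (monomial_word \<mu>) \<longleftrightarrow> (\<forall>g. count (mset l) g = \<mu> g)"
  by (simp add: multiset_eq_iff monomial_word_def count_power_word generator_list)

lemma mset_monomial_word_increment:
  "mset (monomial_word (increment \<mu> h)) = mset (h # monomial_word \<mu>)"
  by (rule multiset_eqI) (auto simp: monomial_word_def count_power_word generator_list)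

lemma degree_of_increment: "degree_of (increment \<mu> h) = Suc (degree_of \<mu>)"
  using arg_cong[OF mset_monomial_word_increment, of size \<mu> h] by (simp add: length_monomial_word)

lemma finite_bounded_degree: "finite {\<mu> :: 'g::finite \<Rightarrow> nat. degree_of \<mu> < d}"
proof (rule finite_subset)
  show "{\<mu> :: 'g \<Rightarrow> nat. degree_of \<mu> < d} \<subseteq> (\<Pi>\<^sub>E g\<in>UNIV. {..<d})"
  proof
    fix \<mu> :: "'g \<Rightarrow> nat" assume "\<mu> \<in> {\<mu>. degree_of \<mu> < d}"
    then have "\<mu> g < d" for g
      using member_le_sum[of g UNIV \<mu>] by (simp add: degree_of_def)
    then show "\<mu> \<in> (\<Pi>\<^sub>E g\<in>UNIV. {..<d})" by (simp add: PiE_UNIV_domain)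
  qed
  show "finite (\<Pi>\<^sub>E g\<in>(UNIV :: 'g set). {..<d})" by (rule finite_PiE) auto
qed

text \<open>One abstraction for several families: left and right multiplications on the bimodule,
  the generators of \<open>A_2n\<close> acting on it, and the multiplications in the Weyl algebra
  itself. Words in the operators take the place of algebra elements.\<close>

locale quasi_commuting = linear_operators scale opr
  for scale :: "'k::field \<Rightarrow> 'm::ab_group_add \<Rightarrow> 'm"
    and opr :: "'g::finite \<Rightarrow> 'm \<Rightarrow> 'm" +
  fixes \<omega> :: "'g \<Rightarrow> 'g \<Rightarrow> 'k"
  assumes opr_opr: "opr g (opr h v) = opr h (opr g v) + scale (\<omega> g h) v"
begin

lemma opr_zero: "opr g 0 = 0"
  using opr_scale[of g 0 0] by simp

lemma opr_diff: "opr g (u - v) = opr g u - opr g v"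
  by (metis add_diff_cancel diff_add_cancel opr_add)

lemma subspace_opr_preimage: "subspace N \<Longrightarrow> subspace {u. opr g u \<in> N}"
  by (simp add: subspace_def opr_zero opr_add opr_scale)

lemma opr_span: "u \<in> span A \<Longrightarrow> (\<And>a. a \<in> A \<Longrightarrow> opr g a \<in> N) \<Longrightarrow> subspace N \<Longrightarrow> opr g u \<in> N"
  using span_minimal[OF _ subspace_opr_preimage, of A g N] by blast

lemma foldr_opr_add: "foldr opr l (u + v) = foldr opr l u + foldr opr l v"
  by (induction l) (auto simp: opr_add)

lemma foldr_opr_scale: "foldr opr l (scale c v) = scale c (foldr opr l v)"
  by (induction l) (auto simp: opr_scale)

lemma foldr_opr_zero: "foldr opr l 0 = 0"
  by (induction l) (auto simp: opr_zero)

text \<open>The strict bound makes the piece of index \<open>length l\<close> the place for what is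
  shorter than \<open>l\<close>, and the piece of index \<open>0\<close> trivial. The Bernstein
  filtration at \<open>i\<close> corresponds to the index \<open>Suc i\<close>.\<close>

definition word_span :: "'m set \<Rightarrow> nat \<Rightarrow> 'm set" where
  "word_span G d = span {foldr opr l g | l g. length l < d \<and> g \<in> G}"

lemma subspace_word_span: "subspace (word_span G d)"
  by (simp add: word_span_def)

lemma word_in_word_span: "length l < d \<Longrightarrow> g \<in> G \<Longrightarrow> foldr opr l g \<in> word_span G d"
  unfolding word_span_def by (rule span_base) blast

lemma word_span_mono: "d \<le> e \<Longrightarrow> word_span G d \<subseteq> word_span G e"
  unfolding word_span_def by (rule span_mono) fastforce

lemma opr_word_span: "u \<in> word_span G d \<Longrightarrow> opr g u \<in> word_span G (Suc d)"
  using word_in_word_span[of "g # _" "Suc d" _ G]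
  by (auto intro!: opr_span[of u, OF _ _ subspace_word_span] simp: word_span_def[of G d])

lemma word_span_le:
  assumes "subspace N" "\<And>l g. length l < d \<Longrightarrow> g \<in> G \<Longrightarrow> foldr opr l g \<in> N"
  shows "word_span G d \<subseteq> N"
  unfolding word_span_def using assms by (intro span_minimal) auto

text \<open>Every transposition of neighbours costs a scalar multiple of a word that is shorter by
  two, which lies within the stated bound.\<close>

lemma move_to_front:
  assumes "g \<in> G"
  shows "foldr opr (l @ a # l') g - foldr opr (a # l @ l') g \<in> word_span G (Suc (length l + length l'))"
proof (induction l)
  case Nil
  then show ?case using subspace_0[OF subspace_word_span] by simp
next
  case (Cons b l)
  let ?w = "foldr opr (l @ l') g"
  have "opr b (foldr opr (l @ a # l') g - foldr opr (a # l @ l') g) \<in>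
      word_span G (Suc (Suc (length l + length l')))"
    using Cons by (rule opr_word_span)
  moreover have "scale (\<omega> b a) ?w \<in> word_span G (Suc (Suc (length l + length l')))"
    using word_in_word_span[of "l @ l'", OF _ assms] by (intro subspace_scale[OF subspace_word_span]) simp
  ultimately have "opr b (foldr opr (l @ a # l') g - foldr opr (a # l @ l') g) + scale (\<omega> b a) ?w
      \<in> word_span G (Suc (Suc (length l + length l')))"
    by (rule subspace_add[OF subspace_word_span])
  moreover have "opr b (foldr opr (l @ a # l') g - foldr opr (a # l @ l') g) + scale (\<omega> b a) ?w =
     foldr opr ((b # l) @ a # l') g - foldr opr (a # (b # l) @ l') g"
    by (simp add: opr_diff opr_opr[of b a])
  ultimately show ?case by simp
qed

text \<open>Commutativity of the associated graded module. The first letter of \<open>l\<close> is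
  located in \<open>l'\<close> and moved to the front; the rest is induction.\<close>

lemma reorder:
  assumes "mset l = mset l'" "g \<in> G"
  shows "foldr opr l g - foldr opr l' g \<in> word_span G (length l)"
  using assms(1)
proof (induction l arbitrary: l')
  case Nil
  then show ?case using subspace_0[OF subspace_word_span] by simp
next
  case (Cons a l)
  then have "a \<in> set l'" by (metis list.set_intros(1) set_mset_mset)
  then obtain l1 l2 where l': "l' = l1 @ a # l2" by (meson split_list)
  have m: "mset l = mset (l1 @ l2)" using Cons.prems l' by simp
  then have len: "length l = length l1 + length l2" by (metis length_append mset_eq_length)
  have "opr a (foldr opr l g - foldr opr (l1 @ l2) g) \<in> word_span G (Suc (length l))"
    using Cons.IH[OF m] by (rule opr_word_span)
  then have "opr a (foldr opr l g - foldr opr (l1 @ l2) g) -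
      (foldr opr (l1 @ a # l2) g - foldr opr (a # l1 @ l2) g) \<in> word_span G (Suc (length l))"
    using move_to_front[OF assms(2), of l1 a l2] len
    by (simp add: subspace_diff[OF subspace_word_span])
  then show ?case using l' by (simp add: opr_diff)
qed

text \<open>Reordering takes a word to its normal form modulo shorter words, and induction on
  \<open>d\<close> finishes. The normal form \<open>nf\<close> is arbitrary because the factors of
  the monomials in \<open>bernstein\<close> come in the unspecified order of a fold.\<close>

lemma word_span_eq_ordered:
  assumes nf: "\<And>\<mu>. mset (nf \<mu>) = mset (monomial_word \<mu>)"
  shows "word_span G d = span {foldr opr (nf \<mu>) g | \<mu> g. degree_of \<mu> < d \<and> g \<in> G}"
proof
  have len: "length (nf \<mu>) = degree_of \<mu>" for \<mu>
    using nf[of \<mu>] by (metis length_monomial_word mset_eq_length)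
  let ?S = "\<lambda>d. span {foldr opr (nf \<mu>) g | \<mu> g. degree_of \<mu> < d \<and> g \<in> G}"
  show "?S d \<subseteq> word_span G d"
    by (rule span_minimal[OF _ subspace_word_span]) (auto simp: len intro: word_in_word_span)
  show "word_span G d \<subseteq> ?S d"
  proof (induction d)
    case 0
    then show ?case by (simp add: word_span_def)
  next
    case (Suc d)
    show ?case
    proof (rule word_span_le)
      fix l :: "'g list" and g assume l: "length l < Suc d" and g: "g \<in> G"
      define \<mu> where "\<mu> = count (mset l)"
      have eq: "mset l = mset (nf \<mu>)" unfolding nf by (simp add: mset_monomial_word_eq_iff \<mu>_def)
      then have deg: "degree_of \<mu> = length l" by (metis len mset_eq_length)
      have "foldr opr l g - foldr opr (nf \<mu>) g \<in> word_span G d"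
        using reorder[OF eq g] word_span_mono[of "length l" d] l by auto
      also have "word_span G d \<subseteq> ?S (Suc d)"
        by (rule order_trans[OF Suc span_mono]) fastforce
      finally have "foldr opr l g - foldr opr (nf \<mu>) g \<in> ?S (Suc d)" .
      moreover have "foldr opr (nf \<mu>) g \<in> ?S (Suc d)"
      proof -
        have "degree_of \<mu> < Suc d" using l deg by simp
        then show ?thesis using g by (intro span_base) blast
      qed
      ultimately show "foldr opr l g \<in> ?S (Suc d)"
        by (rule subspace_diffD[OF subspace_span])
    qed simp
  qed
qed

definition monomial :: "('g \<Rightarrow> nat) \<times> 'm \<Rightarrow> 'm" where
  "monomial t = foldr opr (monomial_word (fst t)) (snd t)"

lemma word_span_eq_monomial: "word_span G d = span (monomial ` {t. degree_of (fst t) < d \<and> snd t \<in> G})"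
  unfolding word_span_eq_ordered[of monomial_word, OF refl]
  by (rule arg_cong[of _ _ span]) (force simp: monomial_def image_iff)

lemma subspace_UN_word_span: "subspace (\<Union>d. word_span G d)"
proof (rule subspaceI)
  show "0 \<in> (\<Union>d. word_span G d)" using subspace_0[OF subspace_word_span] by blast
  fix u v c assume u: "u \<in> (\<Union>d. word_span G d)"
  then show "scale c u \<in> (\<Union>d. word_span G d)" using subspace_scale[OF subspace_word_span] by blast
  assume "v \<in> (\<Union>d. word_span G d)"
  then obtain d e where "u \<in> word_span G d" "v \<in> word_span G e" using u by blast
  then have "u \<in> word_span G (max d e)" "v \<in> word_span G (max d e)"
    using word_span_mono[of d "max d e"] word_span_mono[of e "max d e"] by auto
  then show "u + v \<in> (\<Union>d. word_span G d)" using subspace_add[OF subspace_word_span] by blast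
qed

lemma opr_monomial:
  assumes "g \<in> G"
  shows "opr h (monomial (\<mu>, g)) - monomial (increment \<mu> h, g) \<in> word_span G (Suc (degree_of \<mu>))"
  using reorder[OF mset_monomial_word_increment[of \<mu> h, symmetric] assms]
  by (simp add: monomial_def length_monomial_word)

end

section \<open>Hilbert polynomials\<close>

text \<open>A degree-lexicographic order, with ties between generators broken by their numbers
  \<open>idx\<close>. Comparing degrees first puts all commutator terms below the leading
  monomial.\<close>

definition monomial_key :: "('m \<Rightarrow> nat) \<Rightarrow> ('g::finite \<Rightarrow> nat) \<times> 'm \<Rightarrow> nat \<times> nat list \<times> nat" where
  "monomial_key idx t = (degree_of (fst t), map (fst t) generator_list, idx (snd t))"

lemma map_generator_list_eq_iff:
  "map \<mu> (generator_list :: 'g::finite list) = map \<nu> generator_list \<longleftrightarrow> \<mu> = \<nu>"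
  using generator_list[where 'g = 'g] by (auto simp: map_eq_conv)

lemma inj_on_monomial_key: "inj_on idx G \<Longrightarrow> inj_on (monomial_key idx) (UNIV \<times> G)"
  by (auto simp: inj_on_def monomial_key_def generator_list)

lemma map_less_increment:
  "map \<mu> gs < map \<nu> gs \<Longrightarrow> map (increment \<mu> h) gs < map (increment \<nu> h) gs"
  for \<mu> :: "'g \<Rightarrow> nat"
  by (induction gs) (auto simp: Cons_less_Cons)

lemma monomial_key_less_increment:
  assumes "monomial_key idx (\<mu>, g) < monomial_key idx (\<nu>, g')"
  shows "monomial_key idx (increment \<mu> h, g) < monomial_key idx (increment \<nu> h, g')"
  using assms map_less_increment[of \<mu> generator_list \<nu> h]
  by (auto simp: monomial_key_def degree_of_increment map_generator_list_eq_iff less_prod_def')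

context quasi_commuting
begin

text \<open>The monomial is the leading one of some relation modulo \<open>N\<close>. The pairs that
  are not reducible are the standard monomials of Groebner basis theory.\<close>

definition reducible :: "('m \<Rightarrow> nat) \<Rightarrow> 'm set \<Rightarrow> 'm set \<Rightarrow> ('g \<Rightarrow> nat) \<Rightarrow> 'm \<Rightarrow> bool" where
  "reducible idx N G \<mu> g \<longleftrightarrow> (monomial (\<mu>, g) \<in> span (below (monomial_key idx) monomial (UNIV \<times> G) (\<mu>, g) \<union> N))"

text \<open>Below a monomial of degree less than \<open>d\<close> there are only monomials of degree
  less than \<open>d\<close>, so reducibility can be tested inside the truncation.\<close>

lemma redundant_bounded_degree_iff:
  assumes "degree_of \<mu> < d"
  shows "monomial (\<mu>, g) \<in> span (below (monomial_key idx) monomial ({\<mu>. degree_of \<mu> < d} \<times> G) (\<mu>, g) \<union> N) \<longleftrightarrow> reducible idx N G \<mu> g"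
proof -
  have "{s \<in> {\<mu> :: 'g \<Rightarrow> nat. degree_of \<mu> < d} \<times> G. monomial_key idx s < monomial_key idx (\<mu>, g)} =
      {s \<in> UNIV \<times> G. monomial_key idx s < monomial_key idx (\<mu>, g)}"
    using assms by (auto simp: monomial_key_def less_prod_def')
  then show ?thesis unfolding below_def reducible_def by (simp only:)
qed

text \<open>Multiply the relation by \<open>opr h\<close>. Smaller monomials stay smaller because
  the order is compatible with increments, and the commutator terms have degree at most that of
  \<open>\<mu>\<close>, which is below the degree of the new leading monomial.\<close>

lemma reducible_increment:
  assumes "reducible idx N G \<mu> g" "g \<in> G" and N: "\<And>h u. u \<in> N \<Longrightarrow> opr h u \<in> N"
  shows "reducible idx N G (increment \<mu> h) g"
proof -
  let ?k = "monomial_key idx"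
  define B where "B = span (monomial ` {s \<in> UNIV \<times> G. ?k s < ?k (increment \<mu> h, g)} \<union> N)"
  have B: "subspace B" by (simp add: B_def)
  have low: "word_span G (Suc (degree_of \<nu>)) \<subseteq> B" if "degree_of \<nu> \<le> degree_of \<mu>" for \<nu>
    unfolding B_def word_span_eq_monomial using that
    by (intro span_mono) (auto simp: monomial_key_def less_prod_def' degree_of_increment)
  have "opr h (monomial (\<mu>, g)) \<in> B"
  proof (rule opr_span[OF _ _ B])
    show "monomial (\<mu>, g) \<in> span (monomial ` {s \<in> UNIV \<times> G. ?k s < ?k (\<mu>, g)} \<union> N)"
      using assms(1) by (simp add: reducible_def below_def)
    fix a assume "a \<in> monomial ` {s \<in> UNIV \<times> G. ?k s < ?k (\<mu>, g)} \<union> N"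
    then show "opr h a \<in> B"
    proof
      assume "a \<in> N"
      then show ?thesis using N unfolding B_def by (intro span_base) blast
    next
      assume "a \<in> monomial ` {s \<in> UNIV \<times> G. ?k s < ?k (\<mu>, g)}"
      then obtain \<nu> g' where s: "a = monomial (\<nu>, g')" "g' \<in> G" "?k (\<nu>, g') < ?k (\<mu>, g)" by auto
      have "opr h a - monomial (increment \<nu> h, g') \<in> B"
        using opr_monomial[OF s(2), of h \<nu>] low[of \<nu>] s(1,3) by (auto simp: monomial_key_def less_prod_def')
      moreover have "monomial (increment \<nu> h, g') \<in> B"
        unfolding B_def using monomial_key_less_increment[OF s(3)] s(2) by (intro span_base) blast
      ultimately show ?thesis by (rule subspace_diffD[OF B])
    qed
  qed
  moreover have "opr h (monomial (\<mu>, g)) - monomial (increment \<mu> h, g) \<in> B"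
    using opr_monomial[OF assms(2)] low[of \<mu>] by auto
  ultimately have "monomial (increment \<mu> h, g) \<in> B"
    using subspace_diff[OF B] by (metis diff_diff_eq2 add_diff_cancel_left')
  then show ?thesis by (simp add: reducible_def below_def B_def)
qed

lemma reducible_upward:
  assumes "reducible idx N G \<mu> g" "g \<in> G" "\<And>h u. u \<in> N \<Longrightarrow> opr h u \<in> N" "\<mu> \<le> \<nu>"
  shows "reducible idx N G \<nu> g"
  using assms(4)
proof (induction "degree_of \<nu>" arbitrary: \<nu> rule: less_induct)
  case less
  show ?case
  proof (cases "\<mu> = \<nu>")
    case True
    then show ?thesis using assms(1) by simp
  next
    case False
    then obtain h where h: "\<mu> h < \<nu> h" using less(2) by (metis antisym le_funI not_le)
    define \<nu>' where "\<nu>' = \<nu>(h := \<nu> h - 1)"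
    have \<nu>: "\<nu> = increment \<nu>' h" using h by (simp add: \<nu>'_def)
    have "\<mu> \<le> \<nu>'" using less(2) h by (auto simp: \<nu>'_def le_fun_def)
    then have "reducible idx N G \<nu>' g" using less(1)[of \<nu>'] \<nu> by (metis degree_of_increment lessI)
    then show ?thesis unfolding \<nu> using assms(2,3) by (rule reducible_increment)
  qed
qed

lemma span_irreducible_monomials:
  assumes "finite G" "inj_on idx G"
  shows "word_span G d \<subseteq> span (monomial ` {t. degree_of (fst t) < d \<and> snd t \<in> G \<and> \<not> reducible idx N G (fst t) (snd t)} \<union> N)"
proof -
  let ?T = "{\<mu> :: 'g \<Rightarrow> nat. degree_of \<mu> < d} \<times> G"
  have fin: "finite ?T" using assms(1) finite_bounded_degree by blast
  have inj: "inj_on (monomial_key idx) ?T"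
    by (rule inj_on_subset[OF inj_on_monomial_key[OF assms(2)]]) auto
  have "{t \<in> ?T. monomial t \<notin> span (below (monomial_key idx) monomial ?T t \<union> N)} =
     {t. degree_of (fst t) < d \<and> snd t \<in> G \<and> \<not> reducible idx N G (fst t) (snd t)}"
    using redundant_bounded_degree_iff by auto
  moreover have "?T = {t. degree_of (fst t) < d \<and> snd t \<in> G}" by auto
  ultimately show ?thesis
    unfolding word_span_eq_monomial using span_non_redundant(1)[OF fin inj, of monomial N]
      span_mono[of "monomial ` ?T" "monomial ` ?T \<union> N"] by simp
qed

lemma dim_word_span:
  assumes "finite G" "inj_on idx G"
  shows "dim (word_span G d) = (\<Sum>g\<in>G. card {\<mu>. degree_of \<mu> < d \<and> \<not> reducible idx {} G \<mu> g})"
proof -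
  let ?T = "{\<mu> :: 'g \<Rightarrow> nat. degree_of \<mu> < d} \<times> G"
  have fin: "finite ?T" using assms(1) finite_bounded_degree by blast
  have inj: "inj_on (monomial_key idx) ?T"
    by (rule inj_on_subset[OF inj_on_monomial_key[OF assms(2)]]) auto
  have T: "?T = {t. degree_of (fst t) < d \<and> snd t \<in> G}" by auto
  have "dim (word_span G d) = card {t \<in> ?T. monomial t \<notin> span (below (monomial_key idx) monomial ?T t)}"
    unfolding word_span_eq_monomial T[symmetric] using fin inj by (rule dim_eq_card_non_redundant)
  also have "{t \<in> ?T. monomial t \<notin> span (below (monomial_key idx) monomial ?T t)} =
      (\<Union>g\<in>G. (\<lambda>\<mu>. (\<mu>, g)) ` {\<mu>. degree_of \<mu> < d \<and> \<not> reducible idx {} G \<mu> g})"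
    using redundant_bounded_degree_iff[where N = "{}"] by auto
  also have "card \<dots> = (\<Sum>g\<in>G. card ((\<lambda>\<mu>. (\<mu>, g)) ` {\<mu>. degree_of \<mu> < d \<and> \<not> reducible idx {} G \<mu> g}))"
    using assms(1) by (intro card_UN_disjoint) (auto intro!: finite_subset[OF _ finite_bounded_degree[of d]])
  also have "\<dots> = (\<Sum>g\<in>G. card {\<mu>. degree_of \<mu> < d \<and> \<not> reducible idx {} G \<mu> g})"
    by (simp add: card_image inj_on_def)
  finally show ?thesis .
qed

text \<open>For each generator the exponents that are not reducible form an order ideal, and the
  dimension counts them.\<close>

lemma hilbert_polynomial:
  assumes "finite G"
  shows "eventually_poly (\<lambda>i. dim (word_span G (Suc i)))"
proof -
  obtain idx :: "'m \<Rightarrow> nat" where idx: "inj_on idx G"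
    using finite_imp_inj_to_nat_seg[OF assms] by blast
  have "eventually_poly (\<lambda>i. card {\<mu>. degree_of \<mu> < Suc i \<and> \<not> reducible idx {} G \<mu> g})" if "g \<in> G" for g
  proof -
    define D where "D = (\<lambda>\<mu>. map \<mu> generator_list) ` {\<mu>. \<not> reducible idx {} G \<mu> g}"
    have "down_closed D"
      unfolding down_closed_def
    proof (intro ballI allI impI)
      fix bs as assume "bs \<in> D" and le: "list_all2 (\<le>) as bs"
      then obtain \<nu> where \<nu>: "bs = map \<nu> generator_list" "\<not> reducible idx {} G \<nu> g" by (auto simp: D_def)
      then have len: "length (generator_list :: 'g list) = length as" using le by (simp add: list_all2_lengthD)
      \<comment> \<open>Decodes a list into an exponent function, inverse to mapping over
        \<open>generator_list\<close>.\<close>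
      define \<mu> :: "'g \<Rightarrow> nat" where "\<mu> h = the (map_of (zip generator_list as) h)" for h
      have as: "as = map \<mu> generator_list"
        by (rule nth_equalityI) (use len map_of_zip_nth[OF len generator_list(1)] in \<open>auto simp: \<mu>_def\<close>)
      have "\<mu> h \<le> \<nu> h" for h
      proof -
        have "h \<in> set generator_list" by (simp add: generator_list)
        then show ?thesis using le unfolding as \<nu>(1) by (auto simp: list_all2_conv_all_nth in_set_conv_nth)
      qed
      then have "\<not> reducible idx {} G \<mu> g" using reducible_upward[of idx "{}" G \<mu> g \<nu>] that \<nu>(2) by (auto simp: le_fun_def)
      then show "as \<in> D" by (auto simp: D_def as)
    qed
    then have "eventually_poly (\<lambda>i. card {as \<in> D. sum_list as \<le> i})"
      by (rule eventually_poly_down_closed[where m = "length (generator_list :: 'g list)", rotated]) (auto simp: D_def)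
    moreover have "card {as \<in> D. sum_list as \<le> i} = card {\<mu>. degree_of \<mu> < Suc i \<and> \<not> reducible idx {} G \<mu> g}" for i
    proof -
      have "{as \<in> D. sum_list as \<le> i} =
          (\<lambda>\<mu>. map \<mu> generator_list) ` {\<mu>. degree_of \<mu> < Suc i \<and> \<not> reducible idx {} G \<mu> g}"
        by (auto simp: D_def sum_list_map_generator_list degree_of_def)
      moreover have "inj_on (\<lambda>\<mu>. map \<mu> (generator_list :: 'g list)) X" for X :: "('g \<Rightarrow> nat) set"
        by (rule inj_onI) (simp only: map_generator_list_eq_iff)
      ultimately show ?thesis by (simp add: card_image)
    qed
    ultimately show ?thesis by simp
  qed
  then show ?thesis
    unfolding dim_word_span[OF assms idx] by (intro eventually_poly_sum assms)
qed

end

section \<open>Commutators as derivatives, and the simplicity argument\<close>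

lemma monomial_word_remove:
  assumes "g \<notin> set gs"
  shows "power_word gs (\<mu>(g := n)) = power_word gs \<mu>"
  using assms by (induction gs) (auto simp: power_word_def)

text \<open>For every column \<open>g\<close> the matrix of commutators has a row whose only
  non-zero entry stands there. Commutation with such an \<open>opr h\<close> is a multiple of the
  partial derivative in \<open>g\<close>; for the Weyl algebra \<open>h\<close> is the conjugate
  variable.\<close>

definition nondegenerate :: "('g \<Rightarrow> 'g \<Rightarrow> 'k::zero) \<Rightarrow> bool" where
  "nondegenerate \<omega> \<longleftrightarrow> (\<forall>g. \<exists>h e. e \<noteq> 0 \<and> (\<forall>g'. \<omega> h g' = (if g' = g then e else 0)))"

context quasi_commuting
begin

lemma opr_commutes_word:
  assumes "\<And>g'. g' \<in> set l \<Longrightarrow> \<omega> h g' = 0"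
  shows "opr h (foldr opr l u) = foldr opr l (opr h u)"
  using assms by (induction l) (auto simp: opr_opr[of h])

text \<open>The product rule for a power, the commutator being a scalar. At \<open>n = 0\<close> the
  truncated \<open>n - 1\<close> is harmless since the factor \<open>of_nat n\<close>
  vanishes.\<close>

lemma opr_replicate:
  "opr h (foldr opr (replicate n g) u) =
     foldr opr (replicate n g) (opr h u) + scale (of_nat n * \<omega> h g) (foldr opr (replicate (n - 1) g) u)"
proof (induction n)
  case 0
  then show ?case by simp
next
  case (Suc n)
  have "opr g (foldr opr (replicate (n - 1) g) u) = foldr opr (replicate n g) u" if "n > 0"
    using that by (cases n) auto
  then show ?case
    using Suc by (cases "n = 0") (simp_all add: opr_opr[of h g] opr_add opr_scale algebra_simps scale_left_distrib)
qed

text \<open>For \<open>h\<close> dual to \<open>g\<close>, the commutator with \<open>opr h\<close> differentiates ordered monomials with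
  respect to \<open>opr g\<close>.\<close>

lemma opr_power_word:
  assumes h: "\<And>g'. \<omega> h g' = (if g' = g then e else 0)" and "distinct gs"
  shows "opr h (foldr opr (power_word gs \<mu>) u) - foldr opr (power_word gs \<mu>) (opr h u) =
     (if g \<in> set gs then scale (of_nat (\<mu> g) * e) (foldr opr (power_word gs (\<mu>(g := \<mu> g - 1))) u) else 0)"
  using assms(2)
proof (induction gs)
  case Nil
  then show ?case by (simp add: power_word_def)
next
  case (Cons a gs)
  let ?r = "foldr opr (replicate (\<mu> a) a)" and ?w = "foldr opr (power_word gs \<mu>)"
  have split: "power_word (a # gs) \<nu> = replicate (\<nu> a) a @ power_word gs \<nu>" for \<nu>
    by (simp add: power_word_def)
  show ?case
  proof (cases "a = g")
    case True
    then have g: "g \<notin> set gs" using Cons.prems by simp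
    have "opr h (?w u) = ?w (opr h u)"
      using Cons g by simp
    then show ?thesis
      unfolding split using True g by (simp add: opr_replicate h monomial_word_remove del: foldr_replicate)
  next
    case False
    then have "opr h (?r (?w u)) = ?r (opr h (?w u))"
      by (intro opr_commutes_word) (auto simp: h)
    also have "opr h (?w u) = ?w (opr h u) +
        (if g \<in> set gs then scale (of_nat (\<mu> g) * e) (foldr opr (power_word gs (\<mu>(g := \<mu> g - 1))) u) else 0)"
      using Cons by (simp add: algebra_simps)
    finally show ?thesis
      unfolding split using False by (simp add: foldr_opr_add foldr_opr_scale foldr_opr_zero del: foldr_replicate)
  qed
qed

end

lemma degree_of_eq_0_iff: "degree_of \<mu> = 0 \<longleftrightarrow> \<mu> = (\<lambda>_. 0)"
  by (auto simp: degree_of_def)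

lemma monomial_word_0: "monomial_word (\<lambda>_. 0) = []"
  by (simp add: monomial_word_def power_word_def)

lemma increment_decrement: "\<mu> g \<noteq> 0 \<Longrightarrow> increment (\<mu>(g := \<mu> g - 1)) g = \<mu>"
  for \<mu> :: "'g \<Rightarrow> nat"
  by auto

text \<open>The argument for simplicity of the Weyl algebra. If a polynomial \<open>P\<close> in the
  operators sends everything into the stable subspace \<open>N\<close>, so does its commutator with
  any \<open>opr h\<close>, hence each derivative of \<open>P\<close>. In characteristic zero,
  suitable repeated differentiation leaves a non-zero constant.\<close>

lemma (in quasi_commuting) monomial_relation_trivial:
  fixes c :: "('g \<Rightarrow> nat) \<Rightarrow> 'k"
  assumes char0: "\<And>n. of_nat (Suc n) \<noteq> (0 :: 'k)"
    and "nondegenerate \<omega>" and N: "subspace N" "\<And>h u. u \<in> N \<Longrightarrow> opr h u \<in> N"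
    and "finite S" "\<mu>0 \<in> S" "c \<mu>0 \<noteq> 0"
    and "\<And>u. (\<Sum>\<mu>\<in>S. scale (c \<mu>) (foldr opr (monomial_word \<mu>) u)) \<in> N"
  shows "u \<in> N"
proof -
  define d where "d = Max (degree_of ` S)"
  have "\<And>\<mu>. \<mu> \<in> S \<Longrightarrow> degree_of \<mu> \<le> d" using assms(5) by (simp add: d_def)
  then show ?thesis
    using assms(5-)
  proof (induction d arbitrary: S c \<mu>0)
    case 0
    then have "S = {\<lambda>_. 0}" using degree_of_eq_0_iff by fastforce
    then have "scale (c \<mu>0) u \<in> N" "c \<mu>0 \<noteq> 0" using 0 by (auto simp: monomial_word_0)
    then show ?case using subspace_scale[OF N(1), of "scale (c \<mu>0) u" "inverse (c \<mu>0)"] by simp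
  next
    case (Suc d)
    let ?P = "\<lambda>S c u. \<Sum>\<mu>\<in>S. scale (c \<mu>) (foldr opr (monomial_word \<mu>) u)"
    show ?case
    \<comment> \<open>\<open>S\<close> may carry zero coefficients; if no non-constant exponent has
      a non-zero one, the polynomial is the non-zero constant \<open>c \<mu>0\<close>.\<close>
    proof (cases "\<exists>\<mu>\<in>S. c \<mu> \<noteq> 0 \<and> \<mu> \<noteq> (\<lambda>_. 0)")
      case False
      then have "?P S c u = ?P {\<mu>0} c u"
        using Suc.prems by (intro sum.mono_neutral_right) auto
      then have "scale (c \<mu>0) u \<in> N" using Suc.prems(5)[of u] False Suc.prems(3,4) by (auto simp: monomial_word_0)
      then show ?thesis
        using subspace_scale[OF N(1), of "scale (c \<mu>0) u" "inverse (c \<mu>0)"] Suc.prems(4) by simp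
    next
      case True
      then obtain \<mu>1 g where \<mu>1: "\<mu>1 \<in> S" "c \<mu>1 \<noteq> 0" "\<mu>1 g \<noteq> 0" by fastforce
      obtain h e where h: "e \<noteq> 0" "\<And>g'. \<omega> h g' = (if g' = g then e else 0)"
        using assms(2) unfolding nondegenerate_def by metis
      \<comment> \<open>Support and coefficients of the derivative in \<open>g\<close>: exponents
        drop by one in \<open>g\<close>, and a coefficient picks up the old exponent and the
        commutator value \<open>e\<close>.\<close>
      define S' where "S' = {\<nu>. increment \<nu> g \<in> S}"
      define c' where "c' \<nu> = c (increment \<nu> g) * (of_nat (Suc (\<nu> g)) * e)" for \<nu>
      have fin: "finite S'"
      proof (rule finite_imageD)
        show "finite ((\<lambda>\<nu>. increment \<nu> g) ` S')"
          by (rule finite_subset[OF _ Suc.prems(2)]) (auto simp: S'_def)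
        show "inj_on (\<lambda>\<nu>. increment \<nu> g) S'"
          by (rule inj_onI) (metis fun_upd_eqD fun_upd_triv fun_upd_upd old.nat.inject)
      qed
      have "?P S' c' v \<in> N" for v
      proof -
        have d: "opr h (foldr opr (monomial_word \<mu>) v) - foldr opr (monomial_word \<mu>) (opr h v) =
            scale (of_nat (\<mu> g) * e) (foldr opr (monomial_word (\<mu>(g := \<mu> g - 1))) v)" for \<mu>
          using opr_power_word[of h g e generator_list \<mu> v, OF h(2)]
          by (simp add: generator_list monomial_word_def)
        have "opr h (?P S c v) = (\<Sum>\<mu>\<in>S. scale (c \<mu>) (opr h (foldr opr (monomial_word \<mu>) v)))"
          using Suc.prems(2) by (induction S) (auto simp: opr_zero opr_add opr_scale)
        then have "opr h (?P S c v) - ?P S c (opr h v) =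
            (\<Sum>\<mu>\<in>S. scale (c \<mu>) (opr h (foldr opr (monomial_word \<mu>) v) - foldr opr (monomial_word \<mu>) (opr h v)))"
          by (simp add: scale_right_diff_distrib sum_subtractf)
        also have "\<dots> = (\<Sum>\<mu>\<in>S. scale (c \<mu> * (of_nat (\<mu> g) * e)) (foldr opr (monomial_word (\<mu>(g := \<mu> g - 1))) v))"
          by (simp add: d)
        also have "\<dots> = (\<Sum>\<mu>\<in>{\<mu> \<in> S. \<mu> g \<noteq> 0}. scale (c \<mu> * (of_nat (\<mu> g) * e)) (foldr opr (monomial_word (\<mu>(g := \<mu> g - 1))) v))"
          using Suc.prems(2) by (intro sum.mono_neutral_right) auto
        also have "\<dots> = ?P S' c' v"
          by (rule sum.reindex_bij_witness[of _ "\<lambda>\<nu>. increment \<nu> g" "\<lambda>\<mu>. \<mu>(g := \<mu> g - 1)"])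
            (auto simp: S'_def c'_def increment_decrement)
        finally have eq: "opr h (?P S c v) - ?P S c (opr h v) = ?P S' c' v" .
        show ?thesis
          unfolding eq[symmetric] by (intro subspace_diff[OF N(1)] N(2) Suc.prems(5))
      qed
      moreover have "degree_of \<nu> \<le> d" if "\<nu> \<in> S'" for \<nu>
      proof -
        have "degree_of (increment \<nu> g) \<le> Suc d" using that Suc.prems(1) unfolding S'_def by blast
        then show ?thesis unfolding degree_of_increment by simp
      qed
      moreover have "\<mu>1(g := \<mu>1 g - 1) \<in> S'" "c' (\<mu>1(g := \<mu>1 g - 1)) \<noteq> 0"
        using \<mu>1 h(1) char0[of "\<mu>1 g - 1"] by (auto simp: S'_def c'_def increment_decrement)
      ultimately show ?thesis using Suc.IH[of S'] fin by blast
    qed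
  qed
qed

section \<open>Growth of commuting families of operators\<close>

lemma card_product_functions:
  "card {\<mu> :: 'g::finite \<Rightarrow> nat. \<forall>g. \<mu> g \<in> T g} = (\<Prod>g\<in>UNIV. card (T g))"
  using card_PiE[of "UNIV :: 'g set" T] by (simp add: PiE_UNIV_domain Pi_def)

text \<open>The cube of exponents with entries at most \<open>i\<close> lies in the simplex of
  degrees at most \<open>CARD('g) * i\<close>.\<close>

lemma card_bounded_degree_ge:
  "(Suc i) ^ CARD('g) \<le> card {\<mu> :: 'g::finite \<Rightarrow> nat. degree_of \<mu> < Suc (CARD('g) * i)}"
proof -
  have "(Suc i) ^ CARD('g) = card {\<mu> :: 'g \<Rightarrow> nat. \<forall>g. \<mu> g \<in> {..i}}"
    by (subst card_product_functions) auto
  also have "\<dots> \<le> card {\<mu> :: 'g \<Rightarrow> nat. degree_of \<mu> < Suc (CARD('g) * i)}"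
  proof (rule card_mono[OF finite_bounded_degree])
    show "{\<mu> :: 'g \<Rightarrow> nat. \<forall>g. \<mu> g \<in> {..i}} \<subseteq> {\<mu>. degree_of \<mu> < Suc (CARD('g) * i)}"
    proof
      fix \<mu> :: "'g \<Rightarrow> nat" assume "\<mu> \<in> {\<mu>. \<forall>g. \<mu> g \<in> {..i}}"
      then have "degree_of \<mu> \<le> (\<Sum>g\<in>(UNIV :: 'g set). i)"
        unfolding degree_of_def by (intro sum_mono) simp
      then show "\<mu> \<in> {\<mu>. degree_of \<mu> < Suc (CARD('g) * i)}" by simp
    qed
  qed
  finally show ?thesis .
qed

lemma entry_less_of_degree_less: "degree_of \<mu> < d \<Longrightarrow> \<mu> g < d"
  using member_le_sum[of g UNIV \<mu>] by (simp add: degree_of_def)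

lemma card_bounded_degree_le: "card {\<mu> :: 'g::finite \<Rightarrow> nat. degree_of \<mu> < d} \<le> d ^ CARD('g)"
proof -
  have "card {\<mu> :: 'g \<Rightarrow> nat. degree_of \<mu> < d} \<le> card {\<mu> :: 'g \<Rightarrow> nat. \<forall>g. \<mu> g \<in> {..<d}}"
    by (rule card_mono) (auto simp: entry_less_of_degree_less PiE_UNIV_domain[symmetric] Pi_def
        intro: finite_subset[OF _ finite_PiE[of UNIV "\<lambda>_. {..<d}"]])
  also have "\<dots> = d ^ CARD('g)" by (subst card_product_functions) auto
  finally show ?thesis .
qed

text \<open>If \<open>\<nu>\<close> is not below \<open>\<mu>\<close>, some coordinate
  \<open>k\<close> has \<open>\<mu> k < \<nu> k\<close>. Within the cube of side \<open>d\<close>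
  these exponents lie in a slab of \<open>\<nu> k * d ^ (CARD('g) - 1)\<close> points, and summing
  over \<open>k\<close> produces the degree of \<open>\<nu>\<close>.\<close>

lemma card_not_above_le:
  "card {\<mu> :: 'g::finite \<Rightarrow> nat. degree_of \<mu> < d \<and> \<not> \<nu> \<le> \<mu>} \<le> degree_of \<nu> * d ^ (CARD('g) - 1)"
proof -
  let ?B = "\<lambda>k. {\<mu> :: 'g \<Rightarrow> nat. \<forall>g. \<mu> g \<in> (if g = k then {..<\<nu> k} else {..<d})}"
  have B: "card (?B k) = \<nu> k * d ^ (CARD('g) - 1)" for k
  proof -
    have "card (?B k) = (\<Prod>g\<in>UNIV. card (if g = k then {..<\<nu> k} else {..<d}))"
      by (rule card_product_functions)
    also have "\<dots> = \<nu> k * (\<Prod>g\<in>UNIV - {k}. card (if g = k then {..<\<nu> k} else {..<d}))"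
      by (subst prod.remove[of _ k]) auto
    also have "(\<Prod>g\<in>UNIV - {k}. card (if g = k then {..<\<nu> k} else {..<d})) = (\<Prod>g\<in>UNIV - {k}. d)"
      by (intro prod.cong) auto
    finally show ?thesis by simp
  qed
  have fin: "finite (?B k)" for k
    using finite_PiE[of UNIV "\<lambda>g. if g = k then {..<\<nu> k} else {..<d}"]
    by (simp add: PiE_UNIV_domain Pi_def)
  have "card {\<mu> :: 'g \<Rightarrow> nat. degree_of \<mu> < d \<and> \<not> \<nu> \<le> \<mu>} \<le> card (\<Union>k. ?B k)"
    by (rule card_mono) (use fin in \<open>auto simp: le_fun_def not_le entry_less_of_degree_less\<close>)
  also have "\<dots> \<le> (\<Sum>k\<in>UNIV. card (?B k))" by (rule card_UN_le) simp
  also have "\<dots> = degree_of \<nu> * d ^ (CARD('g) - 1)"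
    unfolding B by (simp add: degree_of_def sum_distrib_right)
  finally show ?thesis .
qed

text \<open>The final proof instantiates this twice, with left multiplications as \<open>L\<close>
  and right ones as \<open>R\<close>, and with the roles exchanged.\<close>

locale commuting_pair =
  L: quasi_commuting scale L \<omega>L + R: quasi_commuting scale R \<omega>R
  for scale :: "'k::field_char_0 \<Rightarrow> 'm::ab_group_add \<Rightarrow> 'm"
    and L R :: "'g::finite \<Rightarrow> 'm \<Rightarrow> 'm" and \<omega>L \<omega>R :: "'g \<Rightarrow> 'g \<Rightarrow> 'k" +
  assumes L_R: "L g (R h u) = R h (L g u)"
    and nondegenerate: "nondegenerate \<omega>R"
begin

lemma foldr_L_R: "foldr L l (R h u) = R h (foldr L l u)"
  by (induction l) (auto simp: L_R)

lemma L_foldr_R: "L g (foldr R l u) = foldr R l (L g u)"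
  by (induction l) (auto simp: L_R)

definition invariant :: "'m set \<Rightarrow> bool" where
  "invariant N \<longleftrightarrow> L.subspace N \<and> (\<forall>g. \<forall>u\<in>N. L g u \<in> N \<and> R g u \<in> N)"

lemma invariant_0: "invariant {0}"
  by (simp add: invariant_def L.opr_zero R.opr_zero)

text \<open>\<open>R g\<close> commutes with words in \<open>L\<close>, so its effect on the whole
  filtration is governed by its values on the finite set \<open>G\<close>.\<close>

lemma R_word_span_shift:
  assumes N: "invariant N" and "finite G" and gen: "\<And>u. \<exists>d. u \<in> L.span (L.word_span G d \<union> N)"
  shows "\<exists>c. \<forall>d g u. u \<in> L.span (L.word_span G d \<union> N) \<longrightarrow> R g u \<in> L.span (L.word_span G (d + c) \<union> N)"
proof -
  define A where "A d = L.span (L.word_span G d \<union> N)" for d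
  have A: "L.subspace (A d)" for d by (simp add: A_def)
  have mono: "A d \<subseteq> A e" if "d \<le> e" for d e
    unfolding A_def using L.word_span_mono[OF that, of G] by (intro L.span_mono) auto
  have NA: "N \<subseteq> A d" for d unfolding A_def by (meson L.span_superset Un_subset_iff)
  have LA: "L g u \<in> A (Suc d)" if "u \<in> A d" for g u d
  proof (rule L.opr_span[OF _ _ A])
    show "u \<in> L.span (L.word_span G d \<union> N)" using that by (simp add: A_def)
    fix a assume "a \<in> L.word_span G d \<union> N"
    then show "L g a \<in> A (Suc d)"
      using L.opr_word_span N L.span_superset[of "L.word_span G (Suc d) \<union> N"]
      by (auto simp: A_def invariant_def)
  qed
  have foldr_A: "foldr L l u \<in> A (d + length l)" if "u \<in> A d" for l u d
    by (induction l) (use that LA in auto)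
  have "\<exists>d. R g u \<in> A d" for g u using gen by (auto simp: A_def)
  then obtain df where df: "\<And>g u. R g u \<in> A (df g u)" by metis
  define c where "c = Max (case_prod df ` (UNIV \<times> G))"
  have c: "R g a \<in> A (Suc c)" if "a \<in> G" for g a
  proof -
    have "df g a \<le> c" unfolding c_def using that assms(2) by (intro Max_ge) force+
    then show ?thesis using df[of g a] mono[of "df g a" "Suc c"] by auto
  qed
  have "R g u \<in> A (d + c)" if "u \<in> A d" for g u d
  proof (rule R.opr_span[OF _ _ A])
    show "u \<in> L.span (L.word_span G d \<union> N)" using that by (simp add: A_def)
    fix a assume "a \<in> L.word_span G d \<union> N"
    then show "R g a \<in> A (d + c)"
    proof
      assume "a \<in> N"
      then show ?thesis using N NA by (auto simp: invariant_def)
    next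
      have "L.word_span G d \<subseteq> {a. R g a \<in> A (d + c)}"
      proof (rule L.word_span_le[OF R.subspace_opr_preimage[OF A]])
        fix l :: "'g list" and m assume "length l < d" "m \<in> G"
        then show "foldr L l m \<in> {a. R g a \<in> A (d + c)}"
          using foldr_A[OF c[of m g], of l] mono[of "Suc c + length l" "d + c"] by (auto simp: foldr_L_R)
      qed
      moreover assume "a \<in> L.word_span G d"
      ultimately show ?thesis by blast
    qed
  qed
  then show ?thesis unfolding A_def by blast
qed

text \<open>A polynomial \<open>Q\<close> in the operators \<open>R\<close> commutes with
  \<open>L\<close>, so the elements that \<open>Q\<close> sends into \<open>N\<close> are closed
  under \<open>L\<close>. A relation shared by all generators thus holds everywhere, and the
  simplicity argument applies.\<close>

lemma relation_propagates:
  assumes N: "invariant N" and gen: "\<And>u. \<exists>d. u \<in> L.span (L.word_span G d \<union> N)"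
    and rel: "\<And>m. m \<in> G \<Longrightarrow> (\<Sum>\<mu>\<in>S. scale (c \<mu>) (foldr R (monomial_word \<mu>) m)) \<in> N"
    and "finite S" "\<mu>0 \<in> S" "c \<mu>0 \<noteq> 0"
  shows "u \<in> N"
proof (rule R.monomial_relation_trivial[OF _ nondegenerate, of N S \<mu>0 c])
  show N': "L.subspace N" using N by (simp add: invariant_def)
  define Q where "Q u = (\<Sum>\<mu>\<in>S. scale (c \<mu>) (foldr R (monomial_word \<mu>) u))" for u
  have Q_add: "Q (u + v) = Q u + Q v" for u v
    by (simp add: Q_def R.foldr_opr_add L.scale_right_distrib sum.distrib)
  have Q_scale: "Q (scale a u) = scale a (Q u)" for a u
    by (simp add: Q_def R.foldr_opr_scale L.scale_sum_right mult.commute)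
  have Q_0: "Q 0 = 0" by (simp add: Q_def R.foldr_opr_zero)
  have Q_L: "Q (L g u) = L g (Q u)" for g u
    unfolding Q_def using assms(4)
    by (induction S) (auto simp: L.opr_zero L.opr_add L.opr_scale L_foldr_R)
  have pre: "L.subspace {u. Q u \<in> N}"
    using N' by (simp add: L.subspace_def Q_add Q_scale Q_0)
  have Q_N: "Q u \<in> N" if "u \<in> N" for u
  proof -
    have "foldr R l u \<in> N" for l using that N by (induction l) (auto simp: invariant_def)
    then show ?thesis unfolding Q_def using N' by (intro L.subspace_sum L.subspace_scale)
  qed
  show "Q u \<in> N" for u
  proof -
    obtain d where "u \<in> L.span (L.word_span G d \<union> N)" using gen by blast
    moreover have "L.word_span G d \<subseteq> {u. Q u \<in> N}"
    proof (rule L.word_span_le[OF pre])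
      fix l :: "'g list" and m assume "m \<in> G"
      then have "Q m \<in> N" using rel by (simp add: Q_def)
      then have "Q (foldr L l m) \<in> N" using N by (induction l) (auto simp: Q_L invariant_def)
      then show "foldr L l m \<in> {u. Q u \<in> N}" by simp
    qed
    ultimately show ?thesis using L.span_minimal[OF _ pre, of "L.word_span G d \<union> N"] Q_N by blast
  qed
qed (use assms in \<open>auto simp: invariant_def simp del: of_nat_Suc\<close>)

text \<open>The left growth of a cyclic module with a relation has degree at most \<open>CARD('g) - 1\<close>, which is too
  small to contain the right orbit of the generator unless that orbit has a relation as well.\<close>

lemma cyclic_relation_trivial:
  assumes N: "invariant N" and gen: "\<And>u. \<exists>d. u \<in> L.span (L.word_span {m} d \<union> N)"
    and S: "finite S" "\<mu>0 \<in> S" "c \<mu>0 \<noteq> 0" "(\<Sum>\<mu>\<in>S. scale (c \<mu>) (foldr L (monomial_word \<mu>) m)) \<in> N"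
  shows "u \<in> N"
proof -
  \<comment> \<open>A single generator leaves no ties to break, so the index is constant.\<close>
  define idx where "idx = (\<lambda>_ :: 'm. 0 :: nat)"
  let ?q = "CARD('g)" and ?key = "\<lambda>\<mu> :: 'g \<Rightarrow> nat. monomial_key idx (\<mu>, m)"
  have N': "L.subspace N" using N by (simp add: invariant_def)
  \<comment> \<open>\<open>\<mu>1\<close> is the largest exponent with a non-zero coefficient in the
    relation; solving for its monomial shows that it is reducible.\<close>
  obtain \<mu>1 where red: "L.reducible idx N {m} \<mu>1 m"
  proof -
    define S1 where "S1 = {\<mu> \<in> S. c \<mu> \<noteq> 0}"
    have S1: "finite S1" "S1 \<noteq> {}" using S by (auto simp: S1_def)
    obtain \<mu>1 where \<mu>1: "\<mu>1 \<in> S1" "Max (?key ` S1) = ?key \<mu>1"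
      by (rule obtains_MAX[OF S1, of ?key])
    define B where "B = L.span (below (monomial_key idx) L.monomial (UNIV \<times> {m}) (\<mu>1, m) \<union> N)"
    have B: "L.subspace B" "N \<subseteq> B" unfolding B_def by (simp, meson L.span_superset Un_subset_iff)
    have "L.monomial (\<mu>, m) \<in> B" if "\<mu> \<in> S1 - {\<mu>1}" for \<mu>
    proof -
      have "?key \<mu> \<le> ?key \<mu>1" using Max_ge[of "?key ` S1" "?key \<mu>"] that S1(1) by (simp add: \<mu>1(2))
      moreover have "inj_on (monomial_key idx) (UNIV \<times> {m} :: (('g \<Rightarrow> nat) \<times> 'm) set)"
        by (rule inj_on_monomial_key) simp
      then have "?key \<mu> \<noteq> ?key \<mu>1" using that by (auto simp: inj_on_def)
      ultimately have "?key \<mu> < ?key \<mu>1" by simp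
      then show ?thesis unfolding B_def below_def by (intro L.span_base) blast
    qed
    then have "(\<Sum>\<mu>\<in>S1 - {\<mu>1}. scale (c \<mu>) (L.monomial (\<mu>, m))) \<in> B"
      by (intro L.subspace_sum[OF B(1)] L.subspace_scale[OF B(1)])
    moreover have "(\<Sum>\<mu>\<in>S1. scale (c \<mu>) (L.monomial (\<mu>, m))) \<in> B"
    proof -
      have "(\<Sum>\<mu>\<in>S1. scale (c \<mu>) (L.monomial (\<mu>, m))) = (\<Sum>\<mu>\<in>S. scale (c \<mu>) (foldr L (monomial_word \<mu>) m))"
        using S(1) by (intro sum.mono_neutral_cong_left) (auto simp: S1_def L.monomial_def)
      then show ?thesis using S(4) B(2) by auto
    qed
    ultimately have "scale (c \<mu>1) (L.monomial (\<mu>1, m)) \<in> B"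
      using S1 \<mu>1(1) L.subspace_diff[OF B(1)] by (simp add: sum.remove) fastforce
    then have "scale (inverse (c \<mu>1)) (scale (c \<mu>1) (L.monomial (\<mu>1, m))) \<in> B"
      by (rule L.subspace_scale[OF B(1)])
    then have "L.monomial (\<mu>1, m) \<in> B" using \<mu>1(1) by (simp add: S1_def)
    then show ?thesis using that by (simp add: L.reducible_def B_def)
  qed
  define T where "T d = {\<mu>. degree_of \<mu> < d \<and> \<not> L.reducible idx N {m} \<mu> m}" for d
  have finT: "finite (T d)" for d
    by (rule finite_subset[OF _ finite_bounded_degree[of d]]) (auto simp: T_def)
  \<comment> \<open>Reducibility spreads upwards from \<open>\<mu>1\<close>, and this lowers the
    growth exponent by one.\<close>
  have cardT: "card (T d) \<le> degree_of \<mu>1 * d ^ (?q - 1)" for d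
  proof -
    have "T d \<subseteq> {\<mu>. degree_of \<mu> < d \<and> \<not> \<mu>1 \<le> \<mu>}"
      using L.reducible_upward[OF red] N by (auto simp: T_def invariant_def)
    then have "card (T d) \<le> card {\<mu>. degree_of \<mu> < d \<and> \<not> \<mu>1 \<le> \<mu>}"
      by (intro card_mono) (auto intro: finite_subset[OF _ finite_bounded_degree[of d]])
    then show ?thesis using card_not_above_le order_trans by blast
  qed
  have spanT: "L.span (L.word_span {m} d \<union> N) \<subseteq> L.span ((\<lambda>\<mu>. L.monomial (\<mu>, m)) ` T d \<union> N)" for d
  proof (rule L.span_minimal[OF _ L.subspace_span])
    have "{t. degree_of (fst t) < d \<and> snd t \<in> {m} \<and> \<not> L.reducible idx N {m} (fst t) (snd t)} = (\<lambda>\<mu>. (\<mu>, m)) ` T d"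
      by (auto simp: T_def)
    then have "L.word_span {m} d \<subseteq> L.span ((\<lambda>\<mu>. L.monomial (\<mu>, m)) ` T d \<union> N)"
      using L.span_irreducible_monomials[of "{m}" idx d N] by (simp add: image_image)
    moreover have "N \<subseteq> L.span ((\<lambda>\<mu>. L.monomial (\<mu>, m)) ` T d \<union> N)"
      by (meson L.span_superset Un_subset_iff)
    ultimately show "L.word_span {m} d \<union> N \<subseteq> L.span ((\<lambda>\<mu>. L.monomial (\<mu>, m)) ` T d \<union> N)" by blast
  qed
  obtain b where b: "\<And>d g u. u \<in> L.span (L.word_span {m} d \<union> N) \<Longrightarrow> R g u \<in> L.span (L.word_span {m} (d + b) \<union> N)"
    using R_word_span_shift[OF N _ gen] by auto
  have R_word: "foldr R l m \<in> L.span (L.word_span {m} (Suc (b * length l)) \<union> N)" for l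
  proof (induction l)
    case Nil
    have "m \<in> L.word_span {m} (Suc 0)" using L.word_in_word_span[of "[]" "Suc 0" m "{m}"] by simp
    then show ?case by (simp add: L.span_base)
  next
    case (Cons g l)
    then show ?case using b[OF Cons, of g] by (simp add: algebra_simps)
  qed
  \<comment> \<open>Write \<open>q\<close> for \<open>CARD('g)\<close>. Degrees up to
    \<open>q K\<close> give at least \<open>(K+1)^q\<close> right monomials. Their values at
    \<open>m\<close> lie, modulo \<open>N\<close>, in the span of at most
    \<open>|\<mu>1| (b q K + 1)^(q-1)\<close> left monomials. Bounding the bracket by
    \<open>(b q + 1) (K+1)\<close> turns this into \<open>K (K+1)^(q-1)\<close>, which is
    smaller.\<close>
  define K where "K = degree_of \<mu>1 * Suc (b * ?q) ^ (?q - 1)"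
  let ?S = "{\<mu> :: 'g \<Rightarrow> nat. degree_of \<mu> < Suc (?q * K)}" and ?d = "Suc (b * (?q * K))"
  have "card ((\<lambda>\<mu>. L.monomial (\<mu>, m)) ` T ?d) \<le> card (T ?d)" by (rule card_image_le[OF finT])
  also have "\<dots> \<le> degree_of \<mu>1 * ?d ^ (?q - 1)" by (rule cardT)
  also have "\<dots> \<le> degree_of \<mu>1 * (Suc (b * ?q) * Suc K) ^ (?q - 1)"
    by (intro mult_left_mono power_mono) (auto simp: algebra_simps)
  also have "\<dots> = K * Suc K ^ (?q - 1)" by (simp only: K_def power_mult_distrib mult.assoc)
  also have "\<dots> < Suc K * Suc K ^ (?q - 1)" by simp
  also have "\<dots> = Suc K ^ ?q" by (metis One_nat_def Suc_pred power_Suc zero_less_card_finite)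
  also have "\<dots> \<le> card ?S" by (rule card_bounded_degree_ge)
  finally have less: "card ((\<lambda>\<mu>. L.monomial (\<mu>, m)) ` T ?d) < card ?S" .
  have "foldr R (monomial_word \<mu>) m \<in> L.span ((\<lambda>\<mu>. L.monomial (\<mu>, m)) ` T ?d \<union> N)" if "\<mu> \<in> ?S" for \<mu>
  proof -
    have "Suc (b * length (monomial_word \<mu>)) \<le> ?d" using that by (simp add: length_monomial_word)
    then have "L.span (L.word_span {m} (Suc (b * length (monomial_word \<mu>))) \<union> N) \<subseteq> L.span (L.word_span {m} ?d \<union> N)"
      by (intro L.span_mono Un_mono L.word_span_mono) auto
    then show ?thesis using R_word spanT by blast
  qed
  from L.exists_relation_mod[where f = "\<lambda>\<mu>. foldr R (monomial_word \<mu>) m",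
      OF finite_imageI[OF finT] N' finite_bounded_degree less this]
  obtain c' where c': "\<exists>\<mu>\<in>?S. c' \<mu> \<noteq> 0" "(\<Sum>\<mu>\<in>?S. scale (c' \<mu>) (foldr R (monomial_word \<mu>) m)) \<in> N"
    by auto
  then obtain \<mu>2 where "\<mu>2 \<in> ?S" "c' \<mu>2 \<noteq> 0" by blast
  with c'(2) show ?thesis
    using relation_propagates[OF N gen, where S = ?S and c = c' and ?\<mu>0.0 = \<mu>2]
      finite_bounded_degree by blast
qed

end

section \<open>The degree of the Hilbert polynomial\<close>

lemma poly_bound:
  fixes p :: "'a::linordered_field poly"
  shows "\<exists>C\<ge>0. \<forall>x\<ge>1. \<bar>poly p x\<bar> \<le> C * x ^ degree p"
proof (intro exI conjI allI impI)
  let ?C = "\<Sum>i\<le>degree p. \<bar>coeff p i\<bar>"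
  show "?C \<ge> 0" by (simp add: sum_nonneg)
  fix x :: 'a assume x: "x \<ge> 1"
  have "\<bar>poly p x\<bar> \<le> (\<Sum>i\<le>degree p. \<bar>coeff p i * x ^ i\<bar>)"
    unfolding poly_altdef by (rule sum_abs)
  also have "\<dots> \<le> (\<Sum>i\<le>degree p. \<bar>coeff p i\<bar> * x ^ degree p)"
    using x by (intro sum_mono) (auto simp: abs_mult intro!: mult_left_mono power_increasing)
  finally show "\<bar>poly p x\<bar> \<le> ?C * x ^ degree p" by (simp add: sum_distrib_right)
qed

lemma degree_le_of_upper_bound:
  fixes p :: "'a::archimedean_field poly"
  assumes "\<forall>\<^sub>F i in sequentially. \<bar>poly p (of_nat i)\<bar> \<le> C * of_nat (Suc i) ^ q"
  shows "degree p \<le> q"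
proof (rule ccontr)
  assume "\<not> degree p \<le> q"
  then obtain d where d: "degree p = Suc d" "q \<le> d" by (cases "degree p") auto
  define r where "r = p - monom (lead_coeff p) (degree p)"
  have "degree r \<le> d"
  proof (rule degree_le, intro allI impI)
    fix i assume "d < i"
    then consider "i = Suc d" | "degree p < i" using d by linarith
    then show "coeff r i = 0" by cases (auto simp: r_def d(1) coeff_eq_0)
  qed
  obtain B where B: "B \<ge> 0" "\<And>x. x \<ge> 1 \<Longrightarrow> \<bar>poly r x\<bar> \<le> B * x ^ degree r"
    using poly_bound[of r] by auto
  have "lead_coeff p \<noteq> 0" using d(1) by (metis degree_0 leading_coeff_0_iff nat.distinct(1))
  \<comment> \<open>Cancelling \<open>x^d\<close> from the estimates below leaves
    \<open>|lead_coeff p| * x <= max C 0 * 2^q + B\<close>, so \<open>x\<close> cannot exceed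
    \<open>K\<close>. The power of two comes from \<open>i + 1 <= 2 i\<close>, and
    \<open>max\<close> guards against negative \<open>C\<close>.\<close>
  define K where "K = (max C 0 * 2 ^ q + B) / \<bar>lead_coeff p\<bar>"
  obtain n where n: "K < of_nat n" using reals_Archimedean2 by blast
  obtain i where i: "i \<ge> max n 1" "\<bar>poly p (of_nat i)\<bar> \<le> C * of_nat (Suc i) ^ q"
    using eventually_happens'[OF sequentially_bot eventually_conj[OF assms eventually_ge_at_top[of "max n 1"]]]
    by blast
  let ?x = "of_nat i :: 'a"
  have x: "?x \<ge> 1" using i(1) by simp
  have "\<bar>lead_coeff p\<bar> * ?x ^ Suc d = \<bar>poly p ?x - poly r ?x\<bar>"
    by (simp add: r_def poly_monom abs_mult d(1))
  also have "\<dots> \<le> \<bar>poly p ?x\<bar> + \<bar>poly r ?x\<bar>" by (rule abs_triangle_ineq4)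
  also have "\<bar>poly r ?x\<bar> \<le> B * ?x ^ d"
    using B(2)[OF x] power_increasing[OF \<open>degree r \<le> d\<close> x] B(1) by (meson mult_left_mono order_trans)
  also have "\<bar>poly p ?x\<bar> \<le> max C 0 * (2 ^ q * ?x ^ d)"
  proof -
    have "of_nat (Suc i) ^ q \<le> (2 * ?x) ^ q" using x by (intro power_mono) auto
    also have "\<dots> \<le> 2 ^ q * ?x ^ d"
      using power_increasing[OF d(2) x] by (simp add: power_mult_distrib)
    finally have "C * of_nat (Suc i) ^ q \<le> max C 0 * (2 ^ q * ?x ^ d)"
      by (intro mult_mono) auto
    then show ?thesis using i(2) by linarith
  qed
  finally have "\<bar>lead_coeff p\<bar> * ?x * ?x ^ d \<le> (max C 0 * 2 ^ q + B) * ?x ^ d"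
    by (simp add: algebra_simps)
  then have "\<bar>lead_coeff p\<bar> * ?x \<le> max C 0 * 2 ^ q + B" using x by simp
  then have "?x \<le> K" using \<open>lead_coeff p \<noteq> 0\<close> by (simp add: K_def pos_le_divide_eq mult.commute)
  moreover have "of_nat n \<le> ?x" using i(1) by simp
  ultimately show False using n by linarith
qed

lemma degree_ge_of_lower_bound:
  fixes p :: "'a::archimedean_field poly"
  assumes "\<forall>\<^sub>F i in sequentially. of_nat (Suc i) ^ q \<le> poly p (of_nat (s + t * i))"
  shows "q \<le> degree p"
proof (rule ccontr)
  assume "\<not> q \<le> degree p"
  then obtain d where d: "q = Suc d" "degree p \<le> d" by (cases q) auto
  obtain B where B: "B \<ge> 0" "\<And>x. x \<ge> 1 \<Longrightarrow> \<bar>poly p x\<bar> \<le> B * x ^ degree p"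
    using poly_bound[of p] by auto
  \<comment> \<open>The second summand comes from \<open>s + t i <= (s + t) (i + 1)\<close>; the
    first covers the argument \<open>0\<close>, where \<open>poly_bound\<close> says
    nothing.\<close>
  define K where "K = \<bar>poly p (of_nat s)\<bar> + B * of_nat (s + t) ^ d"
  obtain n where n: "K < of_nat n" using reals_Archimedean2 by blast
  obtain i where i: "i \<ge> n" "of_nat (Suc i) ^ q \<le> poly p (of_nat (s + t * i))"
    using eventually_happens'[OF sequentially_bot eventually_conj[OF assms eventually_ge_at_top[of n]]]
    by blast
  let ?y = "of_nat (Suc i) :: 'a" and ?x = "of_nat (s + t * i) :: 'a"
  have y: "?y ^ d \<ge> 1" by (simp add: one_le_power del: of_nat_Suc)
  have "poly p ?x \<le> K * ?y ^ d"
  proof (cases "s + t * i = 0")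
    case True
    then have "s + t * i = s" by simp
    then have "poly p ?x \<le> \<bar>poly p (of_nat s)\<bar> * 1" by (simp only: mult_1_right abs_ge_self)
    also have "\<dots> \<le> K * ?y ^ d" using y B(1) by (intro mult_mono) (auto simp: K_def)
    finally show ?thesis .
  next
    case False
    then have x: "?x \<ge> 1" by (metis One_nat_def Suc_leI neq0_conv of_nat_1 of_nat_mono)
    have "poly p ?x \<le> B * ?x ^ degree p" using B(2)[OF x] by linarith
    also have "\<dots> \<le> B * ?x ^ d" using B(1) power_increasing[OF d(2) x] by (simp add: mult_left_mono)
    also have "\<dots> \<le> B * (of_nat (s + t) * ?y) ^ d"
    proof (intro mult_left_mono power_mono B(1))
      have "s + t * i \<le> (s + t) * Suc i" by (simp add: algebra_simps)
      then show "?x \<le> of_nat (s + t) * ?y" by (metis of_nat_mono of_nat_mult)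
    qed simp
    also have "\<dots> \<le> K * ?y ^ d"
      using y by (simp add: K_def power_mult_distrib mult_right_mono algebra_simps del: of_nat_Suc of_nat_add)
    finally show ?thesis .
  qed
  with i(2) have "?y * ?y ^ d \<le> K * ?y ^ d" by (simp only: d(1) power_Suc)
  moreover have "?y ^ d > 0" using y by linarith
  ultimately have "?y \<le> K" by simp
  moreover have "of_nat n \<le> ?y" using i(1) by (intro of_nat_mono) simp
  ultimately show False using n by linarith
qed

lemma degree_eq_of_bounds:
  fixes p :: "rat poly"
  assumes p: "\<forall>\<^sub>F i in sequentially. of_nat (f i) = poly p (of_nat i)"
    and upper: "\<And>i. f i \<le> C * Suc i ^ q"
    and lower: "\<And>i. Suc i ^ q \<le> r * f (s + t * i)" and "0 < q" "0 < t"
  shows "p \<noteq> 0 \<and> degree p = q"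
proof -
  have "\<forall>\<^sub>F i in sequentially. \<bar>poly p (of_nat i)\<bar> \<le> of_nat C * of_nat (Suc i) ^ q"
    using p
  proof eventually_elim
    case (elim i)
    have "(of_nat (f i) :: rat) \<le> of_nat (C * Suc i ^ q)" using upper by (rule of_nat_mono)
    then show ?case unfolding elim[symmetric] by (simp del: of_nat_Suc)
  qed
  then have 1: "degree p \<le> q" by (rule degree_le_of_upper_bound)
  have "filterlim (\<lambda>i. s + t * i) sequentially sequentially"
    using assms(5) by (intro filterlim_subseq) (simp add: strict_mono_def)
  then have "\<forall>\<^sub>F i in sequentially. of_nat (f (s + t * i)) = poly p (of_nat (s + t * i))"
    using p unfolding filterlim_iff by blast
  then have "\<forall>\<^sub>F i in sequentially. of_nat (Suc i) ^ q \<le> poly (smult (of_nat r) p) (of_nat (s + t * i))"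
  proof eventually_elim
    case (elim i)
    have "(of_nat (Suc i ^ q) :: rat) \<le> of_nat (r * f (s + t * i))" using lower by (rule of_nat_mono)
    then show ?case by (simp add: elim[symmetric] del: of_nat_Suc of_nat_add)
  qed
  then have "q \<le> degree (smult (of_nat r) p)" by (rule degree_ge_of_lower_bound)
  also have "\<dots> \<le> degree p" by (rule degree_smult_le)
  finally have "degree p = q" using 1 by simp
  \<comment> \<open>The zero polynomial is excluded because its degree is \<open>0\<close> and
    \<open>q\<close> is positive.\<close>
  then show ?thesis using assms(4) by auto
qed

section \<open>Growth of the left, right and bimodule filtrations\<close>

context commuting_pair
begin

lemma L_growth_upper:
  assumes "finite G"
  shows "\<exists>T. finite T \<and> card T \<le> card G * d ^ CARD('g) \<and> L.word_span G d \<subseteq> L.span T"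
proof (intro exI conjI)
  let ?T = "{\<mu> :: 'g \<Rightarrow> nat. degree_of \<mu> < d} \<times> G"
  have eq: "{t :: ('g \<Rightarrow> nat) \<times> 'm. degree_of (fst t) < d \<and> snd t \<in> G} = ?T" by auto
  have fin: "finite ?T" using assms finite_bounded_degree by blast
  then show "finite (L.monomial ` ?T)" by simp
  have "card (L.monomial ` ?T) \<le> card ?T" using fin by (rule card_image_le)
  also have "\<dots> \<le> d ^ CARD('g) * card G"
    unfolding card_cartesian_product by (intro mult_right_mono card_bounded_degree_le) simp
  finally show "card (L.monomial ` ?T) \<le> card G * d ^ CARD('g)" by (simp add: mult.commute)
  show "L.word_span G d \<subseteq> L.span (L.monomial ` ?T)"
    unfolding L.word_span_eq_monomial eq ..
qed

lemma sum_apply: "(\<Sum>i\<in>A. f i) x = (\<Sum>i\<in>A. f i x)"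
  for f :: "'i \<Rightarrow> 'x \<Rightarrow> 'y::comm_monoid_add"
  by (induction A rule: infinite_finite_induct) auto

text \<open>Apply each right monomial to all generators at once, giving a tuple in a space of
  dimension at most \<open>card G * card T\<close>. With more monomials than that, one relation
  would kill every generator and hence the whole module.\<close>

lemma R_growth_lower:
  assumes "finite G" and gen: "\<And>u. \<exists>d. u \<in> L.word_span G d" and "(UNIV :: 'm set) \<noteq> {0}"
    and T: "finite T" "\<And>\<mu> g. g \<in> G \<Longrightarrow> degree_of \<mu> \<le> CARD('g) * i \<Longrightarrow> foldr R (monomial_word \<mu>) g \<in> L.span T"
  shows "Suc i ^ CARD('g) \<le> card G * card T"
proof (rule ccontr)
  assume "\<not> ?thesis"
  then have less: "card G * card T < Suc i ^ CARD('g)" by simp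
  \<comment> \<open>Functions supported on \<open>G\<close> model the direct sum of copies of the
    module indexed by \<open>G\<close>; \<open>e g w\<close> is \<open>w\<close> placed in the
    component \<open>g\<close>.\<close>
  define fscale where "fscale c f = (\<lambda>x :: 'm. scale c (f x :: 'm))" for c f
  interpret F: vector_space fscale
    by standard (simp_all add: fscale_def fun_eq_iff L.scale_right_distrib L.scale_left_distrib)
  define e where "e g w = (\<lambda>x :: 'm. if x = g then w else (0 :: 'm))" for g w
  define T' where "T' = case_prod e ` (G \<times> T)"
  define f where "f \<mu> = (\<Sum>g\<in>G. e g (foldr R (monomial_word \<mu>) g))" for \<mu>
  let ?S = "{\<mu> :: 'g \<Rightarrow> nat. degree_of \<mu> < Suc (CARD('g) * i)}"
  have "card T' \<le> card G * card T"
    unfolding T'_def using card_image_le[of "G \<times> T" "case_prod e"] assms(1) T(1)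
    by (simp add: card_cartesian_product)
  also note less
  also have "Suc i ^ CARD('g) \<le> card ?S" by (rule card_bounded_degree_ge)
  finally have less': "card T' < card ?S" .
  have e_span: "e g w \<in> F.span T'" if "g \<in> G" "w \<in> L.span T" for g w
  proof -
    have "L.subspace {w. e g w \<in> F.span T'}"
    proof (rule L.subspaceI)
      have "e g 0 = 0" by (auto simp: e_def)
      then show "0 \<in> {w. e g w \<in> F.span T'}" using F.span_zero by simp
      fix v w c assume v: "v \<in> {w. e g w \<in> F.span T'}"
      have "e g (scale c v) = fscale c (e g v)" by (auto simp: e_def fscale_def)
      then show "scale c v \<in> {w. e g w \<in> F.span T'}" using v by (simp add: F.span_scale)
      assume w: "w \<in> {w. e g w \<in> F.span T'}"
      have "e g (v + w) = e g v + e g w" by (auto simp: e_def)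
      then show "v + w \<in> {w. e g w \<in> F.span T'}" using v w by (simp add: F.span_add)
    qed
    moreover have "T \<subseteq> {w. e g w \<in> F.span T'}"
      using that(1) by (auto simp: T'_def intro!: F.span_base)
    ultimately show ?thesis using that(2) L.span_minimal by blast
  qed
  have "f \<mu> \<in> F.span (T' \<union> {0})" if "\<mu> \<in> ?S" for \<mu>
  proof -
    have "f \<mu> \<in> F.span T'"
      unfolding f_def using that by (intro F.span_sum e_span T(2)) auto
    then show ?thesis using F.span_mono[of T' "T' \<union> {0}"] by blast
  qed
  then obtain c where c: "\<exists>\<mu>\<in>?S. c \<mu> \<noteq> 0" "(\<Sum>\<mu>\<in>?S. fscale (c \<mu>) (f \<mu>)) \<in> {0}"
    using F.exists_relation_mod[of T' "{0}" ?S f] less' assms(1) T(1) finite_bounded_degree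
    by (auto simp: T'_def)
  have "(\<Sum>\<mu>\<in>?S. scale (c \<mu>) (foldr R (monomial_word \<mu>) m)) \<in> {0}" if "m \<in> G" for m
  proof -
    have "f \<mu> m = foldr R (monomial_word \<mu>) m" for \<mu>
      using that assms(1) by (simp add: f_def e_def sum_apply sum.delta if_distrib cong: if_cong)
    then have "(\<Sum>\<mu>\<in>?S. fscale (c \<mu>) (f \<mu>)) m = (\<Sum>\<mu>\<in>?S. scale (c \<mu>) (foldr R (monomial_word \<mu>) m))"
      by (simp add: sum_apply fscale_def)
    then show ?thesis using c(2) by simp
  qed
  note rel = this
  obtain \<mu>0 where \<mu>0: "\<mu>0 \<in> ?S" "c \<mu>0 \<noteq> 0" using c(1) by blast
  have "u \<in> {0}" for u :: 'm
  proof (rule relation_propagates[where c = c, OF invariant_0 _ _ finite_bounded_degree \<mu>0])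
    show "\<exists>d. u \<in> L.span (L.word_span G d \<union> {0})" for u
      using gen[of u] L.span_base by blast
  qed (rule rel)
  then show False using assms(3) by blast
qed

end

text \<open>\<open>B\<close> stands for the generators of the algebra that acts on bimodules from
  the left. The scalar factors absorb the minus sign in the action of the second half of the
  derivations.\<close>

locale combined_pair = commuting_pair scale L R \<omega>L \<omega>R + B: quasi_commuting scale B \<omega>B
  for scale :: "'k::field_char_0 \<Rightarrow> 'm::ab_group_add \<Rightarrow> 'm"
    and L R :: "'g::finite \<Rightarrow> 'm \<Rightarrow> 'm" and \<omega>L \<omega>R
    and B :: "'h::finite \<Rightarrow> 'm \<Rightarrow> 'm" and \<omega>B +
  assumes B_cases: "\<exists>g e. (\<forall>u. B h u = scale e (L g u)) \<or> (\<forall>u. B h u = scale e (R g u))"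
    and L_B: "\<exists>h e. \<forall>u. L g u = scale e (B h u)"
    and R_B: "\<exists>h e. \<forall>u. R g u = scale e (B h u)"
begin

lemma R_word_span_B: "u \<in> B.word_span G d \<Longrightarrow> R g u \<in> B.word_span G (Suc d)"
  by (metis R_B B.opr_word_span B.subspace_word_span L.subspace_scale)

lemma L_word_span_B: "u \<in> B.word_span G d \<Longrightarrow> L g u \<in> B.word_span G (Suc d)"
  by (metis L_B B.opr_word_span B.subspace_word_span L.subspace_scale)

text \<open>\<open>G\<close> generates under \<open>L\<close> alone, while \<open>G'\<close> is any
  finite generating set under \<open>B\<close>. From above, the filtration of \<open>G'\<close> is
  contained in a linearly reindexed \<open>L\<close>-filtration of \<open>G\<close>; from below, it
  contains, after a shift, the right orbits of \<open>G\<close>. Both bounds have exponent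
  \<open>CARD('g)\<close>.\<close>

lemma dimension_eq:
  assumes "finite G" and gen: "\<And>u. \<exists>d. u \<in> L.word_span G d" and "(UNIV :: 'm set) \<noteq> {0}"
    and "finite G'" and gen': "\<And>u. \<exists>d. u \<in> B.word_span G' d"
  shows "\<exists>p :: rat poly. p \<noteq> 0 \<and> degree p = CARD('g) \<and>
     (\<forall>\<^sub>F i in sequentially. of_nat (L.dim (B.word_span G' (Suc i))) = poly p (of_nat i))"
proof -
  let ?q = "CARD('g)" and ?f = "\<lambda>i. L.dim (B.word_span G' (Suc i))"
  obtain p :: "rat poly" where p: "\<forall>\<^sub>F i in sequentially. of_nat (?f i) = poly p (of_nat i)"
    using B.hilbert_polynomial[OF assms(4)] unfolding eventually_poly_def by blast
  have gen0: "\<exists>d. u \<in> L.span (L.word_span G d \<union> {0})" for u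
    using gen[of u] L.span_base by blast
  have span0: "L.span (L.word_span G d \<union> {0}) = L.word_span G d" for d
    using L.subspace_word_span[of G d] L.subspace_0[OF L.subspace_word_span, of G d]
    by (simp add: insert_absorb L.span_eq_iff)
  obtain b where b: "\<And>d g u. u \<in> L.word_span G d \<Longrightarrow> R g u \<in> L.word_span G (d + b)"
    using R_word_span_shift[OF invariant_0 assms(1) gen0] unfolding span0 by blast
  have B_step: "B h u \<in> L.word_span G (d + Suc b)" if "u \<in> L.word_span G d" for h u d
  proof -
    have "L g u \<in> L.word_span G (d + Suc b)" "R g u \<in> L.word_span G (d + Suc b)" for g
      using L.opr_word_span[OF that, of g] b[OF that, of g]
        L.word_span_mono[of "Suc d" "d + Suc b" G] L.word_span_mono[of "d + b" "d + Suc b" G] by auto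
    then show ?thesis
      using B_cases[of h] L.subspace_scale[OF L.subspace_word_span] by metis
  qed
  obtain dg where dg: "\<And>u. u \<in> L.word_span G (dg u)" using gen by metis
  \<comment> \<open>All of \<open>G'\<close> lies in the \<open>L\<close>-filtration at
    \<open>s\<close>; inserting \<open>0\<close> keeps \<open>Max\<close> meaningful for empty
    \<open>G'\<close>.\<close>
  define s where "s = Max (insert 0 (dg ` G'))"
  have s: "foldr B l g \<in> L.word_span G (s + Suc b * length l)" if "g \<in> G'" for g l
  proof (induction l)
    case Nil
    have "dg g \<le> s" unfolding s_def using that assms(4) by (intro Max_ge) auto
    then show ?case using dg[of g] L.word_span_mono[of "dg g" s G] by auto
  next
    case (Cons h l)
    then show ?case using B_step[OF Cons, of h] by (simp add: algebra_simps)
  qed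
  have upper: "?f i \<le> card G * (s + Suc b) ^ ?q * Suc i ^ ?q" for i
  proof -
    obtain T where T: "finite T" "card T \<le> card G * (s + Suc b * i) ^ ?q"
      "L.word_span G (s + Suc b * i) \<subseteq> L.span T"
      using L_growth_upper[OF assms(1)] by blast
    have "B.word_span G' (Suc i) \<subseteq> L.word_span G (s + Suc b * i)"
    proof (rule B.word_span_le[OF L.subspace_word_span])
      fix l :: "'h list" and g assume l: "length l < Suc i" and g: "g \<in> G'"
      have "Suc b * length l \<le> Suc b * i" using l by (intro mult_left_mono) auto
      then show "foldr B l g \<in> L.word_span G (s + Suc b * i)"
        using s[OF g, of l] L.word_span_mono[of "s + Suc b * length l" "s + Suc b * i" G] by auto
    qed
    then have "?f i \<le> card T" using T by (intro L.dim_le_card) auto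
    also have "\<dots> \<le> card G * (s + Suc b * i) ^ ?q" by (rule T)
    also have "\<dots> \<le> card G * ((s + Suc b) * Suc i) ^ ?q"
      by (intro mult_left_mono power_mono) (auto simp: algebra_simps)
    finally show ?thesis by (simp only: power_mult_distrib mult.assoc)
  qed
  obtain dB where dB: "\<And>u. u \<in> B.word_span G' (dB u)" using gen' by metis
  define t where "t = Max (insert 0 (dB ` G))"
  have lower: "Suc i ^ ?q \<le> card G * ?f (t + ?q * i)" for i
  proof -
    let ?W = "B.word_span G' (Suc (t + ?q * i))"
    obtain T where T: "T \<subseteq> ?W" "L.independent T" "?W \<subseteq> L.span T" "card T = L.dim ?W"
      by (rule L.basis_exists)
    \<comment> \<open>Finiteness comes from the finitely many monomials that span this
      piece.\<close>
    have "finite T"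
    proof -
      have fin: "finite (B.monomial ` ({\<mu> :: 'h \<Rightarrow> nat. degree_of \<mu> < Suc (t + ?q * i)} \<times> G'))"
        using assms(4) finite_bounded_degree by blast
      have "?W = L.span (B.monomial ` ({\<mu> :: 'h \<Rightarrow> nat. degree_of \<mu> < Suc (t + ?q * i)} \<times> G'))"
        unfolding B.word_span_eq_monomial by (intro arg_cong[of _ _ L.span] image_cong) auto
      then show ?thesis using L.independent_span_bound[OF fin T(2)] T(1) by simp
    qed
    have start: "g \<in> B.word_span G' t" if "g \<in> G" for g
    proof -
      have "dB g \<le> t" unfolding t_def using that assms(1) by (intro Max_ge) auto
      then show ?thesis using dB[of g] B.word_span_mono[of "dB g" t G'] by auto
    qed
    have word: "foldr R l g \<in> B.word_span G' (t + length l)" if "g \<in> G" for l g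
      by (induction l) (auto simp: start that intro: R_word_span_B)
    have "foldr R (monomial_word \<mu>) g \<in> L.span T" if "g \<in> G" "degree_of \<mu> \<le> ?q * i" for \<mu> g
      using word[OF that(1), of "monomial_word \<mu>"] T(3) that(2)
        B.word_span_mono[of "t + length (monomial_word \<mu>)" "Suc (t + ?q * i)" G']
      by (auto simp: length_monomial_word)
    then show ?thesis
      using R_growth_lower[OF assms(1) gen assms(3) \<open>finite T\<close>, of i] T(4) by simp
  qed
  have "p \<noteq> 0 \<and> degree p = ?q"
    by (rule degree_eq_of_bounds[OF p upper lower]) auto
  then show ?thesis using p by blast
qed

end

section \<open>Weyl algebra actions\<close>

lemma UNIV_weyl_gen: "(UNIV :: 'n weyl_gen set) = range GX \<union> range GD"
proof -
  have "g \<in> range GX \<union> range GD" for g :: "'n weyl_gen" by (cases g) auto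
  then show ?thesis by blast
qed

instance weyl_gen :: (finite) finite
  by standard (simp add: UNIV_weyl_gen)

lemma sum_weyl_gen: "(\<Sum>g\<in>(UNIV :: 'n::finite weyl_gen set). f g) = (\<Sum>i\<in>UNIV. f (GX i)) + (\<Sum>i\<in>UNIV. f (GD i))"
  unfolding UNIV_weyl_gen
  by (subst sum.union_disjoint) (auto simp: sum.reindex inj_on_def)

lemma card_weyl_gen: "CARD('n::finite weyl_gen) = CARD('n) + CARD('n)"
  using sum_weyl_gen[where 'n = 'n, of "\<lambda>_. 1 :: nat"] by simp

definition weyl_generator :: "'n weyl_gen \<Rightarrow> ('k::field, 'n) weyl" where
  "weyl_generator = case_weyl_gen wX wD"

lemma weyl_generator_simps [simp]: "weyl_generator (GX i) = wX i" "weyl_generator (GD i) = wD i"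
  by (simp_all add: weyl_generator_def)

text \<open>The commutators of the generators: the standard symplectic form, up to the choice of
  sign.\<close>

fun weyl_form :: "'n weyl_gen \<Rightarrow> 'n weyl_gen \<Rightarrow> 'k::field" where
  "weyl_form (GD i) (GX j) = (if i = j then 1 else 0)"
| "weyl_form (GX i) (GD j) = (if i = j then - 1 else 0)"
| "weyl_form _ _ = 0"

lemma weyl_generator_commute:
  "weyl_generator g * weyl_generator h =
     weyl_generator h * weyl_generator g + weyl_scale (weyl_form g h) (1 :: ('k::field, 'n) weyl)"
proof -
  have dx: "wD i * wX j = wX j * wD i + (if i = j then 1 else (0 :: ('k, 'n) weyl))" for i j
    using wD_wX[of i j] by (simp add: algebra_simps)
  show ?thesis
    by (cases g; cases h) (auto simp: wX_wX wD_wD dx)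
qed

lemma nondegenerate_weyl_form:
  "nondegenerate (weyl_form :: 'n weyl_gen \<Rightarrow> _ \<Rightarrow> 'k::field)"
  "nondegenerate (\<lambda>(g :: 'n weyl_gen) h. - weyl_form g h :: 'k)"
proof -
  have ex: "\<exists>h e. e \<noteq> (0 :: 'k) \<and> (\<forall>g'. weyl_form h g' = (if g' = g then e else 0))" for g :: "'n weyl_gen"
  proof (cases g)
    case (GX i)
    have "weyl_form (GD i) g' = (if g' = g then (1 :: 'k) else 0)" for g'
      unfolding GX by (cases g') auto
    then show ?thesis by (intro exI[of _ "GD i"] exI[of _ 1]) simp
  next
    case (GD i)
    have "weyl_form (GX i) g' = (if g' = g then (- 1 :: 'k) else 0)" for g'
      unfolding GD by (cases g') auto
    then show ?thesis by (intro exI[of _ "GX i"] exI[of _ "- 1"]) simp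
  qed
  show "nondegenerate (weyl_form :: 'n weyl_gen \<Rightarrow> _ \<Rightarrow> 'k)"
    using ex by (simp add: nondegenerate_def)
  show "nondegenerate (\<lambda>(g :: 'n weyl_gen) h. - weyl_form g h :: 'k)"
    unfolding nondegenerate_def
  proof
    fix g :: "'n weyl_gen"
    obtain h and e :: 'k where "e \<noteq> 0" "\<And>g'. weyl_form h g' = (if g' = g then e else 0)"
      using ex[of g] by metis
    then show "\<exists>h e. e \<noteq> 0 \<and> (\<forall>g'. - weyl_form h g' = (if g' = g then e else (0 :: 'k)))"
      by (intro exI[of _ h] exI[of _ "- e"]) simp
  qed
qed

lemma weyl_spanned_by_words:
  "a \<in> weyl.span (range (\<lambda>l. prod_list (map weyl_generator l) :: ('k::field, 'n) weyl))"
proof -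
  have word: "abs_weyl (Poly_Mapping.single (Word l) 1) = (prod_list (map weyl_generator l) :: ('k, 'n) weyl)" for l
  proof (induction l)
    case Nil
    have "Poly_Mapping.single (Word []) 1 = (1 :: ('k, 'n weyl_gen) free_algebra)"
      by (simp add: zero_free_monoid_def[symmetric])
    then show ?case by (simp add: one_weyl.abs_eq)
  next
    case (Cons g l)
    have "Poly_Mapping.single (Word (g # l)) 1 =
        (free_var g * Poly_Mapping.single (Word l) 1 :: ('k, 'n weyl_gen) free_algebra)"
      by (simp add: free_var_def mult_single)
    moreover have "abs_weyl (free_var g) = (weyl_generator g :: ('k, 'n) weyl)"
      by (cases g) (simp_all add: wX.abs_eq wD.abs_eq)
    ultimately show ?case by (simp add: times_weyl.abs_eq[symmetric] Cons)
  qed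
  have "abs_weyl p \<in> weyl.span (range (\<lambda>l. prod_list (map weyl_generator l) :: ('k, 'n) weyl))" for p
  proof (induction p rule: free_algebra_induct)
    case (single w c)
    obtain l where w: "w = Word l" by (cases w)
    have "Poly_Mapping.single w c = free_scale c (Poly_Mapping.single w 1)"
      by (simp add: free_scale_def mult_single)
    then have "abs_weyl (Poly_Mapping.single w c) = weyl_scale c (prod_list (map weyl_generator l) :: ('k, 'n) weyl)"
      by (simp add: weyl_scale.abs_eq[symmetric] w word)
    then show ?case by (simp add: weyl.span_scale weyl.span_base)
  next
    case (add p q)
    then show ?case by (simp add: plus_weyl.abs_eq[symmetric] weyl.span_add)
  qed
  moreover obtain p where "a = abs_weyl p" by (metis Quotient3_abs_rep Quotient3_weyl)
  ultimately show ?thesis by simp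
qed

text \<open>\<open>act\<close> is a left or a right action of the Weyl algebra; accordingly \<open>mult\<close> multiplies by
  generators from the left or from the right.\<close>

locale weyl_action =
  M: quasi_commuting scale opr \<omega> + A: quasi_commuting weyl_scale mult \<omega>
  for scale :: "'k::field \<Rightarrow> 'm::ab_group_add \<Rightarrow> 'm"
    and opr :: "'n::finite weyl_gen \<Rightarrow> 'm \<Rightarrow> 'm" and \<omega>
    and mult :: "'n weyl_gen \<Rightarrow> ('k, 'n) weyl \<Rightarrow> ('k, 'n) weyl" +
  fixes act :: "('k, 'n) weyl \<Rightarrow> 'm \<Rightarrow> 'm"
  assumes act_plus: "act (a + b) m = act a m + act b m"
    and act_ascale: "act (weyl_scale c a) m = scale c (act a m)"
    and act_one: "act 1 m = m"
    and act_mult: "act (mult g a) m = opr g (act a m)"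
    and mult_generates: "\<exists>d. a \<in> A.word_span {1} d"
begin

lemma act_word: "act (foldr mult l 1) m = foldr opr l m"
  by (induction l) (auto simp: act_one act_mult)

lemma act_zero: "act 0 m = 0"
  using act_plus[of 0 0 m] by simp

lemma act_sum: "act (\<Sum>i\<in>I. f i) m = (\<Sum>i\<in>I. act (f i) m)"
  by (induction I rule: infinite_finite_induct) (auto simp: act_zero act_plus)

lemma subspace_act_preimage: "M.subspace N \<Longrightarrow> A.subspace {a. act a m \<in> N}"
  by (simp add: M.subspace_def A.subspace_def act_zero act_plus act_ascale)

lemma act_word_span:
  assumes "a \<in> A.word_span {1} d" "m \<in> G"
  shows "act a m \<in> M.word_span G d"
proof -
  have "A.word_span {1} d \<subseteq> {a. act a m \<in> M.word_span G d}"
    by (rule A.word_span_le[OF subspace_act_preimage[OF M.subspace_word_span]])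
      (use assms(2) in \<open>auto simp: act_word intro: M.word_in_word_span\<close>)
  then show ?thesis using assms(1) by blast
qed

lemma act_in_closed:
  assumes "M.subspace N" "\<And>g u. u \<in> N \<Longrightarrow> opr g u \<in> N" "m \<in> N"
  shows "act a m \<in> N"
proof -
  obtain d where "a \<in> A.word_span {1} d" using mult_generates by blast
  then have "act a m \<in> M.word_span {m} d" by (rule act_word_span) simp
  moreover have "foldr opr l m \<in> N" for l by (induction l) (auto simp: assms)
  then have "M.word_span {m} d \<subseteq> N" by (intro M.word_span_le assms) auto
  ultimately show ?thesis by blast
qed

lemma submodule_iff: "submodule act N \<longleftrightarrow> M.subspace N \<and> (\<forall>g. \<forall>u\<in>N. opr g u \<in> N)"
proof
  assume N: "submodule act N"
  have "scale c u \<in> N" if "u \<in> N" for c u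
    using N that act_ascale[of c 1 u] by (auto simp: submodule_def act_one) metis
  moreover have "opr g u \<in> N" if "u \<in> N" for g u
    using N that act_mult[of g 1 u] by (auto simp: submodule_def act_one) metis
  ultimately show "M.subspace N \<and> (\<forall>g. \<forall>u\<in>N. opr g u \<in> N)"
    using N by (auto simp: submodule_def M.subspace_def)
next
  assume "M.subspace N \<and> (\<forall>g. \<forall>u\<in>N. opr g u \<in> N)"
  then show "submodule act N"
    using act_in_closed[of N] by (auto simp: submodule_def M.subspace_def)
qed

text \<open>The increasing union of the pieces is a submodule containing \<open>G\<close>, and every
  submodule containing \<open>G\<close> contains all pieces.\<close>

lemma generates_iff: "generates act G \<longleftrightarrow> (\<forall>u. \<exists>d. u \<in> M.word_span G d)"
proof
  assume gen: "generates act G"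
  have "submodule act (\<Union>d. M.word_span G d)"
    unfolding submodule_iff using M.subspace_UN_word_span M.opr_word_span by blast
  moreover have "G \<subseteq> (\<Union>d. M.word_span G d)"
    using M.word_in_word_span[of "[]" "Suc 0"] by fastforce
  ultimately have "submodule act hull G \<subseteq> (\<Union>d. M.word_span G d)"
    by (intro hull_minimal)
  then show "\<forall>u. \<exists>d. u \<in> M.word_span G d" using gen by (auto simp: generates_def)
next
  assume *: "\<forall>u. \<exists>d. u \<in> M.word_span G d"
  have "UNIV \<subseteq> N" if "submodule act N" "G \<subseteq> N" for N
  proof -
    have N: "M.subspace N" "\<And>g u. u \<in> N \<Longrightarrow> opr g u \<in> N" using that(1) by (auto simp: submodule_iff)
    have "foldr opr l g \<in> N" if "g \<in> G" for l g
      by (induction l) (use \<open>G \<subseteq> N\<close> that N in auto)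
    then have "M.word_span G d \<subseteq> N" for d by (intro M.word_span_le N)
    then show ?thesis using * by blast
  qed
  then show "generates act G" unfolding generates_def hull_def by blast
qed

text \<open>The ordered monomials span the algebra, and a combination with all coefficients zero
  would be \<open>0\<close>. The condition \<open>a \<noteq> 0\<close> thus becomes a non-zero
  coefficient, the form in which the relation arguments take it.\<close>

lemma act_eq_monomial_sum:
  assumes "a \<noteq> 0"
  shows "\<exists>S c. finite S \<and> (\<exists>\<mu>\<in>S. c \<mu> \<noteq> 0) \<and>
    (\<forall>m. act a m = (\<Sum>\<mu>\<in>S. scale (c \<mu>) (foldr opr (monomial_word \<mu>) m)))"
proof -
  let ?f = "\<lambda>\<mu>. foldr mult (monomial_word \<mu>) 1"
  obtain d where "a \<in> A.word_span {1} d" using mult_generates by blast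
  also have "A.word_span {1} d = A.span (?f ` {\<mu>. degree_of \<mu> < d})"
    unfolding A.word_span_eq_ordered[of monomial_word, OF refl] by (rule arg_cong[of _ _ A.span]) auto
  finally obtain T r where T: "finite T" "T \<subseteq> ?f ` {\<mu>. degree_of \<mu> < d}" "a = (\<Sum>b\<in>T. weyl_scale (r b) b)"
    unfolding A.span_explicit by blast
  \<comment> \<open>Chooses one exponent for each element of \<open>T\<close>, so that the sum can
    be indexed by exponents.\<close>
  from iffD1[OF subset_image_inj T(2)] obtain S where S: "inj_on ?f S" "T = ?f ` S"
    by (elim exE conjE)
  have a: "a = (\<Sum>\<mu>\<in>S. weyl_scale (r (?f \<mu>)) (?f \<mu>))"
    using T(3) S by (simp add: sum.reindex)
  have "\<exists>\<mu>\<in>S. r (?f \<mu>) \<noteq> 0"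
  proof (rule ccontr)
    assume "\<not> ?thesis"
    then have "a = 0" unfolding a by (intro sum.neutral) auto
    then show False using assms by simp
  qed
  moreover have "finite S" using T(1) S by (simp add: finite_image_iff)
  moreover have "act a m = (\<Sum>\<mu>\<in>S. scale (r (?f \<mu>)) (foldr opr (monomial_word \<mu>) m))" for m
    unfolding a by (simp add: act_sum act_ascale act_word)
  ultimately show ?thesis by (intro exI[of _ S] exI[of _ "\<lambda>\<mu>. r (?f \<mu>)"]) simp
qed

end

section \<open>Left and right modules as families of operators\<close>

lemma quasi_commuting_left_mult:
  "quasi_commuting weyl_scale (\<lambda>g a. weyl_generator g * a) (weyl_form :: 'n::finite weyl_gen \<Rightarrow> _ \<Rightarrow> 'k::field)"
proof
  fix g h :: "'n weyl_gen" and u v :: "('k, 'n) weyl" and c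
  show "weyl_generator g * (u + v) = weyl_generator g * u + weyl_generator g * v"
    by (simp add: distrib_left)
  show "weyl_generator g * weyl_scale c v = weyl_scale c (weyl_generator g * v)"
    by (rule weyl_scale_mult_right)
  show "weyl_generator g * (weyl_generator h * v) =
      weyl_generator h * (weyl_generator g * v) + weyl_scale (weyl_form g h) v"
    unfolding mult.assoc[symmetric] weyl_generator_commute[of g h]
    by (simp add: distrib_right weyl_scale_mult_left)
qed

text \<open>Composing right multiplications reverses the order of products, hence the opposite sign
  of the form.\<close>

lemma quasi_commuting_right_mult:
  "quasi_commuting weyl_scale (\<lambda>g a. a * weyl_generator g)
     (\<lambda>(g :: 'n::finite weyl_gen) h. - weyl_form g h :: 'k::field)"
proof
  fix g h :: "'n weyl_gen" and u v :: "('k, 'n) weyl" and c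
  show "(u + v) * weyl_generator g = u * weyl_generator g + v * weyl_generator g"
    by (simp add: distrib_right)
  show "weyl_scale c v * weyl_generator g = weyl_scale c (v * weyl_generator g)"
    by (rule weyl_scale_mult_left)
  show "v * weyl_generator h * weyl_generator g =
      v * weyl_generator g * weyl_generator h + weyl_scale (- weyl_form g h) v"
    unfolding mult.assoc weyl_generator_commute[of g h]
    by (simp add: distrib_left weyl_scale_mult_right)
qed

lemma foldr_left_mult: "foldr (\<lambda>g a. weyl_generator g * a) l 1 = prod_list (map weyl_generator l)"
  by (induction l) auto

lemma foldr_right_mult: "foldr (\<lambda>g a. a * weyl_generator g) l 1 = prod_list (map weyl_generator (rev l))"
  by (induction l) auto

lemma weyl_action_left:
  assumes "algebra_left_module weyl_scale scale (act :: ('k::field, 'n::finite) weyl \<Rightarrow> 'm::ab_group_add \<Rightarrow> 'm)"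
  shows "weyl_action scale (\<lambda>g. act (weyl_generator g)) weyl_form (\<lambda>g a. weyl_generator g * a) act"
proof -
  interpret algebra_left_module weyl_scale scale act by fact
  interpret A: quasi_commuting weyl_scale "\<lambda>g a. weyl_generator g * a" "weyl_form :: 'n weyl_gen \<Rightarrow> _ \<Rightarrow> 'k"
    by (rule quasi_commuting_left_mult)
  show ?thesis
  proof
    fix g h :: "'n weyl_gen" and a b and m v c
    show "act (weyl_generator g) (act (weyl_generator h) v) =
        act (weyl_generator h) (act (weyl_generator g) v) + scale (weyl_form g h) v"
      unfolding lact_times[symmetric] weyl_generator_commute[of g h]
      by (simp add: lact_plus lact_ascale lact_one)
    have "range (\<lambda>l. prod_list (map weyl_generator l)) \<subseteq> (\<Union>d. A.word_span {1} d)"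
      using A.word_in_word_span[of _ "Suc _" 1 "{1}"] unfolding foldr_left_mult by blast
    from weyl.span_minimal[OF this A.subspace_UN_word_span] show "\<exists>d. a \<in> A.word_span {1} d"
      using weyl_spanned_by_words[of a] by blast
  qed (simp_all add: lact_plus lact_add lact_times lact_one lact_ascale lact_scale)
qed

lemma weyl_action_right:
  assumes "algebra_right_module weyl_scale scale (ract :: 'm::ab_group_add \<Rightarrow> ('k::field, 'n::finite) weyl \<Rightarrow> 'm)"
  shows "weyl_action scale (\<lambda>g m. ract m (weyl_generator g)) (\<lambda>g h. - weyl_form g h)
    (\<lambda>g a. a * weyl_generator g) (\<lambda>a m. ract m a)"
proof -
  interpret algebra_right_module weyl_scale scale ract by fact
  interpret A: quasi_commuting weyl_scale "\<lambda>g a. a * weyl_generator g" "\<lambda>(g :: 'n weyl_gen) h. - weyl_form g h :: 'k"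
    by (rule quasi_commuting_right_mult)
  show ?thesis
  proof
    fix g h :: "'n weyl_gen" and a b and m v c
    show "ract (ract v (weyl_generator h)) (weyl_generator g) =
        ract (ract v (weyl_generator g)) (weyl_generator h) + scale (- weyl_form g h) v"
      unfolding ract_times[symmetric] weyl_generator_commute[of g h]
      by (simp add: ract_plus ract_ascale ract_one)
    have "prod_list (map weyl_generator l) \<in> (\<Union>d. A.word_span {1} d)" for l
      using A.word_in_word_span[of "rev l" "Suc (length l)" 1 "{1}"] unfolding foldr_right_mult by auto
    then have "range (\<lambda>l. prod_list (map weyl_generator l)) \<subseteq> (\<Union>d. A.word_span {1} d)" by blast
    from weyl.span_minimal[OF this A.subspace_UN_word_span] show "\<exists>d. a \<in> A.word_span {1} d"
      using weyl_spanned_by_words[of a] by blast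
  qed (simp_all add: ract_plus ract_add ract_times ract_one ract_ascale ract_scale)
qed

lemma wX_monomial_word:
  "\<exists>w. (\<forall>g. count (mset w) g = case_weyl_gen \<alpha> (\<lambda>_. 0) g) \<and>
     wX_monomial \<alpha> = (prod_list (map weyl_generator w) :: ('k::field, 'n::finite) weyl)"
proof -
  \<comment> \<open>The fold visits the indices in an unspecified order, so only the number of
    occurrences of each letter is tracked.\<close>
  have "\<exists>w. (\<forall>g. count (mset w) g = case_weyl_gen (\<lambda>i. if i \<in> S then \<alpha> i else 0) (\<lambda>_. 0) g) \<and>
     Finite_Set.fold (\<lambda>i a. wX i ^ \<alpha> i * a) 1 S = (prod_list (map weyl_generator w) :: ('k, 'n) weyl)" if "finite S" for S
    using that
  proof (induction S)
    case empty
    then show ?case by (intro exI[of _ "[]"]) (auto split: weyl_gen.split)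
  next
    case (insert i S)
    then obtain w where w: "\<forall>g. count (mset w) g = case_weyl_gen (\<lambda>i. if i \<in> S then \<alpha> i else 0) (\<lambda>_. 0) g"
      "Finite_Set.fold (\<lambda>i a. wX i ^ \<alpha> i * a) 1 S = (prod_list (map weyl_generator w) :: ('k, 'n) weyl)" by blast
    interpret comp_fun_commute "\<lambda>i (a :: ('k, 'n) weyl). wX i ^ \<alpha> i * a" by (rule comp_fun_commute_wX)
    show ?case
      using insert.hyps w
      by (intro exI[of _ "replicate (\<alpha> i) (GX i) @ w"]) (auto split: weyl_gen.split)
  qed
  from this[of UNIV] show ?thesis by (simp add: wX_monomial_def cong: weyl_gen.case_cong)
qed

lemma wD_monomial_word:
  "\<exists>w. (\<forall>g. count (mset w) g = case_weyl_gen (\<lambda>_. 0) \<beta> g) \<and>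
     wD_monomial \<beta> = (prod_list (map weyl_generator w) :: ('k::field, 'n::finite) weyl)"
proof -
  have "\<exists>w. (\<forall>g. count (mset w) g = case_weyl_gen (\<lambda>_. 0) (\<lambda>i. if i \<in> S then \<beta> i else 0) g) \<and>
     Finite_Set.fold (\<lambda>i a. wD i ^ \<beta> i * a) 1 S = (prod_list (map weyl_generator w) :: ('k, 'n) weyl)" if "finite S" for S
    using that
  proof (induction S)
    case empty
    then show ?case by (intro exI[of _ "[]"]) (auto split: weyl_gen.split)
  next
    case (insert i S)
    then obtain w where w: "\<forall>g. count (mset w) g = case_weyl_gen (\<lambda>_. 0) (\<lambda>i. if i \<in> S then \<beta> i else 0) g"
      "Finite_Set.fold (\<lambda>i a. wD i ^ \<beta> i * a) 1 S = (prod_list (map weyl_generator w) :: ('k, 'n) weyl)" by blast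
    interpret comp_fun_commute "\<lambda>i (a :: ('k, 'n) weyl). wD i ^ \<beta> i * a" by (rule comp_fun_commute_wD)
    show ?case
      using insert.hyps w
      by (intro exI[of _ "replicate (\<beta> i) (GD i) @ w"]) (auto split: weyl_gen.split)
  qed
  from this[of UNIV] show ?thesis by (simp add: wD_monomial_def cong: weyl_gen.case_cong)
qed

text \<open>Each basis monomial is a word with prescribed letters, and
  \<open>word_span_eq_ordered\<close> accepts any choice of such words. The index
  \<open>Suc i\<close> is due to the strict bound in \<open>word_span\<close>.\<close>

lemma bernstein_eq_word_span:
  "(bernstein i :: ('k::field, 'n::finite) weyl set) =
     quasi_commuting.word_span weyl_scale (\<lambda>g a. weyl_generator g * a) {1} (Suc i)"
proof -
  interpret A: quasi_commuting weyl_scale "\<lambda>g a. weyl_generator g * a" "weyl_form :: 'n weyl_gen \<Rightarrow> _ \<Rightarrow> 'k"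
    by (rule quasi_commuting_left_mult)
  have "\<exists>w. mset w = mset (monomial_word \<mu>) \<and>
      wX_monomial (\<mu> \<circ> GX) * wD_monomial (\<mu> \<circ> GD) = (prod_list (map weyl_generator w) :: ('k, 'n) weyl)"
    for \<mu> :: "'n weyl_gen \<Rightarrow> nat"
  proof -
    obtain w w' where "\<forall>g. count (mset w) g = case_weyl_gen (\<mu> \<circ> GX) (\<lambda>_. 0) g"
      "wX_monomial (\<mu> \<circ> GX) = (prod_list (map weyl_generator w) :: ('k, 'n) weyl)"
      "\<forall>g. count (mset w') g = case_weyl_gen (\<lambda>_. 0) (\<mu> \<circ> GD) g"
      "wD_monomial (\<mu> \<circ> GD) = (prod_list (map weyl_generator w') :: ('k, 'n) weyl)"
      using wX_monomial_word wD_monomial_word by metis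
    then show ?thesis
      unfolding mset_monomial_word_eq_iff
      by (intro exI[of _ "w @ w'"]) (auto split: weyl_gen.split)
  qed
  then obtain nf where nf: "\<And>\<mu>. mset (nf \<mu>) = mset (monomial_word \<mu>)"
    "\<And>\<mu>. wX_monomial (\<mu> \<circ> GX) * wD_monomial (\<mu> \<circ> GD) = (prod_list (map weyl_generator (nf \<mu>)) :: ('k, 'n) weyl)"
    by metis
  have "{wX_monomial \<alpha> * wD_monomial \<beta> | \<alpha> \<beta>. (\<Sum>i\<in>UNIV. \<alpha> i) + (\<Sum>i\<in>UNIV. \<beta> i) \<le> i} =
      {foldr (\<lambda>g a. weyl_generator g * a) (nf \<mu>) (g :: ('k, 'n) weyl) | \<mu> g. degree_of \<mu> < Suc i \<and> g \<in> {1}}"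
    (is "?X = ?Y")
  proof (intro equalityI subsetI)
    fix x assume "x \<in> ?X"
    then obtain \<alpha> \<beta> where x: "x = wX_monomial \<alpha> * wD_monomial \<beta>"
      "(\<Sum>i\<in>UNIV. \<alpha> i) + (\<Sum>i\<in>UNIV. \<beta> i) \<le> i" by blast
    let ?\<mu> = "case_weyl_gen \<alpha> \<beta>"
    have "?\<mu> \<circ> GX = \<alpha>" "?\<mu> \<circ> GD = \<beta>" by auto
    then have "x = foldr (\<lambda>g a. weyl_generator g * a) (nf ?\<mu>) 1"
      using nf(2)[of ?\<mu>] by (simp add: x foldr_left_mult)
    moreover have "degree_of ?\<mu> < Suc i" using x(2) by (simp add: degree_of_def sum_weyl_gen)
    ultimately show "x \<in> ?Y" by blast
  next
    fix x assume "x \<in> ?Y"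
    then obtain \<mu> where "x = foldr (\<lambda>g a. weyl_generator g * a) (nf \<mu>) 1" "degree_of \<mu> < Suc i" by blast
    then have "x = wX_monomial (\<mu> \<circ> GX) * wD_monomial (\<mu> \<circ> GD)"
      "(\<Sum>i\<in>UNIV. (\<mu> \<circ> GX) i) + (\<Sum>i\<in>UNIV. (\<mu> \<circ> GD) i) \<le> i"
      by (simp_all add: nf(2) foldr_left_mult degree_of_def sum_weyl_gen)
    then show "x \<in> ?X" by blast
  qed
  then show ?thesis
    unfolding bernstein_def A.word_span_eq_ordered[of nf, OF nf(1)] by simp
qed

lemma bernstein_filtration_eq_word_span:
  assumes "algebra_left_module weyl_scale scale (act :: ('k::field, 'n::finite) weyl \<Rightarrow> 'm::ab_group_add \<Rightarrow> 'm)"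
    and "finite G"
  shows "bernstein_filtration act G i =
    quasi_commuting.word_span scale (\<lambda>g. act (weyl_generator g)) G (Suc i)"
proof -
  interpret weyl_action scale "\<lambda>g. act (weyl_generator g)" weyl_form "\<lambda>g a. weyl_generator g * a" act
    by (rule weyl_action_left[OF assms(1)])
  have B: "bernstein i = A.word_span {1} (Suc i)" by (rule bernstein_eq_word_span)
  show ?thesis
  proof
    show "bernstein_filtration act G i \<subseteq> M.word_span G (Suc i)"
      by (auto simp: bernstein_filtration_def B intro!: M.subspace_sum[OF M.subspace_word_span] act_word_span)
    show "M.word_span G (Suc i) \<subseteq> bernstein_filtration act G i"
    proof (rule M.word_span_le)
      show "M.subspace (bernstein_filtration act G i)"
      proof (rule M.subspaceI)
        have "(0 :: ('k, 'n) weyl) \<in> bernstein i" unfolding B by (rule weyl.subspace_0[OF A.subspace_word_span])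
        then have "(\<Sum>g\<in>G. act 0 g) \<in> bernstein_filtration act G i"
          unfolding bernstein_filtration_def by (intro CollectI exI[of _ "\<lambda>_. 0"]) auto
        then show "0 \<in> bernstein_filtration act G i" by (simp add: act_zero)
        fix u v c assume "u \<in> bernstein_filtration act G i"
        then obtain b where b: "u = (\<Sum>g\<in>G. act (b g) g)" "\<forall>g\<in>G. b g \<in> bernstein i"
          unfolding bernstein_filtration_def by blast
        have "scale c u = (\<Sum>g\<in>G. act (weyl_scale c (b g)) g)"
          by (simp add: b(1) M.scale_sum_right act_ascale)
        moreover have "\<forall>g\<in>G. weyl_scale c (b g) \<in> bernstein i"
          using b(2) weyl.subspace_scale[OF A.subspace_word_span] unfolding B by blast
        ultimately show "scale c u \<in> bernstein_filtration act G i"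
          unfolding bernstein_filtration_def by (intro CollectI exI[of _ "\<lambda>g. weyl_scale c (b g)"]) blast
        assume "v \<in> bernstein_filtration act G i"
        then obtain b' where b': "v = (\<Sum>g\<in>G. act (b' g) g)" "\<forall>g\<in>G. b' g \<in> bernstein i"
          unfolding bernstein_filtration_def by blast
        have "u + v = (\<Sum>g\<in>G. act (b g + b' g) g)"
          by (simp add: b(1) b'(1) sum.distrib act_plus)
        moreover have "\<forall>g\<in>G. b g + b' g \<in> bernstein i"
          using b(2) b'(2) weyl.subspace_add[OF A.subspace_word_span] unfolding B by blast
        ultimately show "u + v \<in> bernstein_filtration act G i"
          unfolding bernstein_filtration_def by (intro CollectI exI[of _ "\<lambda>g. b g + b' g"]) blast
      qed
      fix l :: "'n weyl_gen list" and g assume l: "length l < Suc i" and g: "g \<in> G"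
      \<comment> \<open>A single word at \<open>g\<close> is obtained from coefficients that vanish
        at all other generators.\<close>
      define b where "b h = (if h = g then foldr (\<lambda>g a. weyl_generator g * a) l 1 else (0 :: ('k, 'n) weyl))" for h
      have "\<forall>h\<in>G. b h \<in> bernstein i"
        using l A.word_in_word_span[of l "Suc i" 1 "{1}"] weyl.subspace_0[OF A.subspace_word_span]
        by (auto simp: B b_def)
      moreover have "(\<Sum>h\<in>G. act (b h) h) = (\<Sum>h\<in>G. if h = g then foldr (\<lambda>g. act (weyl_generator g)) l g else 0)"
        by (intro sum.cong) (auto simp: b_def act_word act_zero)
      then have "(\<Sum>h\<in>G. act (b h) h) = foldr (\<lambda>g. act (weyl_generator g)) l g"
        using g assms(2) by simp
      ultimately show "foldr (\<lambda>g. act (weyl_generator g)) l g \<in> bernstein_filtration act G i"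
        unfolding bernstein_filtration_def by (intro CollectI exI[of _ b]) simp
    qed
  qed
qed

section \<open>The theorem for commuting families, and then for bimodules\<close>

lemma holonomic_of_combined_pair:
  fixes act :: "('k::field_char_0, 'j::finite) weyl \<Rightarrow> 'm::ab_group_add \<Rightarrow> 'm"
    and L :: "'g::finite \<Rightarrow> 'm \<Rightarrow> 'm"
  assumes act: "algebra_left_module weyl_scale scale act"
    and pair: "combined_pair scale L R \<omega>L \<omega>R (\<lambda>g. act (weyl_generator g)) weyl_form"
    and card: "CARD('g) = CARD('j)"
    and G: "finite G" "\<And>u. \<exists>d. u \<in> quasi_commuting.word_span scale L G d"
  shows "holonomic scale act"
proof -
  interpret combined_pair scale L R \<omega>L \<omega>R "\<lambda>g. act (weyl_generator g)" weyl_form by fact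
  interpret W: weyl_action scale "\<lambda>g. act (weyl_generator g)" weyl_form "\<lambda>g a. weyl_generator g * a" act
    by (rule weyl_action_left[OF act])
  have "generates act G"
    unfolding W.generates_iff
  proof
    fix u
    have "L.word_span G d \<subseteq> B.word_span G d" for d
    proof (rule L.word_span_le[OF B.subspace_word_span])
      fix l :: "'g list" and g assume l: "length l < d" and g: "g \<in> G"
      have "foldr L l g \<in> B.word_span G (Suc (length l))"
        by (induction l) (use g B.word_in_word_span[of "[]" "Suc 0" g G] in \<open>auto intro: L_word_span_B\<close>)
      then show "foldr L l g \<in> B.word_span G d" using l B.word_span_mono[of "Suc (length l)" d G] by auto
    qed
    then show "\<exists>d. u \<in> B.word_span G d" using G(2)[of u] by blast
  qed
  then have "finitely_generated act" using G(1) by (auto simp: finitely_generated_def)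
  moreover have "has_dimension scale act CARD('j)" if "(UNIV :: 'm set) \<noteq> {0}"
    unfolding has_dimension_def
  proof (intro allI impI)
    fix G' :: "'m set" assume G': "finite G' \<and> generates act G'"
    then have "\<exists>d. u \<in> B.word_span G' d" for u by (simp add: W.generates_iff)
    from dimension_eq[OF G that _ this] G'
    show "\<exists>p :: rat poly. p \<noteq> 0 \<and> degree p = CARD('j) \<and>
        (\<forall>\<^sub>F i in sequentially. of_nat (L.dim (bernstein_filtration act G' i)) = poly p (of_nat i))"
      by (simp add: bernstein_filtration_eq_word_span[OF act] card)
  qed
  ultimately show ?thesis by (auto simp: holonomic_def)
qed

lemma cyclic_of_commuting_pair:
  fixes act :: "('k::field_char_0, 'n::finite) weyl \<Rightarrow> 'm::ab_group_add \<Rightarrow> 'm"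
  assumes pair: "commuting_pair scale L R \<omega>L \<omega>R" and action: "weyl_action scale L \<omega>L P act"
    and cyclic: "cyclic_module act" and nonzero: "(UNIV :: 'm set) \<noteq> {0}"
  shows "free_module act"
    and "\<And>N. submodule act N \<Longrightarrow> (\<And>g u. u \<in> N \<Longrightarrow> R g u \<in> N) \<Longrightarrow> N = {0} \<or> N = UNIV"
proof -
  interpret commuting_pair scale L R \<omega>L \<omega>R by fact
  interpret W: weyl_action scale L \<omega>L P act by fact
  obtain m where m: "generates act {m}" using cyclic by (auto simp: cyclic_module_def)
  have gen: "\<exists>d. u \<in> L.word_span {m} d" for u using m by (simp add: W.generates_iff)
  \<comment> \<open>Used with \<open>N = {0}\<close> for freeness and, at the end, with a non-zero
    element of \<open>N\<close> written as \<open>act a m\<close>.\<close>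
  have torsion: "N = UNIV" if N: "invariant N" and a: "a \<noteq> 0" "act a m \<in> N" for a N
  proof -
    obtain S c \<mu>0 where S: "finite S" "\<mu>0 \<in> S" "c \<mu>0 \<noteq> 0"
      "\<forall>m. act a m = (\<Sum>\<mu>\<in>S. scale (c \<mu>) (foldr L (monomial_word \<mu>) m))"
      using W.act_eq_monomial_sum[OF a(1)] by (elim exE bexE conjE)
    have "u \<in> N" for u
    proof (rule cyclic_relation_trivial[where c = c, OF N _ S(1-3)])
      show "\<exists>d. u \<in> L.span (L.word_span {m} d \<union> N)" for u
        using gen[of u] L.span_base by blast
      show "(\<Sum>\<mu>\<in>S. scale (c \<mu>) (foldr L (monomial_word \<mu>) m)) \<in> N"
        using a(2) S(4) by simp
    qed
    then show ?thesis by blast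
  qed
  have "module_basis act {m}"
    unfolding module_basis_def
  proof (intro conjI allI impI ballI)
    fix F f b assume F: "finite F" "F \<subseteq> {m}" "(\<Sum>b\<in>F. act (f b) b) = 0" "b \<in> F"
    then have "F = {m}" "b = m" by auto
    then have "act (f b) m = 0" using F(3) by simp
    then show "f b = 0" using torsion[OF invariant_0, of "f b"] nonzero by auto
  qed (rule m)
  then show "free_module act" by (auto simp: free_module_def)
  fix N assume N: "submodule act N" "\<And>g u. u \<in> N \<Longrightarrow> R g u \<in> N"
  have inv: "invariant N" using N by (auto simp: invariant_def W.submodule_iff)
  show "N = {0} \<or> N = UNIV"
  proof (cases "N \<subseteq> {0}")
    case True
    then show ?thesis using N(1) by (auto simp: submodule_def)
  next
    case False
    then obtain u where u: "u \<in> N" "u \<noteq> 0" by blast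
    have "submodule act (range (\<lambda>a. act a m))"
      unfolding W.submodule_iff
    proof (intro conjI allI ballI)
      show "L.subspace (range (\<lambda>a. act a m))"
        unfolding L.subspace_def
        by (auto simp: image_iff) (metis W.act_zero, metis W.act_plus, metis W.act_ascale)
      show "L g v \<in> range (\<lambda>a. act a m)" if "v \<in> range (\<lambda>a. act a m)" for g v
        using that by (auto simp: W.act_mult[symmetric])
    qed
    moreover have "{m} \<subseteq> range (\<lambda>a. act a m)" by (metis W.act_one insert_subsetI empty_subsetI rangeI)
    ultimately have "range (\<lambda>a. act a m) = UNIV"
      using m hull_minimal[of "{m}" "range (\<lambda>a. act a m)" "submodule act"] unfolding generates_def by auto
    then obtain a where "u = act a m" by (metis UNIV_I imageE)
    then show ?thesis using torsion[OF inv, of a] u W.act_zero by blast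
  qed
qed

theorem theorem2p1:
  fixes scale :: "'k::field_char_0 \<Rightarrow> 'm::ab_group_add \<Rightarrow> 'm"
    and lact :: "('k, 'n::finite) weyl \<Rightarrow> 'm \<Rightarrow> 'm"
    and ract :: "'m \<Rightarrow> ('k, 'n) weyl \<Rightarrow> 'm"
  assumes "algebra_bimodule weyl_scale scale lact ract"
  shows "(finitely_generated lact \<or> finitely_generated (\<lambda>a m. ract m a) \<longrightarrow>
            holonomic_bimodule scale lact ract) \<and>
         ((UNIV :: 'm set) \<noteq> {0} \<and> cyclic_module lact \<longrightarrow>
            free_module lact \<and> irreducible_bimodule lact ract) \<and>
         ((UNIV :: 'm set) \<noteq> {0} \<and> cyclic_module (\<lambda>a m. ract m a) \<longrightarrow>
            free_module (\<lambda>a m. ract m a) \<and> irreducible_bimodule lact ract)"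
proof -
  interpret algebra_bimodule weyl_scale scale lact ract by fact
  let ?L = "\<lambda>g. lact (weyl_generator g)" and ?R = "\<lambda>g m. ract m (weyl_generator g)"
  let ?\<omega> = "\<lambda>g h. - weyl_form g h"
  have left: "weyl_action scale ?L weyl_form (\<lambda>g a. weyl_generator g * a) lact"
    by (rule weyl_action_left) unfold_locales
  have right: "weyl_action scale ?R ?\<omega> (\<lambda>g a. a * weyl_generator g) (\<lambda>a m. ract m a)"
    by (rule weyl_action_right) unfold_locales
  interpret L: weyl_action scale ?L weyl_form "\<lambda>g a. weyl_generator g * a" lact by (rule left)
  interpret R: weyl_action scale ?R ?\<omega> "\<lambda>g a. a * weyl_generator g" "\<lambda>a m. ract m a" by (rule right)
  interpret LR: commuting_pair scale ?L ?R weyl_form ?\<omega>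
    by unfold_locales (simp_all add: lact_ract nondegenerate_weyl_form)
  interpret RL: commuting_pair scale ?R ?L ?\<omega> weyl_form
    by unfold_locales (simp_all add: lact_ract nondegenerate_weyl_form)
  define act where "act = bimodule_left_action scale lact ract"
  have "is_bimodule_left_action scale lact ract act"
    unfolding act_def by (rule is_bimodule_left_action) fact
  then have act: "algebra_left_module weyl_scale scale act"
    and gens: "\<And>i m. act (wX (Inl i)) m = lact (wX i) m" "\<And>i m. act (wD (Inl i)) m = lact (wD i) m"
      "\<And>i m. act (wX (Inr i)) m = ract m (wX i)" "\<And>i m. act (wD (Inr i)) m = - ract m (wD i)"
    by (auto simp: is_bimodule_left_action_def)
  interpret B: weyl_action scale "\<lambda>g. act (weyl_generator g)" weyl_form "\<lambda>g a. weyl_generator g * a" act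
    by (rule weyl_action_left[OF act])
  \<comment> \<open>The factor \<open>-1\<close> occurs only for the derivations of the second copy
    of the index set.\<close>
  have cases: "(\<exists>g. act (weyl_generator h) = scale 1 \<circ> ?L g) \<or> (\<exists>g e. act (weyl_generator h) = scale e \<circ> ?R g)" for h
  proof (cases h)
    case (GX j)
    show ?thesis
    proof (cases j)
      case (Inl i)
      then show ?thesis using GX by (intro disjI1 exI[of _ "GX i"]) (simp add: fun_eq_iff gens)
    next
      case (Inr i)
      then show ?thesis using GX by (intro disjI2 exI[of _ "GX i"] exI[of _ 1]) (simp add: fun_eq_iff gens)
    qed
  next
    case (GD j)
    show ?thesis
    proof (cases j)
      case (Inl i)
      then show ?thesis using GD by (intro disjI1 exI[of _ "GD i"]) (simp add: fun_eq_iff gens)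
    next
      case (Inr i)
      then show ?thesis using GD by (intro disjI2 exI[of _ "GD i"] exI[of _ "- 1"]) (simp add: fun_eq_iff gens)
    qed
  qed
  have Lg: "\<exists>h e. \<forall>u. ?L g u = scale e (act (weyl_generator h) u)" for g
  proof (cases g)
    case (GX i)
    then show ?thesis by (intro exI[of _ "GX (Inl i)"] exI[of _ 1]) (simp add: gens)
  next
    case (GD i)
    then show ?thesis by (intro exI[of _ "GD (Inl i)"] exI[of _ 1]) (simp add: gens)
  qed
  have Rg: "\<exists>h e. \<forall>u. ?R g u = scale e (act (weyl_generator h) u)" for g
  proof (cases g)
    case (GX i)
    then show ?thesis by (intro exI[of _ "GX (Inr i)"] exI[of _ 1]) (simp add: gens)
  next
    case (GD i)
    then show ?thesis by (intro exI[of _ "GD (Inr i)"] exI[of _ "- 1"]) (simp add: gens)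
  qed
  have LRB: "combined_pair scale ?L ?R weyl_form ?\<omega> (\<lambda>g. act (weyl_generator g)) weyl_form"
  proof unfold_locales
    show "\<exists>g e. (\<forall>u. act (weyl_generator h) u = scale e (?L g u)) \<or> (\<forall>u. act (weyl_generator h) u = scale e (?R g u))" for h
      using cases[of h] by (metis comp_apply)
  qed (rule Lg Rg)+
  have RLB: "combined_pair scale ?R ?L ?\<omega> weyl_form (\<lambda>g. act (weyl_generator g)) weyl_form"
  proof unfold_locales
    show "\<exists>g e. (\<forall>u. act (weyl_generator h) u = scale e (?R g u)) \<or> (\<forall>u. act (weyl_generator h) u = scale e (?L g u))" for h
      using cases[of h] by (metis comp_apply)
  qed (rule Lg Rg)+
  \<comment> \<open>Both sides are \<open>2n\<close>: the number of generators of
    \<open>A_n\<close>, which governs the growth, and the number of variables of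
    \<open>A_2n\<close>, which is the dimension asked for.\<close>
  have card: "CARD('n weyl_gen) = CARD('n + 'n)" by (simp add: card_weyl_gen)
  have "holonomic_bimodule scale lact ract" if fg: "finitely_generated lact"
  proof -
    obtain G where "finite G" "generates lact G" using fg by (auto simp: finitely_generated_def)
    then show ?thesis
      using holonomic_of_combined_pair[OF act LRB card] by (simp add: holonomic_bimodule_def act_def L.generates_iff)
  qed
  moreover have "holonomic_bimodule scale lact ract" if fg: "finitely_generated (\<lambda>a m. ract m a)"
  proof -
    obtain G where "finite G" "generates (\<lambda>a m. ract m a) G" using fg by (auto simp: finitely_generated_def)
    then show ?thesis
      using holonomic_of_combined_pair[OF act RLB card] by (simp add: holonomic_bimodule_def act_def R.generates_iff)
  qed
  moreover have "free_module lact \<and> irreducible_bimodule lact ract"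
    if "(UNIV :: 'm set) \<noteq> {0}" "cyclic_module lact"
    using cyclic_of_commuting_pair[OF LR.commuting_pair_axioms left that(2,1)] that(1)
    by (auto simp: irreducible_bimodule_def R.submodule_iff)
  moreover have "free_module (\<lambda>a m. ract m a) \<and> irreducible_bimodule lact ract"
    if "(UNIV :: 'm set) \<noteq> {0}" "cyclic_module (\<lambda>a m. ract m a)"
    using cyclic_of_commuting_pair[OF RL.commuting_pair_axioms right that(2,1)] that(1)
    by (auto simp: irreducible_bimodule_def L.submodule_iff)
  ultimately show ?thesis by blast
qed

end
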